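(* Let $k \ge 4$ be an integer and let $\sigma_k := 1 - \dfrac{k}{2^k - 2}$. Then $$\left|\zeta(\sigma_k + it)\right| \le 1.546\, t^{1/(2^k - 2)}\log t \qquad\text{for all real } t \ge 3.$$
   Context: $\zeta$ denotes the Riemann zeta-function. *)

theory Defs
  imports "HOL-Complex_Analysis.Complex_Analysis"
begin

text \<open>
  The Riemann zeta-function is the analytic continuation to \<open>\<complex> - {1}\<close> of the Dirichlet series
  \<open>\<Sum>n\<ge>1. n powr (-s)\<close>, \<open>Re s > 1\<close>.  HOL functions being total, its value at the pole
  is set to \<open>0\<close>; this only serves to make the function unique.  Lemma \<open>ex1_riemann_zeta\<close> below
  shows that the description determines exactly one function.
\<close>

definition is_riemann_zeta :: "(complex \<Rightarrow> complex) \<Rightarrow> bool" where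
  "is_riemann_zeta f \<longleftrightarrow>
     f holomorphic_on - {1} \<and>
     (\<forall>s. Re s > 1 \<longrightarrow> (\<lambda>n. of_nat (Suc n) powr (- s)) sums f s) \<and>
     f 1 = 0"

definition riemann_zeta :: "complex \<Rightarrow> complex" where
  "riemann_zeta = (THE f. is_riemann_zeta f)"

definition zeta_sigma :: "nat \<Rightarrow> real" where
  "zeta_sigma k = 1 - real k / (2 ^ k - 2)"

subsection \<open>Existence and uniqueness of the continuation\<close>

lemma is_riemann_zeta_unique:
  assumes f: "is_riemann_zeta f" and g: "is_riemann_zeta g"
  shows "f = g"
proof
  fix s :: complex
  show "f s = g s"
  proof (cases "s = 1")
    case True
    then show ?thesis using f g by (simp add: is_riemann_zeta_def)
  next
    case False
    have "2 \<in> {s. Re s > 1}" by simp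
    hence ne: "{s. Re s > 1} \<noteq> {}" by blast
    show ?thesis
    proof (rule analytic_continuation_open[of "{s. Re s > 1}" "- {1}" f g s])
      show "connected (- {1::complex})" by (rule connected_punctured_universe) simp
      fix z assume "z \<in> {s. Re s > 1}"
      then show "f z = g z"
        using f g by (auto simp: is_riemann_zeta_def intro: sums_unique2)
    qed (use f g False ne in \<open>auto simp: is_riemann_zeta_def open_halfspace_Re_gt\<close>)
  qed
qed

lemma powr_one_plus_Taylor_bound:
  fixes R :: real and m :: nat
  assumes R: "R \<ge> 0"
  obtains C where "C \<ge> 0"
    "\<And>a x. norm (a::complex) \<le> R \<Longrightarrow> 0 \<le> x \<Longrightarrow> x \<le> 1 \<Longrightarrow>
       norm ((1 + of_real x) powr a - (\<Sum>j\<le>m. (a gchoose j) * of_real x ^ j)) \<le> C * x ^ Suc m"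
proof
  define C where "C = (\<Prod>l<Suc m. R + real l) * 2 powr R / fact m"
  show "C \<ge> 0" unfolding C_def using R by (intro divide_nonneg_pos mult_nonneg_nonneg prod_nonneg) auto
  fix a :: complex and x :: real
  assume a: "norm a \<le> R" and x: "0 \<le> x" "x \<le> 1"
  define f where "f = (\<lambda>i z. (\<Prod>l<i. a - of_nat l) * (1 + z) powr (a - of_nat i))"
  define S :: "complex set" where "S = closed_segment 0 (of_real x)"
  have S: "\<exists>y. z = of_real y \<and> 0 \<le> y \<and> y \<le> 1" if "z \<in> S" for z
  proof -
    from that obtain u where u: "z = of_real (u * x)" "0 \<le> u" "u \<le> 1"
      by (auto simp: S_def closed_segment_def scaleR_conv_of_real)
    have "u * x \<le> 1 * 1" using u x by (intro mult_mono) auto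
    with u x show ?thesis by (intro exI[of _ "u * x"]) auto
  qed
  have "norm (f 0 (of_real x) - (\<Sum>i\<le>m. f i 0 * (of_real x - 0) ^ i / fact i))
          \<le> ((\<Prod>l<Suc m. R + real l) * 2 powr R) * norm (complex_of_real x - 0) ^ Suc m / fact m"
  proof (rule complex_Taylor)
    show "convex S" by (simp add: S_def)
    show "0 \<in> S" "of_real x \<in> S" by (simp_all add: S_def)
  next
    fix i z assume "z \<in> S" "i \<le> m"
    then obtain y where y: "z = of_real y" "0 \<le> y" "y \<le> 1" using S by blast
    have nz: "1 + z \<notin> \<real>\<^sub>\<le>\<^sub>0"
    proof -
      have "1 + z = of_real (1 + y)" using y by simp
      then show ?thesis using y by (simp only: nonpos_Reals_of_real_iff)
    qed
    have "((\<lambda>z. (1 + z) powr (a - of_nat i)) has_field_derivative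
             (a - of_nat i) * (1 + z) powr (a - of_nat i - 1) * (0 + 1)) (at z within S)"
      using nz by (intro derivative_intros) 
    from DERIV_cmult[OF this, of "\<Prod>l<i. a - of_nat l"]
    show "(f i has_field_derivative f (Suc i) z) (at z within S)"
      by (simp add: f_def algebra_simps)
  next
    fix z assume "z \<in> S"
    then obtain y where y: "z = of_real y" "0 \<le> y" "y \<le> 1" using S by blast
    have z1: "1 + z = of_real (1 + y)" using y by simp
    have "norm (\<Prod>l<Suc m. a - of_nat l) \<le> (\<Prod>l<Suc m. R + real l)"
      unfolding prod_norm[symmetric]
    proof (rule prod_mono)
      fix l
      show "0 \<le> norm (a - of_nat l) \<and> norm (a - of_nat l) \<le> R + real l"
        using norm_triangle_ineq4[of a "of_nat l"] a by simp
    qed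
    moreover have "norm ((1 + z) powr (a - of_nat (Suc m))) \<le> 2 powr R"
    proof -
      have "norm ((1 + z) powr (a - of_nat (Suc m))) = (1 + y) powr Re (a - of_nat (Suc m))"
        unfolding z1 using y by (subst norm_powr_real_powr) (auto simp del: of_real_add)
      also have "\<dots> \<le> (1 + y) powr R"
        using y complex_Re_le_cmod[of a] a by (intro powr_mono) auto
      also have "\<dots> \<le> 2 powr R" using y R by (intro powr_mono2) auto
      finally show ?thesis .
    qed
    ultimately show "norm (f (Suc m) z) \<le> (\<Prod>l<Suc m. R + real l) * 2 powr R"
      unfolding f_def norm_mult using R by (intro mult_mono prod_nonneg) auto
  qed
  moreover have "(\<Sum>i\<le>m. f i 0 * (of_real x - 0) ^ i / fact i) = (\<Sum>j\<le>m. (a gchoose j) * of_real x ^ j)"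
    by (intro sum.cong) (auto simp: f_def gbinomial_prod_rev atLeast0LessThan)
  ultimately show "norm ((1 + of_real x) powr a - (\<Sum>j\<le>m. (a gchoose j) * of_real x ^ j)) \<le> C * x ^ Suc m"
    using x by (simp add: f_def C_def norm_power)
qed

text \<open>
  \<open>zeta_rem m n s\<close> is the remainder of the order-\<open>m\<close> binomial expansion of
  \<open>(n + 2) powr (1 - s) = (n + 1) powr (1 - s) * (1 + 1 / (n + 1)) powr (1 - s)\<close>.  Telescoping the
  sum over \<open>n\<close> expresses \<open>(s - 1) * \<zeta>(s)\<close> through the sum of the remainders and the values
  \<open>\<zeta>(s + 1), \<dots>, \<zeta>(s + m - 1)\<close>; this continues \<open>(s - 1) * \<zeta>(s)\<close> one unit strip at a time.
\<close>

definition zeta_rem :: "nat \<Rightarrow> nat \<Rightarrow> complex \<Rightarrow> complex" where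
  "zeta_rem m n s = of_nat (Suc n) powr (1 - s) *
     ((1 + of_real (1 / real (Suc n))) powr (1 - s)
       - (\<Sum>j\<le>m. ((1 - s) gchoose j) * of_real (1 / real (Suc n)) ^ j))"

lemma summable_Suc_powr: "c < -1 \<Longrightarrow> summable (\<lambda>n. real (Suc n) powr c)"
  using summable_real_powr_iff[of c] summable_Suc_iff[of "\<lambda>n. real n powr c"] by simp

lemma zeta_rem_bound:
  fixes z :: complex
  assumes z: "Re z > 1 - real m"
  obtains d M where "d > 0" "cball z d \<subseteq> {s. Re s > 1 - real m}" "summable M"
    "\<And>n s. s \<in> cball z d \<Longrightarrow> norm (zeta_rem m n s) \<le> M n"
proof -
  define d where "d = (Re z - (1 - real m)) / 2"
  define c where "c = Re z - d"
  have d: "d > 0" and c: "c > 1 - real m" using z by (auto simp: d_def c_def field_simps)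
  have ball: "Re s \<ge> c" "norm (1 - s) \<le> 1 + norm z + d" if "s \<in> cball z d" for s
  proof -
    have "norm (z - s) \<le> d" using that by (simp add: dist_norm)
    then show "Re s \<ge> c" using complex_Re_le_cmod[of "z - s"] by (simp add: c_def)
    have "norm (1 - s) \<le> norm (1 - z) + norm (z - s)" using norm_triangle_ineq[of "1 - z" "z - s"] by simp
    also have "norm (1 - z) \<le> 1 + norm z" using norm_triangle_ineq4[of 1 z] by simp
    finally show "norm (1 - s) \<le> 1 + norm z + d" using \<open>norm (z - s) \<le> d\<close> by simp
  qed
  obtain C where C: "C \<ge> 0" "\<And>a x. norm (a::complex) \<le> 1 + norm z + d \<Longrightarrow> 0 \<le> x \<Longrightarrow> x \<le> 1 \<Longrightarrow>
       norm ((1 + of_real x) powr a - (\<Sum>j\<le>m. (a gchoose j) * of_real x ^ j)) \<le> C * x ^ Suc m"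
    using powr_one_plus_Taylor_bound[of "1 + norm z + d" m] d by (auto simp: add_nonneg_nonneg)
  define M where "M = (\<lambda>n. C * real (Suc n) powr (- c - real m))"
  show ?thesis
  proof (rule that[of d M])
    show "cball z d \<subseteq> {s. Re s > 1 - real m}" using ball(1) c by force
    show "summable M" unfolding M_def using c by (intro summable_mult summable_Suc_powr) auto
    fix n s assume s: "s \<in> cball z d"
    have "norm (of_nat (Suc n) powr (1 - s) :: complex) = real (Suc n) powr (1 - Re s)"
      by (subst norm_powr_real_powr) auto
    also have "\<dots> \<le> real (Suc n) powr (1 - c)" using ball(1)[OF s] by (intro powr_mono) auto
    finally have 1: "norm (of_nat (Suc n) powr (1 - s) :: complex) \<le> real (Suc n) powr (1 - c)" .
    have "norm (zeta_rem m n s) \<le> real (Suc n) powr (1 - c) * (C * (1 / real (Suc n)) ^ Suc m)"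
      unfolding zeta_rem_def norm_mult
      by (intro mult_mono 1 C(2)[OF ball(2)[OF s]]) (auto simp del: of_nat_Suc)
    also have "(1 / real (Suc n)) ^ Suc m = real (Suc n) powr (- real (Suc m))"
      by (simp add: powr_minus powr_realpow power_one_over divide_inverse power_inverse del: of_nat_Suc power_Suc)
    also have "real (Suc n) powr (1 - c) * (C * real (Suc n) powr (- real (Suc m))) = M n"
      by (simp add: M_def powr_add[symmetric] mult_ac)
    finally show "norm (zeta_rem m n s) \<le> M n" .
  qed (use d in auto)
qed

lemma gchoose_holomorphic: "(\<lambda>s::complex. (1 - s) gchoose j) holomorphic_on A"
  unfolding gbinomial_prod_rev
  by (intro holomorphic_on_divide holomorphic_on_prod holomorphic_on_diff
        holomorphic_on_const holomorphic_on_ident) simp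

lemma zeta_rem_holomorphic:
  "(\<lambda>s. \<Sum>n. zeta_rem m n s) holomorphic_on {s. Re s > 1 - real m}" (is ?hol)
  and zeta_rem_summable: "Re s > 1 - real m \<Longrightarrow> summable (\<lambda>n. zeta_rem m n s)"
proof -
  show ?hol
  proof (rule holomorphic_uniform_sequence[where f = "\<lambda>N s. \<Sum>n<N. zeta_rem m n s"])
    show "open {s. Re s > 1 - real m}" by (rule open_halfspace_Re_gt)
    fix N show "(\<lambda>s. \<Sum>n<N. zeta_rem m n s) holomorphic_on {s. Re s > 1 - real m}"
      unfolding zeta_rem_def
      by (intro holomorphic_on_sum holomorphic_on_mult holomorphic_on_diff holomorphic_on_powr_right
            gchoose_holomorphic holomorphic_on_const holomorphic_on_ident)
  next
    fix z assume "z \<in> {s. Re s > 1 - real m}"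
    then have "Re z > 1 - real m" by simp
    then obtain d M where "d > 0" "cball z d \<subseteq> {s. Re s > 1 - real m}" "summable M"
      "\<And>n s. s \<in> cball z d \<Longrightarrow> norm (zeta_rem m n s) \<le> M n"
      by (rule zeta_rem_bound) blast
    then show "\<exists>d>0. cball z d \<subseteq> {s. Re s > 1 - real m} \<and>
      uniform_limit (cball z d) (\<lambda>N s. \<Sum>n<N. zeta_rem m n s) (\<lambda>s. \<Sum>n. zeta_rem m n s) sequentially"
      by (metis Weierstrass_m_test)
  qed
  assume "Re s > 1 - real m"
  then obtain d M where "d > 0" "summable M"
    "\<And>n s'. s' \<in> cball s d \<Longrightarrow> norm (zeta_rem m n s') \<le> M n"
    by (rule zeta_rem_bound) blast
  then show "summable (\<lambda>n. zeta_rem m n s)"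
    by (meson summable_comparison_test' centre_in_cball less_imp_le)
qed

definition zeta_series :: "complex \<Rightarrow> complex" where
  "zeta_series s = (\<Sum>n. of_nat (Suc n) powr (- s))"

lemma zeta_series_sums:
  assumes "Re s > 1"
  shows "(\<lambda>n. of_nat (Suc n) powr (- s)) sums zeta_series s"
  unfolding zeta_series_def
proof (rule summable_sums, rule summable_norm_cancel)
  have "norm (of_nat (Suc n) powr (- s) :: complex) = real (Suc n) powr (- Re s)" for n
    by (subst norm_powr_real_powr) auto
  then show "summable (\<lambda>n. norm (of_nat (Suc n) powr (- s) :: complex))"
    using summable_Suc_powr[of "- Re s"] assms by (simp del: of_nat_Suc)
qed

lemma zeta_rem_eq:
  "zeta_rem m n s = of_nat (Suc (Suc n)) powr (1 - s) - of_nat (Suc n) powr (1 - s)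
     - (\<Sum>j=1..m. ((1 - s) gchoose j) * of_nat (Suc n) powr (- (s + of_nat j - 1)))"
proof -
  define x :: complex where "x = of_nat (Suc n)"
  have x: "x \<noteq> 0" unfolding x_def by (simp del: of_nat_Suc)
  have "x powr (1 - s) * (1 + of_real (1 / real (Suc n))) powr (1 - s)
      = (x * (1 + of_real (1 / real (Suc n)))) powr (1 - s)"
    unfolding x_def by (subst powr_times_real_left) (auto simp del: of_nat_Suc)
  also have "x * (1 + of_real (1 / real (Suc n))) = of_nat (Suc (Suc n))"
    using x by (simp add: x_def field_simps)
  finally have 1: "x powr (1 - s) * (1 + of_real (1 / real (Suc n))) powr (1 - s)
    = of_nat (Suc (Suc n)) powr (1 - s)" .
  have 2: "x powr (1 - s) * of_real (1 / real (Suc n)) ^ j = x powr (- (s + of_nat j - 1))" for j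
  proof -
    have "of_real (1 / real (Suc n)) ^ j = inverse (x powr of_nat j)"
      using x by (simp add: x_def power_inverse divide_inverse del: of_nat_Suc)
    also have "\<dots> = x powr (- of_nat j)" by (simp add: powr_minus)
    finally show ?thesis using x by (simp add: powr_add[symmetric] algebra_simps)
  qed
  have "{..m} = insert 0 {1..m}" by auto
  then have "(\<Sum>j\<le>m. ((1 - s) gchoose j) * x powr (- (s + of_nat j - 1)))
     = x powr (1 - s) + (\<Sum>j=1..m. ((1 - s) gchoose j) * x powr (- (s + of_nat j - 1)))"
    by simp
  moreover have "zeta_rem m n s = x powr (1 - s) * (1 + of_real (1 / real (Suc n))) powr (1 - s)
     - (\<Sum>j\<le>m. ((1 - s) gchoose j) * (x powr (1 - s) * of_real (1 / real (Suc n)) ^ j))"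
    unfolding zeta_rem_def x_def by (simp only: right_diff_distrib sum_distrib_left mult_ac)
  ultimately show ?thesis unfolding 1 2 by (simp add: x_def)
qed

lemma zeta_rem_suminf:
  assumes s: "Re s > 1"
  shows "(\<Sum>n. zeta_rem m n s) = -1 - (\<Sum>j=1..m. ((1 - s) gchoose j) * zeta_series (s + of_nat j - 1))"
proof -
  have "(\<lambda>n. of_nat (Suc n) powr (1 - s) :: complex) \<longlonglongrightarrow> 0"
  proof (rule tendsto_norm_zero_cancel)
    have "norm (of_nat (Suc n) powr (1 - s) :: complex) = real (Suc n) powr (1 - Re s)" for n
      by (subst norm_powr_real_powr) auto
    moreover have "(\<lambda>n. real (Suc n) powr (1 - Re s)) \<longlonglongrightarrow> 0"
      using s by (intro tendsto_neg_powr filterlim_compose[OF filterlim_real_sequentially filterlim_Suc]) auto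
    ultimately show "(\<lambda>n. norm (of_nat (Suc n) powr (1 - s) :: complex)) \<longlonglongrightarrow> 0"
      by (simp del: of_nat_Suc)
  qed
  from telescope_sums[OF this]
  have tel: "(\<lambda>n. of_nat (Suc (Suc n)) powr (1 - s) - of_nat (Suc n) powr (1 - s) :: complex) sums (-1)"
    by simp
  have "(\<lambda>n. zeta_rem m n s) sums
     (-1 - (\<Sum>j=1..m. ((1 - s) gchoose j) * zeta_series (s + of_nat j - 1)))"
    unfolding zeta_rem_eq
    using s by (intro sums_diff tel sums_sum sums_mult zeta_series_sums) auto
  then show ?thesis by (rule sums_unique[symmetric])
qed

lemma gchoose_shift:
  assumes "j \<ge> 2"
  shows "((1 - s) gchoose j) * z = - (((1 - s) gchoose (j - 1)) / of_nat j) * ((s + of_nat j - 1 - 1) * (z::complex))"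
proof -
  from assms obtain i where j: "j = Suc i" by (cases j) auto
  have "of_nat (Suc i) * ((1 - s) gchoose Suc i) = ((1 - s) - of_nat i) * ((1 - s) gchoose i)"
    using gbinomial_absorb_comp[of "1 - s" i] gbinomial_absorption[of i "1 - s"] by simp
  then have "((1 - s) gchoose Suc i) = ((1 - s) - of_nat i) * ((1 - s) gchoose i) / of_nat (Suc i)"
    by (simp add: nonzero_eq_divide_eq mult.commute del: of_nat_Suc)
  moreover have "(1 - s) - of_nat i = - (s + of_nat j - 1 - 1)" by (simp add: j)
  ultimately have "((1 - s) gchoose Suc i) = - (s + of_nat j - 1 - 1) * ((1 - s) gchoose i) / of_nat (Suc i)"
    by metis
  then have "((1 - s) gchoose j) = - (((1 - s) gchoose (j - 1)) / of_nat j) * (s + of_nat j - 1 - 1)"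
    by (simp only: j diff_Suc_1 times_divide_eq_left times_divide_eq_right mult_minus_left mult_minus_right mult.commute minus_divide_left)
  then show ?thesis by (simp only: mult.assoc)
qed

lemma zeta_series_recursion:
  assumes s: "Re s > 1"
  shows "(s - 1) * zeta_series s = 1 + (\<Sum>n. zeta_rem (Suc m) n s)
     - (\<Sum>j=2..Suc m. (((1 - s) gchoose (j - 1)) / of_nat j) *
            ((s + of_nat j - 1 - 1) * zeta_series (s + of_nat j - 1)))"
proof -
  have "{1..Suc m} = insert 1 {2..Suc m}" by auto
  then have "(\<Sum>n. zeta_rem (Suc m) n s) = -1 - ((1 - s) * zeta_series s +
      (\<Sum>j=2..Suc m. ((1 - s) gchoose j) * zeta_series (s + of_nat j - 1)))"
    unfolding zeta_rem_suminf[OF s] by simp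
  also have "(\<Sum>j=2..Suc m. ((1 - s) gchoose j) * zeta_series (s + of_nat j - 1)) =
     (\<Sum>j=2..Suc m. - ((((1 - s) gchoose (j - 1)) / of_nat j) *
            ((s + of_nat j - 1 - 1) * zeta_series (s + of_nat j - 1))))"
    by (intro sum.cong refl, subst gchoose_shift) auto
  finally have *: "(\<Sum>n. zeta_rem (Suc m) n s) = - 1 - ((1 - s) * zeta_series s +
     (\<Sum>j=2..Suc m. - ((((1 - s) gchoose (j - 1)) / of_nat j) *
            ((s + of_nat j - 1 - 1) * zeta_series (s + of_nat j - 1)))))" .
  have "(s - 1) * zeta_series s = - ((1 - s) * zeta_series s)" by (simp add: algebra_simps)
  then show ?thesis unfolding * sum_negf by simp
qed

lemma zeta_continuation_halfplane:
  "\<exists>h. h holomorphic_on {s. Re s > - real m} \<and> (\<forall>s. Re s > 1 \<longrightarrow> h s = (s - 1) * zeta_series s)"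
proof (induction m)
  case 0
  have "(\<lambda>s. 1 + (\<Sum>n. zeta_rem 1 n s)) holomorphic_on {s. Re s > - real 0}"
    using zeta_rem_holomorphic[of 1] by (intro holomorphic_intros) simp_all
  moreover have "1 + (\<Sum>n. zeta_rem 1 n s) = (s - 1) * zeta_series s" if "Re s > 1" for s
    using zeta_series_recursion[OF that, of 0] by simp
  ultimately show ?case by (intro exI[of _ "\<lambda>s. 1 + (\<Sum>n. zeta_rem 1 n s)"]) auto
next
  case (Suc m)
  then obtain h where h: "h holomorphic_on {s. Re s > - real m}"
    "\<And>s. Re s > 1 \<Longrightarrow> h s = (s - 1) * zeta_series s" by blast
  define H where "H = (\<lambda>s. 1 + (\<Sum>n. zeta_rem (Suc (Suc m)) n s)
     - (\<Sum>j=2..Suc (Suc m). (((1 - s) gchoose (j - 1)) / of_nat j) * h (s + of_nat j - 1)))"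
  have "H s = (s - 1) * zeta_series s" if "Re s > 1" for s
  proof -
    have "(\<Sum>j=2..Suc (Suc m). (((1 - s) gchoose (j - 1)) / of_nat j) * h (s + of_nat j - 1)) =
       (\<Sum>j=2..Suc (Suc m). (((1 - s) gchoose (j - 1)) / of_nat j) *
            ((s + of_nat j - 1 - 1) * zeta_series (s + of_nat j - 1)))"
      using that by (intro sum.cong refl, subst h(2)) auto
    then show ?thesis unfolding H_def zeta_series_recursion[OF that, of "Suc m"] by simp
  qed
  moreover have "H holomorphic_on {s. Re s > - real (Suc m)}"
    unfolding H_def
  proof (intro holomorphic_intros)
    show "(\<lambda>s. \<Sum>n. zeta_rem (Suc (Suc m)) n s) holomorphic_on {s. Re s > - real (Suc m)}"
      using zeta_rem_holomorphic[of "Suc (Suc m)"] by simp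
  next
    fix j :: nat assume j: "j \<in> {2..Suc (Suc m)}"
    show "(\<lambda>s. (1 - s) gchoose (j - 1)) holomorphic_on {s. Re s > - real (Suc m)}"
      by (rule gchoose_holomorphic)
    show "of_nat j \<noteq> (0::complex)" using j by auto
    have "(h \<circ> (\<lambda>s. s + of_nat j - 1)) holomorphic_on {s. Re s > - real (Suc m)}"
      using j by (intro holomorphic_on_compose_gen[OF _ h(1)] holomorphic_intros) auto
    then show "(\<lambda>s. h (s + of_nat j - 1)) holomorphic_on {s. Re s > - real (Suc m)}"
      by (simp add: o_def)
  qed
  ultimately show ?case by (intro exI[of _ H]) auto
qed

lemma ex_riemann_zeta: "\<exists>f. is_riemann_zeta f"
proof -
  have "\<exists>h. \<forall>m. h m holomorphic_on {s. Re s > - real m} \<and>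
          (\<forall>s. Re s > 1 \<longrightarrow> h m s = (s - 1) * zeta_series s)"
    by (intro choice allI zeta_continuation_halfplane)
  then obtain h where h: "\<And>m. h m holomorphic_on {s. Re s > - real m}"
    "\<And>m s. Re s > 1 \<Longrightarrow> h m s = (s - 1) * zeta_series s"
    by blast
  have eq: "h m s = h n s" if "Re s > - real m" "Re s > - real n" for m n s
  proof (rule analytic_continuation_open[of "{s. Re s > 1}" "{s. Re s > - real (min m n)}" "h m" "h n" s])
    have "2 \<in> {s. Re s > 1}" by simp
    then show "{s. Re s > 1} \<noteq> {}" by blast
    show "connected {s. Re s > - real (min m n)}"
      by (intro convex_connected convex_halfspace_Re_gt)
    show "h m holomorphic_on {s. Re s > - real (min m n)}"
      by (rule holomorphic_on_subset[OF h(1)[of m]]) auto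
    show "h n holomorphic_on {s. Re s > - real (min m n)}"
      by (rule holomorphic_on_subset[OF h(1)[of n]]) auto
    show "s \<in> {s. Re s > - real (min m n)}" using that by (auto simp: min_def)
  qed (auto simp: open_halfspace_Re_gt h(2))
  define H where "H = (\<lambda>s. h (nat \<lceil>\<bar>Re s\<bar> + 1\<rceil>) s)"
  have H_eq: "H s = h m s" if "Re s > - real m" for m s
    unfolding H_def by (intro eq that) linarith
  have "H holomorphic_on (\<Union>m. {s. Re s > - real m})"
  proof (rule holomorphic_on_UN_open)
    fix m show "H holomorphic_on {s. Re s > - real m}"
      using h(1)[of m] by (subst holomorphic_cong[OF refl, of _ H "h m"]) (auto simp: H_eq)
  qed (auto simp: open_halfspace_Re_gt)
  moreover have "(\<Union>m. {s. Re s > - real m}) = UNIV"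
  proof -
    have "\<exists>m. Re s > - real m" for s
      using reals_Archimedean2[of "- Re s"] by (auto simp: minus_less_iff)
    then show ?thesis by auto
  qed
  ultimately have H: "H holomorphic_on UNIV" by simp
  define f where "f = (\<lambda>s. H s / (s - 1))"
  have "f holomorphic_on - {1}"
    unfolding f_def by (intro holomorphic_intros holomorphic_on_subset[OF H]) auto
  moreover have "f s = zeta_series s" if "Re s > 1" for s
  proof -
    have "s \<noteq> 1" using that by auto
    then show ?thesis using that H_eq[of 0 s] h(2)[of s 0] by (simp add: f_def)
  qed
  moreover have "f 1 = 0" by (simp add: f_def)
  ultimately have "is_riemann_zeta f"
    unfolding is_riemann_zeta_def using zeta_series_sums by auto
  then show ?thesis by blast
qed

lemma ex1_riemann_zeta: "\<exists>!f. is_riemann_zeta f"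
  using ex_riemann_zeta is_riemann_zeta_unique by blast

lemma is_riemann_zeta_riemann_zeta: "is_riemann_zeta riemann_zeta"
  unfolding riemann_zeta_def using ex1_riemann_zeta by (rule theI')

end

theory Submission
  imports Defs
begin

text \<open>
  By Euler-Maclaurin summation \<open>\<zeta>(\<sigma> + i t)\<close> is, up to a small error, the partial sum of its Dirichlet
  series up to about \<open>t\<^sup>2\<close>. The terms with \<open>n > exp (- 1.6) t\<close> are handled by the Kusmin-Landau
  inequality; the remaining range is cut into blocks \<open>(X, 1.5 X]\<close>, on which partial summation
  leaves the exponential sums of \<open>t ln n / (2 \<pi>)\<close>. Van der Corput's test of order \<open>j\<close>, obtained by induction
  from the test of order 2 by differencing, bounds each of them, and the best order for
  \<open>X = exp y\<close> grows as \<open>y / ln t\<close> decreases. At \<open>\<sigma> = \<sigma>\<^sub>k\<close> the block with \<open>y = (ln t) / k\<close> is the critical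
  one: there the test of order \<open>k\<close> and the trivial bound both give \<open>t powr (1 / (2 ^ k - 2))\<close>, and no
  other block exceeds this order. Since there are \<open>O(ln t)\<close> blocks, the theorem
  follows for large \<open>t\<close>. For smaller \<open>t\<close>, with \<open>x = ln t\<close>, the resulting bounds are combinations of
  exponentials \<open>exp (c x)\<close> with nonnegative coefficients, hence convex, and it suffices to compare them with
  \<open>1.546 x\<close> at the end points of a few intervals.
\<close>

subsection \<open>Van der Corput differencing\<close>

text \<open>The constant is the difficulty. A unit of \<open>y\<close> contains about 2.47 blocks of
  ratio 1.5, and a block treated by a test of order 5 or more may cost 2.15 \<open>exp tau\<close>,
  where \<open>tau = x / (2 ^ k - 2)\<close>; charging this up to \<open>exp x\<close> would give
  more than 5 \<open>x\<close> instead of 1.546 \<open>x\<close>. Three savings bring it down. Up to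
  \<open>exp (x / k)\<close> the trivial bound costs only about \<open>x / k\<close> in units of
  \<open>exp tau\<close>. At the boundary between two consecutive orders the exponents fall below
  \<open>tau\<close> by an amount that grows as the order moves away from \<open>k\<close>, so
  blocks of low order carry small factors. In the ranges of orders 2 and 3 the block bounds form
  geometric series or decay in \<open>x\<close>, and cost no multiple of \<open>x\<close>. If
  \<open>k\<close> is so large that \<open>k * tau \<le> 5\<close>, there is no decay to exploit,
  but then the trivial bound up to \<open>exp (x / 3)\<close> is itself a small multiple of
  \<open>x\<close>. All estimates use \<open>1 - \<sigma>\<close> only through an upper bound
  \<open>d\<close>; hence one numerical check with a single \<open>d\<close> covers infinitely many
  \<open>k\<close>.\<close>

lemma sum_abs_diff_square:
  fixes g :: "nat \<Rightarrow> real"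
  shows "(\<Sum>r<H. \<Sum>s<H. g (if s \<le> r then r - s else s - r)) = real H * g 0 + 2 * (\<Sum>d=1..<H. real (H - d) * g d)"
proof (induction H)
  case (Suc H)
  have 1: "(\<Sum>s<H. g (H - s)) = (\<Sum>d=1..H. g d)"
    by (rule sum.reindex_bij_witness[of _ "\<lambda>d. H - d" "\<lambda>s. H - s"]) auto
  have "(\<Sum>r<Suc H. \<Sum>s<Suc H. g (if s \<le> r then r - s else s - r))
     = (\<Sum>r<H. \<Sum>s<H. g (if s \<le> r then r - s else s - r)) + (\<Sum>r<H. g (H - r)) + (\<Sum>s<H. g (H - s)) + g 0"
    by (simp add: sum.distrib cong: sum.cong_simp)
  also have "\<dots> = real H * g 0 + 2 * (\<Sum>d=1..<H. real (H - d) * g d) + 2 * (\<Sum>d=1..H. g d) + g 0"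
    by (simp add: Suc.IH 1)
  also have "(\<Sum>d=1..<H. real (H - d) * g d) = (\<Sum>d=1..H. real (H - d) * g d)"
    by (cases H) (auto simp: atLeastLessThanSuc_atLeastAtMost)
  also have "real H * g 0 + 2 * (\<Sum>d=1..H. real (H - d) * g d) + 2 * (\<Sum>d=1..H. g d) + g 0
     = real (Suc H) * g 0 + 2 * (\<Sum>d=1..H. real (Suc H - d) * g d)"
  proof -
    have "(\<Sum>d=1..H. real (Suc H - d) * g d) = (\<Sum>d=1..H. real (H - d) * g d + g d)"
      by (intro sum.cong) (auto simp: algebra_simps of_nat_diff)
    thus ?thesis by (simp add: sum.distrib) (simp add: algebra_simps)
  qed
  finally show ?case by (simp add: atLeastLessThanSuc_atLeastAtMost)
qed simp

text \<open>Every term lies in exactly \<open>H\<close> of the windows of length \<open>H\<close>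
  that start in \<open>{- int H..<int N}\<close>, so \<open>H\<close> times the sum is a sum of
  \<open>N + H\<close> window sums. Cauchy-Schwarz and squaring out leave correlations that depend
  on \<open>r\<close> and \<open>s\<close> only through the distance of \<open>r\<close> and
  \<open>s\<close>. Indexing by \<open>int\<close> with values zero outside the range keeps the
  shifts free of boundary terms.\<close>

lemma van_der_Corput_inequality:
  fixes z :: "int \<Rightarrow> complex" and N H :: nat
  assumes z: "\<And>n. n \<notin> {0..<int N} \<Longrightarrow> z n = 0" and H: "H \<ge> 1"
  defines "c \<equiv> \<lambda>d::nat. \<Sum>n\<in>{0..<int N}. z (n + int d) * cnj (z n)"
  shows "(real H * norm (\<Sum>n\<in>{0..<int N}. z n))\<^sup>2
    \<le> real (N + H) * (real H * norm (c 0) + 2 * (\<Sum>d=1..<H. real (H - d) * norm (c d)))"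
proof -
  define I where "I = {- int H..<int N}"
  have fin: "finite I" by (simp add: I_def)
  define y where "y = (\<lambda>m. \<Sum>r<H. z (m + int r))"
  have shift: "(\<Sum>m\<in>I. f (m + int r)) = (\<Sum>n\<in>{0..<int N}. f n)"
    if r: "r < H" and f: "\<And>n. n \<notin> {0..<int N} \<Longrightarrow> f n = 0" for r and f :: "int \<Rightarrow> complex"
  proof -
    have "(\<Sum>m\<in>I. f (m + int r)) = (\<Sum>n\<in>(\<lambda>m. m + int r) ` I. f n)"
      by (subst sum.reindex) (auto simp: inj_on_def)
    also have "\<dots> = (\<Sum>n\<in>{0..<int N}. f n)"
    proof (rule sum.mono_neutral_right)
      show "{0..<int N} \<subseteq> (\<lambda>m. m + int r) ` I"
      proof
        fix x assume "x \<in> {0..<int N}"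
        then have "x - int r \<in> I" using r by (auto simp: I_def)
        then show "x \<in> (\<lambda>m. m + int r) ` I" by (intro image_eqI[of _ _ "x - int r"]) auto
      qed
    qed (auto simp: fin f)
    finally show ?thesis .
  qed
  have "(\<Sum>m\<in>I. y m) = (\<Sum>r<H. \<Sum>m\<in>I. z (m + int r))" unfolding y_def by (rule sum.swap)
  also have "\<dots> = (\<Sum>r<H. \<Sum>n\<in>{0..<int N}. z n)" by (intro sum.cong refl shift z) auto
  finally have ysum: "(\<Sum>m\<in>I. y m) = of_nat H * (\<Sum>n\<in>{0..<int N}. z n)" by simp
  have corr: "norm (\<Sum>m\<in>I. z (m + int r) * cnj (z (m + int s))) = norm (c (if s \<le> r then r - s else s - r))"
    if "r < H" "s < H" for r s
  proof -
    have gen: "(\<Sum>m\<in>I. z (m + int r) * cnj (z (m + int s))) = c (r - s)" if "s \<le> r" "r < H" for r s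
    proof -
      have "(\<Sum>m\<in>I. z ((m + int s) + int (r - s)) * cnj (z (m + int s))) = c (r - s)"
        unfolding c_def using that by (intro shift[of s "\<lambda>n. z (n + int (r - s)) * cnj (z n)"]) (auto simp: z)
      moreover have "(m + int s) + int (r - s) = m + int r" for m using that by simp
      ultimately show ?thesis by simp
    qed
    show ?thesis
    proof (cases "s \<le> r")
      case True then show ?thesis using gen[of s r] that by simp
    next
      case False
      have "(\<Sum>m\<in>I. z (m + int r) * cnj (z (m + int s))) = cnj (\<Sum>m\<in>I. z (m + int s) * cnj (z (m + int r)))"
        by (simp add: mult.commute)
      then show ?thesis using gen[of r s] that False by (simp add: complex_mod_cnj del: cnj_sum)
    qed
  qed
  have "(real H * norm (\<Sum>n\<in>{0..<int N}. z n))\<^sup>2 = (norm (\<Sum>m\<in>I. y m))\<^sup>2"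
    unfolding ysum by (simp add: norm_mult)
  also have "\<dots> \<le> (\<Sum>m\<in>I. norm (y m))\<^sup>2" by (intro power_mono norm_sum) auto
  also have "\<dots> \<le> real (card I) * (\<Sum>m\<in>I. (norm (y m))\<^sup>2)"
    using sum_squared_le_sum_of_squares[of "\<lambda>m. norm (y m)" I] by (simp add: fin mult.commute)
  also have "real (card I) = real (N + H)" by (simp add: I_def)
  also have "(\<Sum>m\<in>I. (norm (y m))\<^sup>2) = Re (\<Sum>m\<in>I. y m * cnj (y m))"
    by (simp add: complex_norm_square[symmetric] del: of_real_power of_real_sum flip: of_real_sum)
  also have "(\<Sum>m\<in>I. y m * cnj (y m)) = (\<Sum>m\<in>I. \<Sum>r<H. \<Sum>s<H. z (m + int r) * cnj (z (m + int s)))"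
    unfolding y_def by (simp add: sum_product)
  also have "\<dots> = (\<Sum>r<H. \<Sum>s<H. \<Sum>m\<in>I. z (m + int r) * cnj (z (m + int s)))"
    by (subst sum.swap, rule sum.cong[OF refl], subst sum.swap, rule refl)
  also have "Re \<dots> \<le> norm \<dots>" by (rule complex_Re_le_cmod)
  also have "\<dots> \<le> (\<Sum>r<H. \<Sum>s<H. norm (c (if s \<le> r then r - s else s - r)))"
  proof -
    have "norm (\<Sum>r<H. \<Sum>s<H. \<Sum>m\<in>I. z (m + int r) * cnj (z (m + int s)))
        \<le> (\<Sum>r<H. \<Sum>s<H. norm (\<Sum>m\<in>I. z (m + int r) * cnj (z (m + int s))))"
      by (rule order.trans[OF norm_sum]) (intro sum_mono norm_sum)
    also have "\<dots> = (\<Sum>r<H. \<Sum>s<H. norm (c (if s \<le> r then r - s else s - r)))"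
      by (intro sum.cong refl corr) auto
    finally show ?thesis .
  qed
  also have "\<dots> = real H * norm (c 0) + 2 * (\<Sum>d=1..<H. real (H - d) * norm (c d))"
    using sum_abs_diff_square[of "\<lambda>d. norm (c d)" H] by simp
  finally show ?thesis by (simp add: mult_left_mono)
qed

text \<open>Multiplying by a conjugate replaces the phase by a difference of step \<open>d\<close>,
  which behaves like \<open>d\<close> times its derivative: this is what lowers the order of a
  derivative test by one. The diagonal \<open>d = 0\<close> contributes the number of terms.\<close>

lemma van_der_Corput_cis:
  fixes F :: "nat \<Rightarrow> real" and a b H :: nat
  assumes "a \<le> b" and H: "H \<ge> 1"
  shows "(real H * norm (\<Sum>n=a..b. cis (F n)))\<^sup>2
    \<le> real (Suc b - a + H) * (real H * real (Suc b - a) +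
         2 * (\<Sum>d=1..<H. real (H - d) * norm (\<Sum>n\<in>{n. a \<le> n \<and> n + d \<le> b}. cis (F (n + d) - F n))))"
proof -
  define N where "N = Suc b - a"
  define z where "z = (\<lambda>n::int. if n \<in> {0..<int N} then cis (F (a + nat n)) else 0)"
  define c where "c = (\<lambda>d::nat. \<Sum>n\<in>{0..<int N}. z (n + int d) * cnj (z n))"
  have c: "c d = (\<Sum>n\<in>{n. a \<le> n \<and> n + d \<le> b}. cis (F (n + d) - F n))" for d
  proof -
    have "(\<Sum>n\<in>{n. a \<le> n \<and> n + d \<le> b}. cis (F (n + d) - F n))
        = (\<Sum>n\<in>{0..<int N - int d}. z (n + int d) * cnj (z n))"
    proof (rule sum.reindex_bij_witness[of _ "\<lambda>n. a + nat n" "\<lambda>n. int n - int a"])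
      fix n assume n: "n \<in> {n. a \<le> n \<and> n + d \<le> b}"
      then have "nat (int n - int a) = n - a" "nat (int n - int a + int d) = n - a + d" by auto
      with n have "z (int n - int a + int d) = cis (F (n + d))" "z (int n - int a) = cis (F n)"
        unfolding z_def N_def by (auto simp: add.commute)
      then show "z (int n - int a + int d) * cnj (z (int n - int a)) = cis (F (n + d) - F n)"
        by (simp add: cis_cnj cis_mult)
    qed (auto simp: N_def)
    also have "\<dots> = c d" unfolding c_def
      by (rule sum.mono_neutral_left) (auto simp: z_def)
    finally show ?thesis by simp
  qed
  have "{n. a \<le> n \<and> n + 0 \<le> b} = {a..b}" by auto
  then have c0: "c 0 = of_nat N" using \<open>a \<le> b\<close> unfolding c by (simp add: N_def)
  have "(\<Sum>n=a..b. cis (F n)) = (\<Sum>n\<in>{0..<int N}. z n)"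
    by (rule sum.reindex_bij_witness[of _ "\<lambda>n. a + nat n" "\<lambda>n. int n - int a"])
       (auto simp: N_def z_def nat_diff_distrib)
  moreover have "(real H * norm (\<Sum>n\<in>{0..<int N}. z n))\<^sup>2
    \<le> real (N + H) * (real H * norm (c 0) + 2 * (\<Sum>d=1..<H. real (H - d) * norm (c d)))"
    unfolding c_def using H by (intro van_der_Corput_inequality) (auto simp: z_def)
  ultimately show ?thesis unfolding c0 by (simp add: c N_def)
qed

subsection \<open>The Kusmin-Landau inequality and the second derivative test\<close>

text \<open>In \<open>Kusmin_Landau\<close> each end contributes a norm \<open>1 / (2 * sin)\<close>
  and one half of a telescoped cotangent; these identities merge the two into a single
  cotangent.\<close>

lemma cot_half_angle:
  fixes x :: real
  assumes "0 < x" "x < 2 * pi"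
  shows "cot (x / 2) + 1 / sin (x / 2) = cot (x / 4)" "1 / sin (x / 2) - cot (x / 2) = cot ((2 * pi - x) / 4)"
proof -
  define y where "y = x / 4"
  have y: "0 < y" "y < pi / 2" and x: "x / 2 = 2 * y" "x / 4 = y" using assms by (auto simp: y_def)
  have s: "sin y > 0" "cos y > 0" using y by (auto intro: sin_gt_zero2 cos_gt_zero_pi)
  have "cos (2 * y) + 1 = 2 * (cos y)\<^sup>2" using cos_double_cos[of y] by simp
  then have "(cos (2 * y) + 1) / sin (2 * y) = cos y / sin y"
    using s by (simp add: sin_double power2_eq_square)
  then show "cot (x / 2) + 1 / sin (x / 2) = cot (x / 4)" unfolding x cot_def by (simp add: add_divide_distrib)
  have "1 - cos (2 * y) = 2 * (sin y)\<^sup>2" using cos_double_sin[of y] by simp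
  then have "(1 - cos (2 * y)) / sin (2 * y) = sin y / cos y"
    using s by (simp add: sin_double power2_eq_square)
  moreover have "cot ((2 * pi - x) / 4) = sin y / cos y"
  proof -
    have e: "(2 * pi - x) / 4 = pi / 2 - y" by (simp add: y_def field_simps)
    show ?thesis unfolding e cot_def by (simp add: sin_diff cos_diff)
  qed
  ultimately show "1 / sin (x / 2) - cot (x / 2) = cot ((2 * pi - x) / 4)"
    unfolding x cot_def by (simp add: diff_divide_distrib)
qed

lemma cot_le_inverse:
  fixes x :: real
  assumes "0 < x" "x < pi / 2"
  shows "cot x \<le> 1 / x"
proof -
  have "x \<le> tan x"
  proof -
    have "\<exists>z. 0 < z \<and> z < x \<and> tan x - tan 0 = (x - 0) * inverse ((cos z)\<^sup>2)"
    proof (intro MVT2 DERIV_tan)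
      fix w assume "0 \<le> w" "w \<le> x"
      then have "cos w > 0" using assms by (intro cos_gt_zero_pi) auto
      then show "cos w \<noteq> 0" by simp
    qed (use assms in auto)
    then obtain z where z: "0 < z" "z < x" "tan x = x * inverse ((cos z)\<^sup>2)" by auto
    have "cos z > 0" using z assms by (intro cos_gt_zero_pi) auto
    then have "(cos z)\<^sup>2 \<le> 1" "(cos z)\<^sup>2 > 0" by (auto simp: power_le_one)
    then have "inverse ((cos z)\<^sup>2) \<ge> 1" by (simp add: one_le_inverse)
    then show ?thesis using z(3) assms by (simp add: mult_le_cancel_left1)
  qed
  then show ?thesis unfolding cot_altdef using assms by (simp add: inverse_eq_divide frac_le)
qed

lemma cot_antimono:
  fixes x y :: real
  assumes "0 < x" "x \<le> y" "y < pi"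
  shows "cot y \<le> cot x"
proof -
  have s: "sin x > 0" "sin y > 0" using assms by (auto intro!: sin_gt_zero)
  have "sin (y - x) \<ge> 0" using assms by (intro sin_ge_zero) auto
  then have "cos y * sin x \<le> cos x * sin y" by (simp add: sin_diff mult.commute)
  then show ?thesis unfolding cot_def using s by (simp add: divide_simps mult.commute)
qed

lemma inverse_one_minus_cis:
  assumes "0 < x" "x < 2 * pi"
  shows "1 / (1 - cis x) = Complex (1 / 2) (cot (x / 2) / 2)" "cis x \<noteq> 1"
    "norm (1 / (1 - cis x)) = 1 / (2 * sin (x / 2))"
proof -
  define y where "y = x / 2"
  have x: "x = 2 * y" and y: "0 < y" "y < pi" using assms by (auto simp: y_def)
  have s: "sin y > 0" using y by (rule sin_gt_zero)
  have e: "1 - cis x = Complex (2 * (sin y)\<^sup>2) (- 2 * sin y * cos y)"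
    unfolding x by (simp add: complex_eq_iff cos_double_sin sin_double)
  then show "cis x \<noteq> 1" using s by (auto simp: complex_eq_iff)
  then have ne: "1 - cis x \<noteq> 0" by simp
  have "Complex (1 / 2) (cot y / 2) * (1 - cis x) = 1"
  proof -
    define u where "u = cot y"
    have "u * sin y = cos y" using s by (simp add: u_def cot_def)
    then have "u * sin y * cos y = (cos y)\<^sup>2" "u * (sin y)\<^sup>2 = sin y * cos y"
      by (simp_all add: power2_eq_square mult.assoc[symmetric])
    moreover have "Complex (1 / 2) (u / 2) * (1 - cis x)
        = Complex ((sin y)\<^sup>2 + u * sin y * cos y) (u * (sin y)\<^sup>2 - sin y * cos y)"
      unfolding e by (simp add: complex_eq_iff algebra_simps)
    ultimately show ?thesis by (simp add: u_def complex_eq_iff)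
  qed
  then show *: "1 / (1 - cis x) = Complex (1 / 2) (cot (x / 2) / 2)"
    using ne by (simp add: y_def divide_eq_eq)
  have "(norm (1 - cis x))\<^sup>2 = (2 * sin y)\<^sup>2"
  proof -
    have "(norm (1 - cis x))\<^sup>2 = (2 * (sin y)\<^sup>2)\<^sup>2 + (2 * sin y * cos y)\<^sup>2" unfolding e by (simp add: cmod_power2)
    also have "\<dots> = (2 * sin y)\<^sup>2 * ((sin y)\<^sup>2 + (cos y)\<^sup>2)" by algebra
    finally show ?thesis by simp
  qed
  then have "norm (1 - cis x) = 2 * sin y" by (rule power2_eq_imp_eq) (use s in auto)
  then show "norm (1 / (1 - cis x)) = 1 / (2 * sin (x / 2))" by (simp add: norm_divide y_def)
qed

text \<open>Summation by parts against \<open>1 / (1 - cis (G n))\<close>, whose values lie on a vertical line.\<close>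

lemma Kusmin_Landau:
  fixes F :: "nat \<Rightarrow> real"
  defines "G \<equiv> \<lambda>n. F (Suc n) - F n"
  assumes ab: "a \<le> b" and mono: "\<And>n. a \<le> n \<Longrightarrow> n < b \<Longrightarrow> G n \<le> G (Suc n)"
    and lo: "0 < G a" and hi: "G b < 2 * pi"
  shows "norm (\<Sum>n=a..b. cis (F n)) \<le> 2 / G a + 2 / (2 * pi - G b)"
proof -
  have mono': "G m \<le> G n" if "a \<le> m" "m \<le> n" "n \<le> b" for m n
    using that(2,3)
  proof (induction n rule: dec_induct)
    case (step n) then show ?case using mono[of n] that by force
  qed simp
  have G: "0 < G n" "G n < 2 * pi" if "a \<le> n" "n \<le> b" for n
    using mono'[of a n] mono'[of n b] lo hi that by auto
  define C where "C = (\<lambda>n. 1 / (1 - cis (G n)))"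
  define e where "e = (\<lambda>n. cis (F n))"
  \<comment> \<open>Each term is a difference of consecutive terms divided by
    \<open>1 - cis (G n)\<close>. At \<open>n = b\<close> this brings in \<open>F (Suc b)\<close>,
    one phase beyond the sum.\<close>
  have en: "e n = (e n - e (Suc n)) * C n" if "a \<le> n" "n \<le> b" for n
  proof -
    have "e (Suc n) = e n * cis (G n)" by (simp add: e_def G_def cis_mult)
    then show ?thesis using inverse_one_minus_cis(2)[OF G[OF that]] by (simp add: C_def field_simps)
  qed
  have "(\<Sum>n=a..m. e n) = C a * e a - C m * e (Suc m) + (\<Sum>n=a..<m. e (Suc n) * (C (Suc n) - C n))"
    if "m \<le> b" "a \<le> m" for m
    using that(2,1)
  proof (induction m rule: dec_induct)
    case base then show ?case using en[of a] ab by (simp add: algebra_simps)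
  next
    case (step m)
    then have E: "e (Suc m) = (e (Suc m) - e (Suc (Suc m))) * C (Suc m)" by (intro en) auto
    have IH: "(\<Sum>n=a..m. e n) = C a * e a - C m * e (Suc m) + (\<Sum>n=a..<m. e (Suc n) * (C (Suc n) - C n))"
      using step by simp
    have "(\<Sum>n=a..Suc m. e n) = (\<Sum>n=a..m. e n) + e (Suc m)" using step by simp
    also have "\<dots> = (C a * e a - C m * e (Suc m) + (\<Sum>n=a..<m. e (Suc n) * (C (Suc n) - C n)))
        + (e (Suc m) - e (Suc (Suc m))) * C (Suc m)"
      by (rule arg_cong2[OF IH E, of "(+)"])
    finally show ?case using step.hyps(1) by (simp add: algebra_simps)
  qed
  then have "norm (\<Sum>n=a..b. e n) \<le> norm (C a) + norm (C b) + (\<Sum>n=a..<b. norm (C (Suc n) - C n))"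
  proof -
    assume "\<And>m. m \<le> b \<Longrightarrow> a \<le> m \<Longrightarrow> (\<Sum>n=a..m. e n) = C a * e a - C m * e (Suc m) + (\<Sum>n=a..<m. e (Suc n) * (C (Suc n) - C n))"
    from this[OF order.refl ab] have "norm (\<Sum>n=a..b. e n) \<le> norm (C a * e a - C b * e (Suc b)) + norm (\<Sum>n=a..<b. e (Suc n) * (C (Suc n) - C n))"
      by (simp add: norm_triangle_ineq)
    also have "norm (C a * e a - C b * e (Suc b)) \<le> norm (C a) + norm (C b)"
      by (rule order.trans[OF norm_triangle_ineq4]) (simp add: norm_mult e_def)
    also have "norm (\<Sum>n=a..<b. e (Suc n) * (C (Suc n) - C n)) \<le> (\<Sum>n=a..<b. norm (C (Suc n) - C n))"
      by (rule order.trans[OF norm_sum]) (simp add: norm_mult e_def)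
    finally show ?thesis by simp
  qed
  \<comment> \<open>The differences of \<open>C\<close> are purely imaginary, and the monotone
    cotangent gives them all the same sign, so the total variation telescopes.\<close>
  also have "(\<Sum>n=a..<b. norm (C (Suc n) - C n)) = (\<Sum>n=a..<b. cot (G n / 2) / 2 - cot (G (Suc n) / 2) / 2)"
  proof (intro sum.cong refl)
    fix n assume n: "n \<in> {a..<b}"
    have "C (Suc n) - C n = Complex 0 (cot (G (Suc n) / 2) / 2 - cot (G n / 2) / 2)"
      unfolding C_def using n by (subst (1 2) inverse_one_minus_cis(1)) (auto simp: G complex_eq_iff)
    moreover have "cot (G (Suc n) / 2) \<le> cot (G n / 2)"
      using n G[of n] G[of "Suc n"] mono[of n] by (intro cot_antimono) auto
    ultimately show "norm (C (Suc n) - C n) = cot (G n / 2) / 2 - cot (G (Suc n) / 2) / 2"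
      by (simp add: cmod_def)
  qed
  also have "\<dots> = cot (G a / 2) / 2 - cot (G b / 2) / 2"
    using sum_Suc_diff'[OF ab, of "\<lambda>n. - cot (G n / 2) / 2"] by (simp add: algebra_simps)
  also have "norm (C a) + norm (C b) + (cot (G a / 2) / 2 - cot (G b / 2) / 2)
     = (cot (G a / 2) + 1 / sin (G a / 2)) / 2 + (1 / sin (G b / 2) - cot (G b / 2)) / 2"
    unfolding C_def using G ab by (subst (1 2) inverse_one_minus_cis(3)) (auto simp: field_simps)
  also have "\<dots> = cot (G a / 4) / 2 + cot ((2 * pi - G b) / 4) / 2"
    using cot_half_angle(1)[of "G a"] cot_half_angle(2)[of "G b"] G[of a] G[of b] ab by simp
  also have "\<dots> \<le> (1 / (G a / 4)) / 2 + (1 / ((2 * pi - G b) / 4)) / 2"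
    using G[of a] G[of b] ab by (intro add_mono divide_right_mono cot_le_inverse) auto
  also have "\<dots> = 2 / G a + 2 / (2 * pi - G b)"
  proof -
    have h: "(1 / (u / 4)) / 2 = 2 / u" for u :: real by simp
    show ?thesis by (simp only: h)
  qed
  finally show ?thesis by (simp add: e_def)
qed

text \<open>Passing to the phase \<open>2 * pi * n - F n\<close> conjugates every term and replaces
  the increments \<open>G n\<close> by \<open>2 * pi - G n\<close>, which reverses their
  order.\<close>

lemma Kusmin_Landau_antimono:
  fixes F :: "nat \<Rightarrow> real"
  defines "G \<equiv> \<lambda>n. F (Suc n) - F n"
  assumes ab: "a \<le> b" and mono: "\<And>n. a \<le> n \<Longrightarrow> n < b \<Longrightarrow> G (Suc n) \<le> G n"
    and lo: "0 < G b" and hi: "G a < 2 * pi"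
  shows "norm (\<Sum>n=a..b. cis (F n)) \<le> 2 / G b + 2 / (2 * pi - G a)"
proof -
  define F' where "F' = (\<lambda>n. 2 * pi * real n - F n)"
  have G': "F' (Suc n) - F' n = 2 * pi - G n" for n by (simp add: F'_def G_def algebra_simps)
  have "cis (F' n) = cnj (cis (F n))" for n
    using cis_mult[of "2 * pi * real n" "- F n"] by (simp add: F'_def cis_cnj cis_multiple_2pi)
  then have "norm (\<Sum>n=a..b. cis (F n)) = norm (\<Sum>n=a..b. cis (F' n))"
    by (metis (no_types, lifting) cnj_sum complex_mod_cnj sum.cong)
  also have "\<dots> \<le> 2 / (F' (Suc a) - F' a) + 2 / (2 * pi - (F' (Suc b) - F' b))"
    by (rule Kusmin_Landau) (use ab mono lo hi in \<open>auto simp: G'\<close>)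
  also have "\<dots> = 2 / G b + 2 / (2 * pi - G a)" unfolding G' by simp
  finally show ?thesis .
qed

lemma convex_nat_set_eq_atLeastAtMost:
  fixes S :: "nat set"
  assumes "finite S" "S \<noteq> {}" "\<And>i j n. i \<in> S \<Longrightarrow> j \<in> S \<Longrightarrow> i \<le> n \<Longrightarrow> n \<le> j \<Longrightarrow> n \<in> S"
  shows "S = {Min S..Max S}"
proof (rule antisym)
  show "S \<subseteq> {Min S..Max S}" using assms(1) by (auto intro: Min_le Max_ge)
  show "{Min S..Max S} \<subseteq> S" using assms(3)[OF Min_in[OF assms(1,2)] Max_in[OF assms(1,2)]] by auto
qed

lemma increments_ge:
  fixes G :: "nat \<Rightarrow> real"
  assumes inc: "\<And>n. a \<le> n \<Longrightarrow> Suc n < b \<Longrightarrow> G n + lam \<le> G (Suc n)"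
    and "a \<le> m" "m \<le> n" "n < b"
  shows "G m + real (n - m) * lam \<le> G n"
  using assms(3,4)
proof (induction n rule: dec_induct)
  case (step n)
  then have "G m + real (n - m) * lam \<le> G n" "G n + lam \<le> G (Suc n)" using inc[of n] assms(2) by auto
  moreover have "real (Suc n - m) = real (n - m) + 1" using step by (simp add: Suc_diff_le)
  ultimately show ?case by (simp add: distrib_right)
qed simp

text \<open>On a cell where \<open>G\<close> runs through one period, the points with \<open>G\<close> close to the period lattice
  are counted, the others are handled by the Kusmin-Landau inequality.\<close>

lemma cell_bound:
  fixes F :: "nat \<Rightarrow> real"
  defines "G \<equiv> \<lambda>n. F (Suc n) - F n"
  assumes inc: "\<And>n. a \<le> n \<Longrightarrow> Suc n < b \<Longrightarrow> G n + lam \<le> G (Suc n)"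
    and lam: "0 < lam" and D: "0 < D" "D < pi"
  shows "norm (\<Sum>n\<in>{n\<in>{a..<b}. 2 * pi * of_int m - D \<le> G n \<and> G n < 2 * pi * of_int m + 2 * pi - D}. cis (F n))
    \<le> 2 * D / lam + 1 + 4 / D"
proof -
  have mono: "G i \<le> G j" if "a \<le> i" "i \<le> j" "j < b" for i j
  proof -
    have "G i + real (j - i) * lam \<le> G j" using that by (intro increments_ge[of a b G lam i j, OF inc])
    moreover have "real (j - i) * lam \<ge> 0" using lam by simp
    ultimately show ?thesis by linarith
  qed
  define P where "P = {n\<in>{a..<b}. 2 * pi * of_int m - D \<le> G n \<and> G n < 2 * pi * of_int m + 2 * pi - D}"
  define A where "A = {n\<in>P. G n < 2 * pi * of_int m + D}"
  define B where "B = {n\<in>P. \<not> G n < 2 * pi * of_int m + D}"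
  have fin: "finite P" "finite A" "finite B" by (auto simp: P_def A_def B_def)
  have "norm (\<Sum>n\<in>A. cis (F n)) \<le> 2 * D / lam + 1"
  proof (cases "A = {}")
    case True then show ?thesis using lam D by (simp add: field_simps)
  next
    case False
    have A: "A = {Min A..Max A}"
    proof (rule convex_nat_set_eq_atLeastAtMost[OF fin(2) False])
      fix i j n assume "i \<in> A" "j \<in> A" "i \<le> n" "n \<le> j"
      then show "n \<in> A" using mono[of i n] mono[of n j] by (auto simp: A_def P_def)
    qed
    have "Min A \<in> A" "Max A \<in> A" using fin False by auto
    then have le: "Min A \<le> Max A" "a \<le> Min A" "Max A < b" and "G (Max A) - G (Min A) < 2 * D"
      using fin by (auto simp: A_def P_def)
    then have "real (Max A - Min A) * lam < 2 * D"
    proof -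
      have "G (Min A) + real (Max A - Min A) * lam \<le> G (Max A)"
        using le by (intro increments_ge[of a b G lam "Min A" "Max A", OF inc])
      then show ?thesis using \<open>G (Max A) - G (Min A) < 2 * D\<close> by linarith
    qed
    then have "real (Max A - Min A) \<le> 2 * D / lam" using lam by (simp add: field_simps)
    moreover have "real (card A) = real (Max A - Min A) + 1"
      using le by (subst A) simp
    moreover have "norm (\<Sum>n\<in>A. cis (F n)) \<le> real (card A)"
      by (rule order.trans[OF norm_sum]) simp
    ultimately show ?thesis by simp
  qed
  moreover have "norm (\<Sum>n\<in>B. cis (F n)) \<le> 4 / D"
  proof (cases "B = {}")
    case True then show ?thesis using D by simp
  next
    case False
    have B: "B = {Min B..Max B}"
    proof (rule convex_nat_set_eq_atLeastAtMost[OF fin(3) False])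
      fix i j n assume "i \<in> B" "j \<in> B" "i \<le> n" "n \<le> j"
      then show "n \<in> B" using mono[of i n] mono[of n j] by (auto simp: B_def P_def)
    qed
    have in_B: "Min B \<in> B" "Max B \<in> B" using fin False by auto
    then have le: "Min B \<le> Max B" "a \<le> Min B" "Max B < b" using fin by (auto simp: B_def P_def)
    \<comment> \<open>Subtracting a multiple of \<open>2 * pi * n\<close> does not change
      \<open>cis\<close>, and moves the increments on \<open>B\<close> between \<open>D\<close> and
      \<open>2 * pi - D\<close>.\<close>
    define F' where "F' = (\<lambda>n. F n - 2 * pi * (of_int m * real n))"
    have G': "F' (Suc n) - F' n = G n - 2 * pi * of_int m" for n by (simp add: F'_def G_def algebra_simps)
    have "cis (F' n) = cis (F n)" for n
    proof -
      have "cis (2 * pi * (of_int (- m * int n))) = 1" by (rule cis_multiple_2pi) simp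
      then show ?thesis using cis_mult[of "F n" "2 * pi * (of_int (- m * int n))"] by (simp add: F'_def)
    qed
    then have "norm (\<Sum>n\<in>B. cis (F n)) = norm (\<Sum>n=Min B..Max B. cis (F' n))" by (subst B) simp
    also have "\<dots> \<le> 2 / (F' (Suc (Min B)) - F' (Min B)) + 2 / (2 * pi - (F' (Suc (Max B)) - F' (Max B)))"
    proof (rule Kusmin_Landau)
      fix n assume "Min B \<le> n" "n < Max B"
      then show "F' (Suc n) - F' n \<le> F' (Suc (Suc n)) - F' (Suc n)"
        unfolding G' using mono[of n "Suc n"] le by simp
    qed (use in_B le D in \<open>auto simp: G' B_def P_def\<close>)
    also have "\<dots> \<le> 2 / D + 2 / D"
      unfolding G' using in_B D by (intro add_mono divide_left_mono mult_pos_pos) (auto simp: B_def P_def)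
    finally show ?thesis by simp
  qed
  moreover have "(\<Sum>n\<in>P. cis (F n)) = (\<Sum>n\<in>A. cis (F n)) + (\<Sum>n\<in>B. cis (F n))"
  proof -
    have "P = A \<union> B" "A \<inter> B = {}" by (auto simp: A_def B_def)
    then show ?thesis using fin by (metis sum.union_disjoint)
  qed
  ultimately have "norm (\<Sum>n\<in>P. cis (F n)) \<le> 2 * D / lam + 1 + 4 / D"
    using norm_triangle_mono by metis
  then show ?thesis unfolding P_def .
qed

text \<open>The points are grouped by the cell of length \<open>2 * pi\<close> that contains
  \<open>G n + D\<close>. As \<open>G\<close> rises by at most \<open>R\<close>, there are at most
  \<open>R / (2 * pi) + 2\<close> cells. The last \<open>+ 1\<close> is the term
  \<open>n = b\<close>: the hypotheses control the increments only up to
  \<open>G (b - 1)\<close>.\<close>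

theorem second_difference_test:
  fixes F :: "nat \<Rightarrow> real"
  defines "G \<equiv> \<lambda>n. F (Suc n) - F n"
  assumes inc: "\<And>n. a \<le> n \<Longrightarrow> Suc n < b \<Longrightarrow> G n + lam \<le> G (Suc n)"
    and lam: "0 < lam" "lam \<le> 1" and ab: "a \<le> b" and R: "R \<ge> 0" "a < b \<Longrightarrow> G (b - 1) - G a \<le> R"
  shows "norm (\<Sum>n=a..b. cis (F n)) \<le> (R / (2 * pi) + 2) * (4 * sqrt 2 / sqrt lam + 1) + 1"
proof (cases "a < b")
  case False
  have "(R / (2 * pi) + 2) * (4 * sqrt 2 / sqrt lam + 1) \<ge> 0"
    using R lam by (intro mult_nonneg_nonneg add_nonneg_nonneg divide_nonneg_nonneg) auto
  then show ?thesis using False ab by simp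
next
  case True
  \<comment> \<open>This choice minimises the cell bound \<open>2 * D / lam + 4 / D\<close>;
    \<open>lam \<le> 1\<close> keeps it at most 2 and so below \<open>pi\<close>.\<close>
  define D where "D = sqrt (2 * lam)"
  have D: "0 < D" "D < pi"
  proof -
    have "D \<le> sqrt 4" unfolding D_def using lam by (intro real_sqrt_le_mono) auto
    then show "D < pi" using pi_gt3 by simp
  qed (use lam in \<open>simp add: D_def\<close>)
  have mono: "G i \<le> G j" if "a \<le> i" "i \<le> j" "j < b" for i j
  proof -
    have "G i + real (j - i) * lam \<le> G j" using that by (intro increments_ge[of a b G lam i j, OF inc])
    moreover have "real (j - i) * lam \<ge> 0" using lam by simp
    ultimately show ?thesis by linarith
  qed
  have two_pi: "2 * pi > 0" by simp
  define c where "c = (\<lambda>n. \<lfloor>(G n + D) / (2 * pi)\<rfloor>)"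
  define M where "M = {c a..c (b - 1)}"
  have cM: "c n \<in> M" if "n \<in> {a..<b}" for n
  proof -
    have "G a \<le> G n" "G n \<le> G (b - 1)" using that by (auto intro!: mono)
    then have "(G a + D) / (2 * pi) \<le> (G n + D) / (2 * pi)" "(G n + D) / (2 * pi) \<le> (G (b - 1) + D) / (2 * pi)"
      by (auto intro!: divide_right_mono)
    then show ?thesis unfolding M_def c_def by (simp add: floor_mono)
  qed
  have cell: "{n\<in>{a..<b}. c n = m} = {n\<in>{a..<b}. 2 * pi * of_int m - D \<le> G n \<and> G n < 2 * pi * of_int m + 2 * pi - D}" for m
  proof -
    have "c n = m \<longleftrightarrow> 2 * pi * of_int m - D \<le> G n \<and> G n < 2 * pi * of_int m + 2 * pi - D" for n
      unfolding c_def floor_eq_iff pos_le_divide_eq[OF two_pi] pos_divide_less_eq[OF two_pi]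
      by (simp only: algebra_simps) linarith
    then show ?thesis by simp
  qed
  have "norm (\<Sum>n=a..<b. cis (F n)) = norm (\<Sum>m\<in>M. \<Sum>n\<in>{n\<in>{a..<b}. c n = m}. cis (F n))"
    by (subst sum.group) (auto simp: cM M_def[symmetric], simp add: M_def)
  also have "\<dots> \<le> (\<Sum>m\<in>M. 2 * D / lam + 1 + 4 / D)"
  proof (rule sum_norm_le)
    fix m assume "m \<in> M"
    show "norm (\<Sum>n\<in>{n\<in>{a..<b}. c n = m}. cis (F n)) \<le> 2 * D / lam + 1 + 4 / D"
      unfolding cell unfolding G_def using inc lam(1) D unfolding G_def by (rule cell_bound)
  qed
  also have "\<dots> = real (card M) * (2 * D / lam + 1 + 4 / D)" by simp
  also have "\<dots> \<le> (R / (2 * pi) + 2) * (2 * D / lam + 1 + 4 / D)"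
  proof (rule mult_right_mono)
    have "c a \<le> c (b - 1)" using cM[of a] True by (simp add: M_def)
    then have "real (card M) = of_int (c (b - 1)) - of_int (c a) + 1" by (simp add: M_def)
    also have "\<dots> \<le> (G (b - 1) + D) / (2 * pi) - ((G a + D) / (2 * pi) - 1) + 1"
      unfolding c_def by linarith
    also have "\<dots> = (G (b - 1) - G a) / (2 * pi) + 2" by (simp add: field_simps)
    also have "\<dots> \<le> R / (2 * pi) + 2" using R True by (simp add: divide_right_mono)
    finally show "real (card M) \<le> R / (2 * pi) + 2" .
  qed (use D lam in simp)
  also have "2 * D / lam + 1 + 4 / D = 4 * sqrt 2 / sqrt lam + 1"
  proof -
    define q r where "q = sqrt lam" and "r = sqrt 2"
    have q: "q > 0" "lam = q * q" and r: "r > 0" "r * r = 2" using lam by (auto simp: q_def r_def)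
    have "D = r * q" by (simp add: D_def q_def r_def real_sqrt_mult)
    then have "2 * D / lam = 2 * r / q" "4 / D = 2 * r / q"
      using q r by (auto simp: field_simps)
    then show ?thesis by (simp add: q_def r_def)
  qed
  finally have "norm (\<Sum>n=a..<b. cis (F n)) \<le> (R / (2 * pi) + 2) * (4 * sqrt 2 / sqrt lam + 1)" .
  moreover have "(\<Sum>n=a..b. cis (F n)) = (\<Sum>n=a..<b. cis (F n)) + cis (F b)"
    using ab by (simp add: sum.last_plus add.commute)
  ultimately show ?thesis using norm_triangle_ineq[of "\<Sum>n=a..<b. cis (F n)" "cis (F b)"] by simp
qed

section \<open>Weighted sums of powers of the shift\<close>

lemma powr_le_one_add:
  fixes x a :: real
  assumes "0 < x" "0 \<le> a" "a \<le> 1"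
  shows "x powr a \<le> 1 + a * (x - 1)"
proof -
  have "exp ((1 - a) * 0 + a * ln x) \<le> (1 - a) * exp 0 + a * exp (ln x)"
    using convex_onD[OF exp_convex, of a 0 "ln x"] assms by simp
  then show ?thesis using assms by (simp add: powr_def algebra_simps)
qed

lemma sum_weight_linear: "2 * (\<Sum>d=1..<H. real (H - d)) = real H * (real H - 1)"
  "6 * (\<Sum>d=1..<H. real (H - d) * real d) = real H * ((real H)\<^sup>2 - 1)"
proof (induction H)
  case (Suc H)
  have *: "(\<Sum>d=1..<Suc H. real (Suc H - d) * f d) = (\<Sum>d=1..<H. real (H - d) * f d) + (\<Sum>d=1..H. f d)" for f
  proof -
    have "(\<Sum>d=1..<Suc H. real (Suc H - d) * f d) = (\<Sum>d=1..H. real (H - d) * f d + f d)"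
      by (intro sum.cong) (auto simp: algebra_simps of_nat_diff)
    also have "(\<Sum>d=1..H. real (H - d) * f d + f d) = (\<Sum>d=1..H. real (H - d) * f d) + (\<Sum>d=1..H. f d)"
      by (rule sum.distrib)
    also have "(\<Sum>d=1..H. real (H - d) * f d) = (\<Sum>d=1..<H. real (H - d) * f d)"
      by (rule sum.mono_neutral_right) auto
    finally show ?thesis .
  qed
  have g: "(\<Sum>d=1..H. real d) = real H * (real H + 1) / 2"
    by (induction H) (auto simp: field_simps)
  show "2 * (\<Sum>d=1..<Suc H. real (Suc H - d)) = real (Suc H) * (real (Suc H) - 1)"
    using *[of "\<lambda>_. 1"] Suc.IH(1) by (simp add: algebra_simps)
  show "6 * (\<Sum>d=1..<Suc H. real (Suc H - d) * real d) = real (Suc H) * ((real (Suc H))\<^sup>2 - 1)"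
    using *[of real] Suc.IH(2) g by (simp add: algebra_simps power2_eq_square)
qed simp_all

text \<open>Concavity: the tangent of the power function is taken at the weighted mean \<open>(H + 1) / 3\<close>.\<close>

lemma sum_weight_powr:
  fixes a :: real
  assumes a: "0 \<le> a" "a \<le> 1" and H: "H \<ge> 1"
  shows "2 * (\<Sum>d=1..<H. real (H - d) * real d powr a) \<le> (real H)\<^sup>2 * (real H / 3) powr a"
proof -
  define c where "c = (real H + 1) / 3"
  have c: "c > 0" by (simp add: c_def)
  have t: "real d powr a \<le> c powr a * ((1 - a) + (a / c) * real d)" if "d \<ge> 1" for d :: nat
  proof -
    have "(real d / c) powr a \<le> 1 + a * (real d / c - 1)" using that c a by (intro powr_le_one_add) auto
    then have "c powr a * (real d / c) powr a \<le> c powr a * (1 + a * (real d / c - 1))"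
      by (rule mult_left_mono) simp
    moreover have "1 + a * (real d / c - 1) = (1 - a) + (a / c) * real d" by (simp add: algebra_simps)
    ultimately show ?thesis using c by (simp add: powr_mult[symmetric])
  qed
  have "2 * (\<Sum>d=1..<H. real (H - d) * real d powr a)
     \<le> 2 * (\<Sum>d=1..<H. real (H - d) * (c powr a * ((1 - a) + (a / c) * real d)))"
    by (intro mult_left_mono sum_mono t) auto
  also have "\<dots> = c powr a * (2 * (\<Sum>d=1..<H. real (H - d)) * (1 - a)
      + (a / c) * (2 * (\<Sum>d=1..<H. real (H - d) * real d)))"
    by (simp add: sum_distrib_left sum_distrib_right sum.distrib[symmetric] algebra_simps diff_divide_distrib add_divide_distrib)
  also have "2 * (\<Sum>d=1..<H. real (H - d) * real d) = c * (real H * (real H - 1))"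
    using sum_weight_linear(2)[of H] by (simp add: c_def power2_eq_square field_simps)
  also have "c powr a * (2 * (\<Sum>d=1..<H. real (H - d)) * (1 - a) + (a / c) * (c * (real H * (real H - 1))))
     = real H * ((real H - 1) * c powr a)"
    unfolding sum_weight_linear(1) using c by (simp add: algebra_simps)
  \<comment> \<open>Going from \<open>(H + 1) / 3\<close> to \<open>H / 3\<close> costs at most a
    factor \<open>1 + 1 / H\<close>, which the factor \<open>H - 1\<close> pays for because
    \<open>(H - 1) * (1 + 1 / H) \<le> H\<close>.\<close>
  also have "\<dots> \<le> real H * (real H * (real H / 3) powr a)"
  proof (rule mult_left_mono)
    have "c = (1 + 1 / real H) * (real H / 3)" using H by (simp add: c_def field_simps)
    then have "c powr a = ((1 + 1 / real H) * (real H / 3)) powr a" by (rule arg_cong)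
    then have "c powr a = (1 + 1 / real H) powr a * (real H / 3) powr a" by (subst (asm) powr_mult) auto
    also have "(1 + 1 / real H) powr a \<le> (1 + 1 / real H) powr 1" using a by (intro powr_mono) auto
    finally have "c powr a \<le> (1 + 1 / real H) * (real H / 3) powr a" by (simp add: mult_right_mono)
    then have "(real H - 1) * c powr a \<le> (real H - 1) * ((1 + 1 / real H) * (real H / 3) powr a)"
      using H by (intro mult_left_mono) auto
    also have "\<dots> = ((real H - 1) * (1 + 1 / real H)) * (real H / 3) powr a" by simp
    also have "\<dots> \<le> real H * (real H / 3) powr a"
      using H by (intro mult_right_mono) (auto simp: field_simps)
    finally show "(real H - 1) * c powr a \<le> real H * (real H / 3) powr a" .
  qed simp
  finally show ?thesis by (simp add: power2_eq_square)
qed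

lemma powr_add_one_diff:
  fixes x s :: real
  assumes "0 < x"
  obtains y where "x < y" "y < x + 1" "(x + 1) powr s - x powr s = s * y powr (s - 1)"
proof -
  have "\<exists>z>x. z < x + 1 \<and> (x + 1) powr s - x powr s = (x + 1 - x) * (s * z powr (s - 1))"
    using assms by (intro MVT2) (auto intro!: has_real_derivative_powr)
  then show ?thesis using that by auto
qed

lemma sum_powr_minus_le:
  fixes a :: real
  assumes a: "0 \<le> a" "a < 1"
  shows "(\<Sum>d=1..H. real d powr (- a)) \<le> real H powr (1 - a) / (1 - a)"
proof (induction H)
  case (Suc H)
  show ?case
  proof (cases "H = 0")
    case True then show ?thesis using a by (simp add: field_simps)
  next
    case False
    obtain y where y: "real H < y" "y < real H + 1"
      "(real H + 1) powr (1 - a) - real H powr (1 - a) = (1 - a) * y powr (1 - a - 1)"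
      using powr_add_one_diff[of "real H" "1 - a"] False by auto
    have "(real H + 1) powr (- a) \<le> y powr (- a)" using y a by (intro powr_mono2') auto
    also have "\<dots> = ((real H + 1) powr (1 - a) - real H powr (1 - a)) / (1 - a)"
      using y a by simp
    finally show ?thesis using Suc.IH a by (simp add: add.commute diff_divide_distrib)
  qed
qed (use a in simp)

text \<open>Raising \<open>H\<close> by one adds the plain sum of \<open>d powr (- a)\<close>, so
  the weighted sum is a discrete double integral of that power. Each step is compared with the true
  integral by the mean value theorem.\<close>

lemma sum_weight_powr_minus:
  fixes a :: real
  assumes a: "0 \<le> a" "a < 1"
  shows "(\<Sum>d=1..<H. real (H - d) * real d powr (- a)) \<le> real H powr (2 - a) / ((1 - a) * (2 - a))"
proof (induction H)
  case (Suc H)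
  show ?case
  proof (cases "H = 0")
    case True then show ?thesis using a by simp
  next
    case False
    obtain y where y: "real H < y" "y < real H + 1"
      "(real H + 1) powr (2 - a) - real H powr (2 - a) = (2 - a) * y powr (2 - a - 1)"
      using powr_add_one_diff[of "real H" "2 - a"] False by auto
    have "(\<Sum>d=1..<Suc H. real (Suc H - d) * real d powr (- a))
       = (\<Sum>d=1..H. real (H - d) * real d powr (- a) + real d powr (- a))"
      by (intro sum.cong) (auto simp: algebra_simps of_nat_diff)
    also have "\<dots> = (\<Sum>d=1..H. real (H - d) * real d powr (- a)) + (\<Sum>d=1..H. real d powr (- a))"
      by (rule sum.distrib)
    also have "(\<Sum>d=1..H. real (H - d) * real d powr (- a)) = (\<Sum>d=1..<H. real (H - d) * real d powr (- a))"
      by (rule sum.mono_neutral_right) auto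
    also have "(\<Sum>d=1..H. real d powr (- a)) \<le> real H powr (1 - a) / (1 - a)"
      using a by (rule sum_powr_minus_le)
    also have "real H powr (1 - a) \<le> y powr (1 - a)" using y a by (intro powr_mono2) auto
    also have "y powr (1 - a) = ((real H + 1) powr (2 - a) - real H powr (2 - a)) / (2 - a)"
      using y a by simp
    also have "(\<Sum>d=1..<H. real (H - d) * real d powr (- a)) \<le> real H powr (2 - a) / ((1 - a) * (2 - a))"
      by (rule Suc.IH)
    also have "real H powr (2 - a) / ((1 - a) * (2 - a))
        + ((real H + 1) powr (2 - a) - real H powr (2 - a)) / (2 - a) / (1 - a)
       = real (Suc H) powr (2 - a) / ((1 - a) * (2 - a))"
      using a by (simp add: diff_divide_distrib mult.commute add.commute)
    finally show ?thesis using a by (simp add: divide_right_mono)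
  qed
qed (use a in simp)

lemma second_derivative_test:
  fixes D :: "nat \<Rightarrow> real \<Rightarrow> real"
  assumes ab: "a \<le> b"
    and d0: "\<And>x. real a \<le> x \<Longrightarrow> x \<le> real b \<Longrightarrow> (D 0 has_real_derivative D 1 x) (at x)"
    and d1: "\<And>x. real a \<le> x \<Longrightarrow> x \<le> real b \<Longrightarrow> (D 1 has_real_derivative D 2 x) (at x)"
    and d2: "\<And>x. real a \<le> x \<Longrightarrow> x \<le> real b \<Longrightarrow> lam \<le> D 2 x"
    and lam: "0 < lam" "lam \<le> 1" and R: "D 1 (real b) - D 1 (real a) \<le> R"
  shows "norm (\<Sum>n=a..b. cis (D 0 (real n))) \<le> (R / (2 * pi) + 2) * (4 * sqrt 2 / sqrt lam + 1) + 1"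
proof (rule second_difference_test[OF _ lam ab])
  have mono1: "D 1 x \<le> D 1 y" if "real a \<le> x" "x \<le> y" "y \<le> real b" for x y
  proof (rule DERIV_nonneg_imp_nondecreasing[OF \<open>x \<le> y\<close>])
    fix u assume "x \<le> u" "u \<le> y"
    then show "\<exists>v. (D 1 has_real_derivative v) (at u) \<and> v \<ge> 0"
      using d1[of u] d2[of u] lam that by (intro exI[of _ "D 2 u"]) auto
  qed
  show "R \<ge> 0" using mono1[of "real a" "real b"] R ab by simp
  have step: "\<exists>z. real n \<le> z \<and> z \<le> real n + 1 \<and> D 0 (real (Suc n)) - D 0 (real n) = D 1 z" if "a \<le> n" "n < b" for n
  proof -
    have "\<exists>z>real n. z < real n + 1 \<and> D 0 (real n + 1) - D 0 (real n) = (real n + 1 - real n) * D 1 z"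
      using that by (intro MVT2 d0) auto
    then show ?thesis by (auto intro: less_imp_le simp: add.commute)
  qed
  show "D 0 (real (Suc n)) - D 0 (real n) + lam \<le> D 0 (real (Suc (Suc n))) - D 0 (real (Suc n))"
    if "a \<le> n" "Suc n < b" for n
  proof -
    define g where "g = (\<lambda>x. D 0 (x + 1) - D 0 x)"
    have "\<exists>z>real n. z < real n + 1 \<and> g (real n + 1) - g (real n) = (real n + 1 - real n) * (D 1 (z + 1) - D 1 z)"
      unfolding g_def using that
      by (intro MVT2 DERIV_diff d0 DERIV_shift[THEN iffD1, OF d0]) auto
    then obtain z where z: "real n < z" "z < real n + 1" "g (real n + 1) - g (real n) = D 1 (z + 1) - D 1 z" by auto
    have "\<exists>w>z. w < z + 1 \<and> D 1 (z + 1) - D 1 z = (z + 1 - z) * D 2 w"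
      using that z by (intro MVT2 d1) auto
    then obtain w where w: "z < w" "w < z + 1" "D 1 (z + 1) - D 1 z = D 2 w" by auto
    have "lam \<le> D 2 w" using w z that by (intro d2) auto
    then have "lam \<le> g (real n + 1) - g (real n)" using z w by simp
    then show ?thesis by (simp add: g_def algebra_simps)
  qed
  assume "a < b"
  obtain z where z: "real a \<le> z" "z \<le> real a + 1" "D 0 (real (Suc a)) - D 0 (real a) = D 1 z"
    using step[of a] \<open>a < b\<close> by auto
  obtain c where c: "b = Suc c" using \<open>a < b\<close> by (cases b) auto
  obtain w where w: "real c \<le> w" "w \<le> real c + 1" "D 0 (real (Suc c)) - D 0 (real c) = D 1 w"
    using step[of c] \<open>a < b\<close> c by auto
  have "D 1 w \<le> D 1 (real b)" using w \<open>a < b\<close> c by (intro mono1) auto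
  moreover have "D 1 (real a) \<le> D 1 z" using z \<open>a < b\<close> by (intro mono1) auto
  ultimately show "D 0 (real (Suc (b - 1))) - D 0 (real (b - 1)) - (D 0 (real (Suc a)) - D 0 (real a)) \<le> R"
    using z w R c by simp
qed

subsection \<open>Derivative tests of higher order\<close>

text \<open>The classical bound of van der Corput for a phase whose derivative of order
  \<open>k\<close> lies between \<open>lam\<close> and \<open>h * lam\<close>. The quantification
  over all phases lets the induction apply it to differenced ones. The derivatives are supplied as a
  family \<open>D\<close>, to each member of which differencing applies, and \<open>N\<close> is
  only an upper bound for the length, so that it can be kept when differencing shortens the
  interval.\<close>

definition derivative_test :: "nat \<Rightarrow> real \<Rightarrow> real \<Rightarrow> bool" where
  "derivative_test k A B \<longleftrightarrow> (\<forall>(D :: nat \<Rightarrow> real \<Rightarrow> real) a b lam h N.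
     a \<le> b \<longrightarrow> real (Suc b - a) \<le> N \<longrightarrow> 0 < lam \<longrightarrow> 1 \<le> h \<longrightarrow>
     (\<forall>i<k. \<forall>x. real a \<le> x \<and> x \<le> real b \<longrightarrow> (D i has_real_derivative D (Suc i) x) (at x)) \<longrightarrow>
     (\<forall>x. real a \<le> x \<and> x \<le> real b \<longrightarrow> lam \<le> D k x \<and> D k x \<le> h * lam) \<longrightarrow>
     norm (\<Sum>n=a..b. cis (D 0 (real n)))
       \<le> A * h powr (2 / 2 ^ (k - 1)) * N * lam powr (1 / (2 ^ k - 2))
         + B * N powr (1 - 2 / 2 ^ (k - 1)) * lam powr (- 1 / (2 ^ k - 2)))"

lemma derivative_testD:
  fixes D :: "nat \<Rightarrow> real \<Rightarrow> real"
  assumes "derivative_test k A B" "a \<le> b" "real (Suc b - a) \<le> N" "0 < lam" "1 \<le> h"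
    "\<And>i x. i < k \<Longrightarrow> real a \<le> x \<Longrightarrow> x \<le> real b \<Longrightarrow> (D i has_real_derivative D (Suc i) x) (at x)"
    "\<And>x. real a \<le> x \<Longrightarrow> x \<le> real b \<Longrightarrow> lam \<le> D k x \<and> D k x \<le> h * lam"
  shows "norm (\<Sum>n=a..b. cis (D 0 (real n)))
       \<le> A * h powr (2 / 2 ^ (k - 1)) * N * lam powr (1 / (2 ^ k - 2))
         + B * N powr (1 - 2 / 2 ^ (k - 1)) * lam powr (- 1 / (2 ^ k - 2))"
  using assms unfolding derivative_test_def by blast

lemma norm_sum_cis_le: "norm (\<Sum>n\<in>A. cis (f n)) \<le> real (card A)"
  by (rule order.trans[OF norm_sum]) simp

lemma derivative_test_2: "derivative_test 2 1.06 14.4"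
  unfolding derivative_test_def
proof (intro allI impI)
  fix D :: "nat \<Rightarrow> real \<Rightarrow> real" and a b :: nat and lam h N :: real
  assume ab: "a \<le> b" and N: "real (Suc b - a) \<le> N" and lam: "0 < lam" and h: "1 \<le> h"
    and der: "\<forall>i<2. \<forall>x. real a \<le> x \<and> x \<le> real b \<longrightarrow> (D i has_real_derivative D (Suc i) x) (at x)"
    and D2: "\<forall>x. real a \<le> x \<and> x \<le> real b \<longrightarrow> lam \<le> D 2 x \<and> D 2 x \<le> h * lam"
  have N1: "N \<ge> 1" using ab N by (simp add: Suc_diff_le)
  define q where "q = sqrt lam"
  have q: "q > 0" "lam = q * q" using lam by (auto simp: q_def)
  have "norm (\<Sum>n=a..b. cis (D 0 (real n))) \<le> 1.06 * h * N * q + 14.4 / q"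
  \<comment> \<open>For \<open>q > 1\<close> the first term alone exceeds the trivial bound
    \<open>N\<close>. Otherwise \<open>q \<le> 1\<close> absorbs the terms of lower order; 1.06
    comes from \<open>(4 * sqrt 2 + 1) / (2 * pi)\<close> and 14.4 from
    \<open>8 * sqrt 2 + 3\<close>.\<close>
  proof (cases "q \<le> 1")
    case False
    have "norm (\<Sum>n=a..b. cis (D 0 (real n))) \<le> real (card {a..b})" by (rule norm_sum_cis_le)
    also have "\<dots> \<le> 1 * 1 * N * 1" using N by simp
    also have "\<dots> \<le> 1.06 * h * N * q" using h N1 False by (intro mult_mono) auto
    finally show ?thesis using q by (simp add: add_increasing2)
  next
    case True
    have d: "(D 0 has_real_derivative D 1 x) (at x)" "(D 1 has_real_derivative D 2 x) (at x)"
      if "real a \<le> x" "x \<le> real b" for x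
      using der[rule_format, of 0 x] der[rule_format, of 1 x] that by (simp_all add: numeral_2_eq_2)
    have R: "D 1 (real b) - D 1 (real a) \<le> N * h * lam"
    proof (cases "a = b")
      case True then show ?thesis using N1 h lam by simp
    next
      case False
      then have "\<exists>z>real a. z < real b \<and> D 1 (real b) - D 1 (real a) = (real b - real a) * D 2 z"
        using ab by (intro MVT2 d) auto
      then obtain z where z: "real a < z" "z < real b" "D 1 (real b) - D 1 (real a) = (real b - real a) * D 2 z" by auto
      have "(real b - real a) * D 2 z \<le> N * (h * lam)"
        using z D2 N N1 lam ab by (intro mult_mono) (auto simp: Suc_diff_le of_nat_diff intro: order.trans[of 0 lam])
      then show ?thesis using z by simp
    qed
    have lam1: "lam \<le> 1" using q True mult_le_one[of q q] by simp
    have "norm (\<Sum>n=a..b. cis (D 0 (real n))) \<le> (N * h * lam / (2 * pi) + 2) * (4 * sqrt 2 / sqrt lam + 1) + 1"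
      by (rule second_derivative_test[OF ab d _ lam lam1 R]) (use D2 in auto)
    also have "\<dots> \<le> (0.1592 * (N * h * lam) + 2) * (5.657 / q + 1) + 1"
    proof (intro add_mono mult_mono order.refl)
      have "sqrt 2 \<le> sqrt (1.41425\<^sup>2)" by (subst real_sqrt_le_iff) (simp add: power2_eq_square)
      then show "4 * sqrt 2 / sqrt lam \<le> 5.657 / q"
        unfolding q_def[symmetric] using q by (intro divide_right_mono) auto
      have "1 \<le> 0.1592 * (2 * pi)" using pi_approx by simp
      then have "N * h * lam * 1 \<le> N * h * lam * (0.1592 * (2 * pi))"
        using N1 h lam by (intro mult_left_mono) auto
      then show "N * h * lam / (2 * pi) \<le> 0.1592 * (N * h * lam)"
        by (simp add: divide_le_eq algebra_simps)
    qed (use N1 h lam in auto)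
    also have "\<dots> = 0.1592 * 5.657 * (N * h * q) + 0.1592 * (N * h * q) * q + 11.314 / q + 3"
      using q by (simp add: field_simps)
    also have "\<dots> \<le> 0.1592 * 5.657 * (N * h * q) + 0.1592 * (N * h * q) * 1 + 11.314 / q + 3 / q"
      using q True N1 h by (intro add_mono mult_left_mono order.refl) (auto simp: field_simps)
    also have "\<dots> \<le> 1.06 * h * N * q + 14.4 / q"
    proof -
      define V W where "V = N * h * q" and "W = 1 / q"
      have "0 \<le> V" "0 \<le> W" using N1 h q by (auto simp: V_def W_def)
      moreover have "c / q = c * W" for c by (simp add: W_def)
      moreover have "1.06 * h * N * q = 1.06 * V" by (simp add: V_def)
      ultimately show ?thesis unfolding V_def[symmetric] by (simp only:) simp
    qed
    finally show ?thesis .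
  qed
  moreover have "lam powr (1 / (2 ^ 2 - 2)) = q" using lam by (simp add: q_def powr_half_sqrt)
  moreover have "lam powr (- 1 / (2 ^ 2 - 2)) = 1 / q"
    using lam by (simp add: q_def powr_half_sqrt powr_minus_divide)
  ultimately show "norm (\<Sum>n=a..b. cis (D 0 (real n)))
      \<le> 1.06 * h powr (2 / 2 ^ (2 - 1)) * N * lam powr (1 / (2 ^ 2 - 2))
         + 14.4 * N powr (1 - 2 / 2 ^ (2 - 1)) * lam powr (- 1 / (2 ^ 2 - 2))"
    using h N1 by simp
qed

text \<open>Differencing with about \<open>H0 = eta * u\<^sup>2\<close> shifts, where
  \<open>u = lam powr (- 1 / (4 * K - 2))\<close>, balances the diagonal \<open>N / H\<close>
  against the first terms of the tests of order \<open>k\<close>: both are of order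
  \<open>N / u\<^sup>2\<close>. The conditions \<open>cA\<close> and \<open>cB\<close> bound the
  squares of the two new terms separately, which suffices since the sum of two squares is at most
  the square of the sum. \<open>1 + io\<close> accounts for rounding \<open>H0\<close> up to an
  integer, \<open>E\<close> bounds \<open>1 + H / N\<close>, and \<open>cC\<close> serves intervals
  that are short compared with \<open>H0\<close>.\<close>

lemma derivative_test_Suc:
  fixes A B A' B' eta C :: real and k :: nat
  assumes test: "derivative_test k A B" and k: "k \<ge> 2"
    and pos: "A > 0" "B > 0" "A' \<ge> 1" "B' > 0" "eta > 0" "C > 0"
  defines "K \<equiv> 2 ^ (k - 1) :: real"
  defines "al \<equiv> 1 / (2 * K - 2)" and "io \<equiv> 1 / (eta * A'\<^sup>2)"
  defines "E \<equiv> 1 + (1 + io) / C"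
  assumes cA: "E * (1 / eta + A * ((1 + io) * eta / 3) powr al) \<le> A'\<^sup>2"
    and cB: "E * (2 / ((1 - al) * (2 - al)) * B * eta powr (- al)) \<le> B'\<^sup>2"
    and cC: "(C * eta) powr (1 / K) \<le> B'"
  shows "derivative_test (Suc k) A' B'"
  unfolding derivative_test_def
proof (intro allI impI)
  fix D :: "nat \<Rightarrow> real \<Rightarrow> real" and a b :: nat and lam h N :: real
  assume ab: "a \<le> b" and N: "real (Suc b - a) \<le> N" and lam: "0 < lam" and h: "1 \<le> h"
    and der: "\<forall>i<Suc k. \<forall>x. real a \<le> x \<and> x \<le> real b \<longrightarrow> (D i has_real_derivative D (Suc i) x) (at x)"
    and Dk: "\<forall>x. real a \<le> x \<and> x \<le> real b \<longrightarrow> lam \<le> D (Suc k) x \<and> D (Suc k) x \<le> h * lam"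
  have N1: "N \<ge> 1" using ab N by (simp add: Suc_diff_le)
  have K2: "K \<ge> 2" using k power_increasing[of 1 "k - 1" "2::real"] by (simp add: K_def)
  have twok: "(2::real) ^ k = 2 * K" using k by (simp add: K_def power_eq_if)
  have al: "0 < al" "al < 1" using K2 by (auto simp: al_def)
  define be where "be = 1 / (4 * K - 2)"
  have be: "be > 0" using K2 by (simp add: be_def)
  have exps: "2 / 2 ^ (Suc k - 1) = 1 / K" "1 / (2 ^ Suc k - 2) = be" "- 1 / (2 ^ Suc k - 2) = - be"
    by (simp_all add: twok be_def)
  have exps': "2 / 2 ^ (k - 1) = 2 / K" "1 / (2 ^ k - 2) = al" "- 1 / (2 ^ k - 2) = - al"
    by (simp only: K_def) (simp_all add: twok al_def)
  define S where "S = norm (\<Sum>n=a..b. cis (D 0 (real n)))"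
  define u where "u = lam powr (- be)"
  have u: "u > 0" using lam by (simp add: u_def)
  have lamu: "lam powr be = 1 / u" using lam by (simp add: u_def powr_minus_divide)
  define T1 where "T1 = A' * h powr (1 / K) * N / u"
  define T2 where "T2 = B' * N powr (1 - 1 / K) * u"
  have T: "T1 \<ge> 0" "T2 \<ge> 0" using pos N1 u by (auto simp: T1_def T2_def)
  have SN: "S \<le> N"
    using norm_sum_cis_le[of "\<lambda>n. D 0 (real n)" "{a..b}"] N by (simp add: S_def)
  have hK: "h powr (1 / K) \<ge> 1" using h K2 by (simp add: ge_one_powr_ge_zero)
  have "S \<le> T1 + T2"
  \<comment> \<open>Large \<open>lam\<close>: the trivial bound is already below \<open>T1\<close>.
    In the other case \<open>H0\<close> exceeds \<open>eta * A'\<^sup>2 = 1 / io\<close>, which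
    justifies the rounding factor.\<close>
  proof (cases "u \<le> A'")
    case True
    have "N * 1 * 1 \<le> N * h powr (1 / K) * (A' / u)"
      using N1 hK True u by (intro mult_mono) (auto simp: field_simps)
    then have "N \<le> T1" by (simp add: T1_def mult_ac)
    then show ?thesis using SN T by linarith
  next
    case False
    then have u1: "u > A'" "u \<ge> 1" using pos by auto
    define H0 where "H0 = eta * u\<^sup>2"
    have H0: "H0 > 0" using pos u by (simp add: H0_def)
    show ?thesis
    \<comment> \<open>Too few terms for \<open>H0\<close> shifts: here the trivial bound is below
      \<open>T2\<close>, by \<open>cC\<close> and because \<open>2 / K \<le> 1\<close>.\<close>
    proof (cases "N < C * H0")
      case True
      have N_eq: "N = N powr (1 - 1 / K) * N powr (1 / K)" using N1 by (simp add: powr_add[symmetric])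
      have "N powr (1 / K) \<le> (C * H0) powr (1 / K)" using True N1 K2 by (intro powr_mono2) auto
      also have "\<dots> = (C * eta) powr (1 / K) * (u\<^sup>2) powr (1 / K)"
        using pos by (simp add: H0_def powr_mult[symmetric] mult.assoc)
      also have "(u\<^sup>2) powr (1 / K) = u powr (2 / K)" using u by (simp add: powr_powr flip: powr_numeral)
      also have "(C * eta) powr (1 / K) * u powr (2 / K) \<le> B' * u powr 1"
        using cC u1 u pos K2 by (intro mult_mono powr_mono) auto
      finally have "N powr (1 / K) \<le> B' * u" using u by simp
      then have "N powr (1 - 1 / K) * N powr (1 / K) \<le> N powr (1 - 1 / K) * (B' * u)"
        by (rule mult_left_mono) simp
      then have "N \<le> T2" using N_eq by (simp add: T2_def mult_ac)
      then show ?thesis using SN T by linarith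
    next
      case False
      define H where "H = nat \<lceil>H0\<rceil>"
      have H: "H \<ge> 1" "real H \<ge> H0" "real H \<le> H0 + 1"
        using H0 unfolding H_def by linarith+
      have io: "io > 0" using pos by (simp add: io_def)
      have "1 \<le> H0 * io"
      proof -
        have "A'\<^sup>2 \<le> u\<^sup>2" using u1 pos by (intro power_mono) auto
        then show ?thesis unfolding H0_def io_def using pos by simp
      qed
      then have Hio: "real H \<le> H0 * (1 + io)" using H by (simp add: algebra_simps)
      have HN: "real H / N \<le> (1 + io) / C"
      proof -
        have "real H * C \<le> H0 * (1 + io) * C" using Hio pos by simp
        also have "\<dots> \<le> (1 + io) * N" using False io by (simp add: mult.commute mult_left_mono)
        finally show ?thesis using N1 pos by (simp add: field_simps)
      qed
      define P where "P = A * h powr (2 / K) * N"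
      define Q where "Q = B * N powr (1 - 2 / K)"
      have PQ: "P \<ge> 0" "Q \<ge> 0" using pos N1 by (auto simp: P_def Q_def)
      define Sd where "Sd = (\<lambda>d. norm (\<Sum>n\<in>{n. a \<le> n \<and> n + d \<le> b}. cis (D 0 (real (n + d)) - D 0 (real n))))"
      have Sd: "Sd d \<le> P * (real d * lam) powr al + Q * (real d * lam) powr (- al)" if d: "d \<ge> 1" for d
      proof (cases "a + d \<le> b")
        case False
        then have "{n. a \<le> n \<and> n + d \<le> b} = {}" by auto
        then have "Sd d = 0" unfolding Sd_def by (simp only: sum.empty norm_zero)
        then show ?thesis using PQ by simp
      next
        case True
        define D' where "D' = (\<lambda>i x. D i (x + real d) - D i x)"
        have e: "{n. a \<le> n \<and> n + d \<le> b} = {a..b - d}" using True by auto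
        have "norm (\<Sum>n=a..b-d. cis (D' 0 (real n)))
          \<le> A * h powr (2 / 2 ^ (k - 1)) * N * (real d * lam) powr (1 / (2 ^ k - 2))
         + B * N powr (1 - 2 / 2 ^ (k - 1)) * (real d * lam) powr (- 1 / (2 ^ k - 2))"
        proof (rule derivative_testD[OF test])
          show "a \<le> b - d" "real (Suc (b - d) - a) \<le> N" using True N by auto
          show "0 < real d * lam" "1 \<le> h" using d lam h by auto
        next
          fix i x assume "i < k" and x: "real a \<le> x" "x \<le> real (b - d)"
          then show "(D' i has_real_derivative D' (Suc i) x) (at x)"
            unfolding D'_def using der True
            by (intro DERIV_diff DERIV_shift[THEN iffD1]) (auto simp: of_nat_diff)
        next
          fix x assume x: "real a \<le> x" "x \<le> real (b - d)"
          have "\<exists>z>x. z < x + real d \<and> D k (x + real d) - D k x = (x + real d - x) * D (Suc k) z"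
            using x d True der by (intro MVT2) (auto simp: of_nat_diff)
          then obtain z where z: "x < z" "z < x + real d" "D' k x = real d * D (Suc k) z" by (auto simp: D'_def)
          have "lam \<le> D (Suc k) z \<and> D (Suc k) z \<le> h * lam" using Dk z x True by (auto simp: of_nat_diff)
          then show "real d * lam \<le> D' k x \<and> D' k x \<le> h * (real d * lam)"
            unfolding z using mult_left_mono[of "D (Suc k) z" "h * lam" "real d"]
              mult_left_mono[of lam "D (Suc k) z" "real d"] by (simp add: mult_ac)
        qed
        then show ?thesis unfolding exps' Sd_def e by (simp add: D'_def P_def Q_def)
      qed
      have "(real H * S)\<^sup>2 \<le> real (Suc b - a + H) * (real H * real (Suc b - a) +
         2 * (\<Sum>d=1..<H. real (H - d) * Sd d))"
        unfolding S_def Sd_def using ab H(1) by (rule van_der_Corput_cis)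
      also have "\<dots> \<le> (N + real H) * (real H * N + 2 * (\<Sum>d=1..<H. real (H - d) * Sd d))"
        using N N1 by (intro mult_mono add_mono mult_left_mono order.refl add_nonneg_nonneg sum_nonneg mult_nonneg_nonneg) (auto simp: Sd_def)
      finally have HS1: "(real H * S)\<^sup>2 \<le> (N + real H) * (real H * N + 2 * (\<Sum>d=1..<H. real (H - d) * Sd d))" .
      have "2 * (\<Sum>d=1..<H. real (H - d) * Sd d)
         \<le> 2 * (\<Sum>d=1..<H. real (H - d) * (P * (real d * lam) powr al + Q * (real d * lam) powr (- al)))"
        by (intro mult_left_mono sum_mono Sd) auto
      also have "\<dots> = P * lam powr al * (2 * (\<Sum>d=1..<H. real (H - d) * real d powr al))
         + 2 * Q * lam powr (- al) * (\<Sum>d=1..<H. real (H - d) * real d powr (- al))"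
        using lam by (simp add: powr_mult sum_distrib_left sum.distrib[symmetric] algebra_simps)
      also have "\<dots> \<le> P * lam powr al * ((real H)\<^sup>2 * (real H / 3) powr al)
         + 2 * Q * lam powr (- al) * (real H powr (2 - al) / ((1 - al) * (2 - al)))"
        using PQ al H by (intro add_mono mult_left_mono sum_weight_powr sum_weight_powr_minus) auto
      also have "\<dots> = (real H)\<^sup>2 * (P * (lam * real H / 3) powr al
          + 2 / ((1 - al) * (2 - al)) * Q * (lam * real H) powr (- al))"
      proof -
        have "real H powr (2 - al) = (real H)\<^sup>2 * real H powr (- al)"
          using H by (simp add: powr_diff powr_minus_divide)
        then show ?thesis using lam by (simp add: powr_mult powr_divide algebra_simps)
      qed
      finally have HS: "2 * (\<Sum>d=1..<H. real (H - d) * Sd d) \<le> (real H)\<^sup>2 * (P * (lam * real H / 3) powr al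
          + 2 / ((1 - al) * (2 - al)) * Q * (lam * real H) powr (- al))" .
      note HS1
      also have "(N + real H) * (real H * N + 2 * (\<Sum>d=1..<H. real (H - d) * Sd d))
        \<le> (N + real H) * (real H * N + (real H)\<^sup>2 * (P * (lam * real H / 3) powr al
          + 2 / ((1 - al) * (2 - al)) * Q * (lam * real H) powr (- al)))"
        using N1 HS by (intro mult_left_mono add_left_mono) auto
      also have "\<dots> = (real H)\<^sup>2 * ((1 + real H / N) * (N * (N / real H + (P * (lam * real H / 3) powr al
          + 2 / ((1 - al) * (2 - al)) * Q * (lam * real H) powr (- al)))))"
        using H N1 by (simp add: field_simps power2_eq_square)
      finally have S2: "S\<^sup>2 \<le> (1 + real H / N) * (N * (N / real H + (P * (lam * real H / 3) powr al
          + 2 / ((1 - al) * (2 - al)) * Q * (lam * real H) powr (- al))))"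
        using H by (simp add: power_mult_distrib)
      \<comment> \<open>This identity determines the exponent of \<open>u\<close>:
        \<open>1 / be = 2 / al + 2\<close>.\<close>
      have key: "lam powr al * (u\<^sup>2) powr al = 1 / u\<^sup>2"
      proof -
        have "lam powr al * (u\<^sup>2) powr al = lam powr (al - 2 * be * al)"
          using lam unfolding u_def by (simp add: powr_powr powr_add[symmetric] powr_numeral[symmetric] mult_ac)
        also have "al - 2 * be * al = 2 * be"
        proof -
          have "al * (2 * K - 2) = 1" "be * (4 * K - 2) = 1" using K2 by (auto simp: al_def be_def)
          then show ?thesis by algebra
        qed
        also have "lam powr (2 * be) = lam powr be * lam powr be" by (simp add: powr_add[symmetric])
        also have "\<dots> = 1 / u\<^sup>2" unfolding lamu by (simp add: power2_eq_square)
        finally show ?thesis .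
      qed
      have fA: "(lam * real H / 3) powr al \<le> ((1 + io) * eta / 3) powr al / u\<^sup>2"
      proof -
        have "(lam * real H / 3) powr al \<le> (lam * (H0 * (1 + io)) / 3) powr al"
          using Hio lam al by (intro powr_mono2 divide_right_mono mult_left_mono) auto
        also have "\<dots> = ((1 + io) * eta / 3 * (lam * u\<^sup>2)) powr al" by (simp add: H0_def mult_ac)
        also have "\<dots> = ((1 + io) * eta / 3) powr al * (lam powr al * (u\<^sup>2) powr al)"
          by (simp only: powr_mult)
        finally show ?thesis unfolding key by simp
      qed
      have fB: "(lam * real H) powr (- al) \<le> eta powr (- al) * u\<^sup>2"
      proof -
        have "(lam * real H) powr (- al) \<le> (lam * H0) powr (- al)"
          using H H0 lam al by (intro powr_mono2') auto
        also have "lam * H0 = eta * (lam * u\<^sup>2)" by (simp add: H0_def mult_ac)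
        also have "(eta * (lam * u\<^sup>2)) powr (- al) = eta powr (- al) * (1 / (lam powr al * (u\<^sup>2) powr al))"
          using lam pos u by (simp add: powr_mult powr_minus_divide)
        finally show ?thesis unfolding key by simp
      qed
      have fN: "N / real H \<le> N / (eta * u\<^sup>2)"
        using H H0 N1 by (intro divide_left_mono) (auto simp: H0_def)
      define c2 where "c2 = 2 / ((1 - al) * (2 - al))"
      have c2: "c2 > 0" using al by (simp add: c2_def)
      have E: "1 + real H / N \<le> E" "E > 0" using HN pos io by (auto simp: E_def add_pos_pos)
      note S2
      also have "(1 + real H / N) * (N * (N / real H + (P * (lam * real H / 3) powr al
          + 2 / ((1 - al) * (2 - al)) * Q * (lam * real H) powr (- al))))
        \<le> E * (N * (N / (eta * u\<^sup>2) + (P * (((1 + io) * eta / 3) powr al / u\<^sup>2)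
          + c2 * Q * (eta powr (- al) * u\<^sup>2))))"
        unfolding c2_def[symmetric] using N1 PQ E c2 fA fB fN
        by (intro mult_mono add_mono order.refl mult_nonneg_nonneg add_nonneg_nonneg) auto
      also have "\<dots> = (N / u)\<^sup>2 * (E * (1 / eta + h powr (2 / K) * (A * ((1 + io) * eta / 3) powr al)))
          + (N * N powr (1 - 2 / K)) * u\<^sup>2 * (E * (c2 * B * eta powr (- al)))"
        using u pos by (simp add: P_def Q_def power2_eq_square field_simps)
      also have "\<dots> \<le> (N / u)\<^sup>2 * (h powr (2 / K) * A'\<^sup>2) + (N * N powr (1 - 2 / K)) * u\<^sup>2 * B'\<^sup>2"
      proof (intro add_mono mult_left_mono)
        have h2: "h powr (2 / K) \<ge> 1" using h K2 by (simp add: ge_one_powr_ge_zero)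
        have "1 / eta * 1 \<le> 1 / eta * h powr (2 / K)" using h2 pos by (intro mult_left_mono) auto
        then have "1 / eta + h powr (2 / K) * (A * ((1 + io) * eta / 3) powr al)
            \<le> h powr (2 / K) * (1 / eta + A * ((1 + io) * eta / 3) powr al)"
          by (simp add: algebra_simps)
        then have "E * (1 / eta + h powr (2 / K) * (A * ((1 + io) * eta / 3) powr al))
            \<le> E * (h powr (2 / K) * (1 / eta + A * ((1 + io) * eta / 3) powr al))"
          using E by (intro mult_left_mono) auto
        also have "\<dots> = h powr (2 / K) * (E * (1 / eta + A * ((1 + io) * eta / 3) powr al))" by simp
        also have "\<dots> \<le> h powr (2 / K) * A'\<^sup>2" using cA by (intro mult_left_mono) auto
        finally show "E * (1 / eta + h powr (2 / K) * (A * ((1 + io) * eta / 3) powr al)) \<le> h powr (2 / K) * A'\<^sup>2" .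
        show "E * (c2 * B * eta powr (- al)) \<le> B'\<^sup>2" using cB by (simp add: c2_def)
      qed (use N1 in auto)
      also have "\<dots> = T1\<^sup>2 + T2\<^sup>2"
      proof -
        have "h powr (2 / K) = (h powr (1 / K))\<^sup>2"
          by (simp add: power2_eq_square powr_add[symmetric])
        moreover have "N * N powr (1 - 2 / K) = (N powr (1 - 1 / K))\<^sup>2"
        proof -
          have "N * N powr (1 - 2 / K) = N powr 1 * N powr (1 - 2 / K)" using N1 by simp
          also have "\<dots> = N powr (1 + (1 - 2 / K))" by (rule powr_add[symmetric])
          also have "1 + (1 - 2 / K) = (1 - 1 / K) + (1 - 1 / K)" by simp
          also have "N powr ((1 - 1 / K) + (1 - 1 / K)) = (N powr (1 - 1 / K))\<^sup>2"
            by (simp only: powr_add power2_eq_square)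
          finally show ?thesis .
        qed
        ultimately show ?thesis by (simp add: T1_def T2_def power_mult_distrib power_divide)
      qed
      also have "\<dots> \<le> (T1 + T2)\<^sup>2" using T by (simp add: power2_sum)
      finally show ?thesis by (rule power2_le_imp_le) (use T in auto)
    qed
  qed
  then show "norm (\<Sum>n=a..b. cis (D 0 (real n)))
       \<le> A' * h powr (2 / 2 ^ (Suc k - 1)) * N * lam powr (1 / (2 ^ Suc k - 2))
         + B' * N powr (1 - 2 / 2 ^ (Suc k - 1)) * lam powr (- 1 / (2 ^ Suc k - 2))"
    unfolding exps lamu u_def[symmetric] using exps(1) by (simp add: S_def T1_def T2_def)
qed

lemma powr_le_if_le_power:
  fixes x r :: real
  assumes "0 \<le> x" "0 \<le> r" "x \<le> r ^ n" "n > 0"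
  shows "x powr (1 / real n) \<le> r"
proof -
  have "x powr (1 / real n) \<le> (r ^ n) powr (1 / real n)" using assms by (intro powr_mono2) auto
  also have "\<dots> = r"
    using assms by (cases "r = 0") (auto simp: powr_realpow[symmetric] powr_powr)
  finally show ?thesis .
qed

lemma derivative_test_3: "derivative_test 3 1.35 5.5"
proof -
  have "derivative_test (Suc 2) 1.35 5.5"
  \<comment> \<open>At this step \<open>al = 1 / 2\<close>, and a rational square \<open>eta\<close>
    makes \<open>eta powr (- al)\<close> rational. The largest integer \<open>C\<close> with
    \<open>C * eta \<le> 5.5\<^sup>2\<close> is 13.\<close>
  proof (rule derivative_test_Suc[OF derivative_test_2, where eta = "9 / 4" and C = 13])
    let ?x = "(1 + 1 / (9 / 4 * 1.35\<^sup>2)) * (9 / 4) / 3 :: real"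
    have e: "1 / (2 * 2 ^ (2 - 1) - 2) = 1 / real 2" by simp
    have "?x powr (1 / real 2) \<le> 0.966"
      by (rule powr_le_if_le_power) (simp_all add: power2_eq_square)
    then have p: "?x powr (1 / (2 * 2 ^ (2 - 1) - 2)) \<le> 0.966" by (simp only: e)
    have "(1 + (1 + 1 / (9 / 4 * 1.35\<^sup>2)) / 13) * (1 / (9 / 4) + 1.06 * ?x powr (1 / (2 * 2 ^ (2 - 1) - 2)))
       \<le> (1 + (1 + 1 / (9 / 4 * 1.35\<^sup>2)) / 13) * (1 / (9 / 4) + 1.06 * 0.966 :: real)"
      by (intro mult_left_mono add_left_mono p) (simp_all add: power2_eq_square)
    also have "\<dots> \<le> 1.35\<^sup>2" by (simp add: power2_eq_square)
    finally show "(1 + (1 + 1 / (9 / 4 * 1.35\<^sup>2)) / 13) * (1 / (9 / 4) + 1.06 * ?x powr (1 / (2 * 2 ^ (2 - 1) - 2)))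
       \<le> (1.35 :: real)\<^sup>2" .
    have "sqrt ((3 / 2)\<^sup>2 :: real) = 3 / 2" by (rule real_sqrt_unique) auto
    then have q: "sqrt (9 / 4 :: real) = 3 / 2" by (simp add: power2_eq_square)
    have "(9 / 4 :: real) powr (- (1 / (2 * 2 ^ (2 - 1) - 2))) = 2 / 3"
      by (simp add: powr_minus powr_half_sqrt q)
    then show "(1 + (1 + 1 / (9 / 4 * 1.35\<^sup>2)) / 13) * (2 / ((1 - 1 / (2 * 2 ^ (2 - 1) - 2)) * (2 - 1 / (2 * 2 ^ (2 - 1) - 2)))
        * 14.4 * (9 / 4) powr (- (1 / (2 * 2 ^ (2 - 1) - 2)))) \<le> (5.5 :: real)\<^sup>2"
      by (simp add: power2_eq_square)
    have e2: "(1::real) / 2 ^ (2 - 1) = 1 / real 2" by simp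
    show "(13 * (9 / 4)) powr (1 / 2 ^ (2 - 1)) \<le> (5.5 :: real)"
      unfolding e2 by (rule powr_le_if_le_power) (simp_all add: power2_eq_square)
  qed simp_all
  then show ?thesis by (simp add: numeral_3_eq_3 numeral_2_eq_2)
qed

text \<open>With \<open>eta = 6\<close> and \<open>C = 25\<close> the constant
  \<open>A = 1.35\<close> reproduces itself under differencing, so that only \<open>B\<close> has to
  be followed. \<open>r\<close> is an upper bound for \<open>al\<close>, 1.0437 one for the factor
  \<open>E\<close>, and 150 is \<open>C * eta\<close>.\<close>

lemma derivative_test_step:
  fixes B B' :: real
  assumes test: "derivative_test k 1.35 B" and k: "k \<ge> 3" and B: "B > 0" "B' > 0"
    and al: "1 / (2 * 2 ^ (k - 1) - 2) \<le> r" "r \<le> 1 / 6"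
    and cB: "1.0437 * (2 / ((1 - r) * (2 - r)) * B) \<le> B'\<^sup>2"
    and cC: "150 powr (1 / 2 ^ (k - 1)) \<le> B'"
  shows "derivative_test (Suc k) 1.35 B'"
proof (rule derivative_test_Suc[OF test, where eta = 6 and C = 25])
  define K :: real where "K = 2 ^ (k - 1)"
  define al' where "al' = 1 / (2 * K - 2)"
  have K: "K \<ge> 4" using k power_increasing[of 2 "k - 1" "2::real"] by (simp add: K_def)
  have al': "0 < al'" "al' \<le> r" using K al by (auto simp: al'_def K_def)
  let ?x = "(1 + 1 / (6 * 1.35\<^sup>2)) * 6 / 3 :: real"
  have "?x powr al' \<le> ?x powr (1 / real 6)" using al' al by (intro powr_mono) (auto simp: power2_eq_square)
  also have "\<dots> \<le> 1.139" by (rule powr_le_if_le_power) (simp_all add: power2_eq_square power_numeral_reduce)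
  finally have "?x powr al' \<le> 1.139" .
  then have "(1 + (1 + 1 / (6 * 1.35\<^sup>2)) / 25) * (1 / 6 + 1.35 * ?x powr al')
      \<le> (1 + (1 + 1 / (6 * 1.35\<^sup>2)) / 25) * (1 / 6 + 1.35 * 1.139)"
    by (intro mult_left_mono add_left_mono) (simp_all add: power2_eq_square)
  also have "\<dots> \<le> 1.35\<^sup>2" by (simp add: power2_eq_square)
  finally show "(1 + (1 + 1 / (6 * 1.35\<^sup>2)) / 25) * (1 / 6 + 1.35 * ?x powr (1 / (2 * 2 ^ (k - 1) - 2))) \<le> (1.35 :: real)\<^sup>2"
    by (simp only: al'_def K_def)
  have "(6::real) powr (- al') \<le> 6 powr 0" using al' by (intro powr_mono) auto
  then have p: "(6::real) powr (- al') \<le> 1" by simp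
  have "(1 + (1 + 1 / (6 * 1.35\<^sup>2)) / 25) * (2 / ((1 - al') * (2 - al')) * B * 6 powr (- al'))
     \<le> 1.0437 * (2 / ((1 - r) * (2 - r)) * B * 1)"
    using al' al B p
    by (intro mult_mono divide_left_mono mult_pos_pos) (auto simp: power2_eq_square)
  then show "(1 + (1 + 1 / (6 * 1.35\<^sup>2)) / 25) * (2 / ((1 - 1 / (2 * 2 ^ (k - 1) - 2)) * (2 - 1 / (2 * 2 ^ (k - 1) - 2)))
      * B * 6 powr (- (1 / (2 * 2 ^ (k - 1) - 2)))) \<le> B'\<^sup>2"
    using cB by (simp only: al'_def K_def)
  show "(25 * 6) powr (1 / 2 ^ (k - 1)) \<le> B'" using cC by simp
qed (use k B in auto)

lemma derivative_test_4: "derivative_test 4 1.35 3.5"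
proof -
  have "derivative_test (Suc 3) 1.35 3.5"
  proof (rule derivative_test_step[OF derivative_test_3, where r = "1 / 6"])
    have "(150::real) powr (1 / real 4) \<le> 3.5"
      by (rule powr_le_if_le_power) (simp_all add: power_numeral_reduce)
    then show "150 powr (1 / 2 ^ (3 - 1)) \<le> (3.5 :: real)" by simp
  qed (simp_all add: power2_eq_square)
  then show ?thesis by simp
qed

text \<open>For \<open>k \<ge> 4\<close> the bound \<open>r = 1 / 14\<close> is available, and a
  step then takes every \<open>B \<le> 3.5\<close> to 2.1. This applies to 2.1 itself, whence
  constants uniform in the order.\<close>

lemma derivative_test_ge_5:
  assumes "k \<ge> 5"
  shows "derivative_test k 1.35 2.1"
proof -
  have st: "derivative_test (Suc k) 1.35 2.1" if "derivative_test k 1.35 B" "k \<ge> 4" "0 < B" "B \<le> 3.5" for k B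
  proof (rule derivative_test_step[OF that(1), where r = "1 / 14"])
    have K: "(2::real) ^ (k - 1) \<ge> 8" using that power_increasing[of 3 "k - 1" "2::real"] by simp
    then show "1 / (2 * 2 ^ (k - 1) - 2) \<le> (1 / 14 :: real)" by (simp add: field_simps)
    have "(150::real) powr (1 / 2 ^ (k - 1)) \<le> 150 powr (1 / real 8)"
      using K by (intro powr_mono) (auto simp: field_simps)
    also have "\<dots> \<le> 2.1" by (rule powr_le_if_le_power) (simp_all add: power_numeral_reduce)
    finally show "150 powr (1 / 2 ^ (k - 1)) \<le> (2.1 :: real)" .
  qed (use that in \<open>auto simp: power2_eq_square\<close>)
  show ?thesis using assms
  proof (induction k rule: dec_induct)
    case base
    show ?case using st[OF derivative_test_4] by simp
  next
    case (step n)
    then show ?case using st[of n "2.1"] by simp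
  qed
qed

subsection \<open>Approximation of the zeta function\<close>

definition trapezoid_error :: "complex \<Rightarrow> nat \<Rightarrow> complex" where
  "trapezoid_error s n = (of_nat n powr (- s) + of_nat (Suc n) powr (- s)) / 2
     - (of_nat (Suc n) powr (1 - s) - of_nat n powr (1 - s)) / (1 - s)"

lemma divide_mult_cancel_8: "q \<noteq> 0 \<Longrightarrow> w / (8 * q) * (q * v) = w / 8 * (v :: real)"
  by simp

text \<open>The error is the integral of \<open>u (1 - u) / 2\<close> against the second derivative of \<open>x powr (- s)\<close>
  over \<open>x = n + u\<close>; the function \<open>F\<close> is its primitive, and \<open>u (1 - u) / 2 \<le> 1 / 8\<close>.\<close>

lemma norm_trapezoid_error_le:
  assumes n: "n > 0" and s: "Re s > -1" "s \<noteq> 1"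
  shows "norm (trapezoid_error s n) \<le> norm s * norm (s + 1) / (8 * (Re s + 1)) *
     (real n powr (- Re s - 1) - real (Suc n) powr (- Re s - 1))"
proof -
  define C where "C = norm s * norm (s + 1) / (8 * (Re s + 1))"
  define F :: "complex \<Rightarrow> complex" where
    "F = (\<lambda>z. z * (1 - z) / 2 * (- s * (of_nat n + z) powr (- s - 1))
      - (1 / 2 - z) * (of_nat n + z) powr (- s) - (of_nat n + z) powr (1 - s) / (1 - s))"
  define F' :: "complex \<Rightarrow> complex" where
    "F' = (\<lambda>z. z * (1 - z) / 2 * (s * (s + 1) * (of_nat n + z) powr (- s - 2)))"
  define G where "G = (\<lambda>u. - C * (real n + u) powr (- Re s - 1))"
  define G' where "G' = (\<lambda>u. C * (Re s + 1) * (real n + u) powr (- Re s - 2))"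
  have dF: "((\<lambda>u. F (of_real u)) has_vector_derivative F' (of_real u)) (at u)" if u: "0 \<le> u" for u
  proof (rule has_vector_derivative_real_field)
    have nz: "of_nat n + complex_of_real u \<notin> \<real>\<^sub>\<le>\<^sub>0"
    proof -
      have e: "of_nat n + complex_of_real u = complex_of_real (real n + u)" by simp
      show ?thesis unfolding e using n u by (subst nonpos_Reals_of_real_iff) auto
    qed
    show "(F has_field_derivative F' (of_real u)) (at (of_real u))"
    proof -
      let ?z = "complex_of_real u"
      have pd: "((\<lambda>z. (of_nat n + z) powr c) has_field_derivative c * (of_nat n + ?z) powr (c - 1)) (at ?z)" for c
        using nz by (auto intro!: derivative_eq_intros)
      have q: "((\<lambda>z. z * (1 - z) / 2) has_field_derivative (1 - 2 * ?z) / 2) (at ?z)"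
        by (auto intro!: derivative_eq_intros simp: field_simps)
      have l: "((\<lambda>z. 1 / 2 - z) has_field_derivative - 1) (at ?z)"
        by (auto intro!: derivative_eq_intros)
      have e: "- s - 1 - 1 = - s - 2" "1 - s - 1 = - s" by simp_all
      have c: "((1 - s) * w) / (1 - s) = w" for w using s by simp
      show ?thesis unfolding F_def
        by (rule DERIV_cong[OF DERIV_diff[OF DERIV_diff[OF DERIV_mult[OF q DERIV_cmult[OF pd]] DERIV_mult[OF l pd]]
              DERIV_cdivide[OF pd]]], unfold F'_def e c) (simp add: field_simps)
    qed
  qed
  have dG: "(G has_vector_derivative G' u) (at u)" if "0 \<le> u" for u
    unfolding G_def G'_def has_real_derivative_iff_has_vector_derivative[symmetric]
    using n that by (auto intro!: derivative_eq_intros simp: algebra_simps)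
  have "norm (F (of_real 1) - F (of_real 0)) \<le> G 1 - G 0"
  proof (rule differentiable_bound_general[of 0 1 "\<lambda>u. F (of_real u)" G "\<lambda>u. F' (of_real u)" G'])
    show "continuous_on {0..1} (\<lambda>u. F (of_real u))" "continuous_on {0..1} G"
      by (intro continuous_at_imp_continuous_on ballI has_vector_derivative_continuous[OF dF]
            has_vector_derivative_continuous[OF dG]; simp)+
  next
    fix u :: real assume u: "0 < u" "u < 1"
    have "u * (1 - u) / 2 \<le> 1 / 8"
      using sum_squares_ge_zero[of "2 * u - 1" 0] by (simp add: algebra_simps power2_eq_square)
    have "norm (F' (of_real u)) = u * (1 - u) / 2 * (norm s * norm (s + 1) * (real n + u) powr (- Re s - 2))"
    proof -
      have e: "of_nat n + complex_of_real u = complex_of_real (real n + u)" by simp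
      have "norm ((of_nat n + complex_of_real u) powr (- s - 2)) = (real n + u) powr (- Re s - 2)"
        unfolding e using u by (subst norm_powr_real_powr) auto
      moreover have "norm (complex_of_real u * (1 - complex_of_real u)) = u * (1 - u)"
      proof -
        have "complex_of_real u * (1 - complex_of_real u) = complex_of_real (u * (1 - u))" by simp
        then show ?thesis using u by (simp only: norm_of_real) simp
      qed
      ultimately show ?thesis unfolding F'_def by (simp add: norm_mult norm_divide)
    qed
    also have "\<dots> \<le> 1 / 8 * (norm s * norm (s + 1) * (real n + u) powr (- Re s - 2))"
      by (rule mult_right_mono) (use \<open>u * (1 - u) / 2 \<le> 1 / 8\<close> in auto)
    also have "\<dots> = G' u"
      using divide_mult_cancel_8[of "Re s + 1" "norm s * norm (s + 1)" "(real n + u) powr (- Re s - 2)"] s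
      by (simp only: G'_def C_def mult.assoc) simp
    finally show "norm (F' (of_real u)) \<le> G' u" .
  qed (use dF dG in auto)
  also have "F (of_real 1) - F (of_real 0) = trapezoid_error s n"
    by (simp add: F_def trapezoid_error_def diff_divide_distrib add.commute add_divide_distrib)
  also have "G 1 - G 0 = C * (real n powr (- Re s - 1) - real (Suc n) powr (- Re s - 1))"
    by (simp add: G_def algebra_simps)
  finally show ?thesis by (simp add: C_def)
qed

lemma trapezoid_error_sums:
  assumes s: "Re s > 1" and N: "N > 0"
  shows "(\<lambda>n. trapezoid_error s (n + N)) sums
    (riemann_zeta s - (\<Sum>n=1..<N. of_nat n powr (- s)) - of_nat N powr (- s) / 2 - of_nat N powr (1 - s) / (s - 1))"
proof -
  have z: "(\<lambda>n. of_nat (Suc n) powr (- s)) sums riemann_zeta s"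
    using is_riemann_zeta_riemann_zeta s by (auto simp: is_riemann_zeta_def)
  obtain M where M: "N = Suc M" using N by (cases N) auto
  have "(\<lambda>n. of_nat (Suc (n + M)) powr (- s)) sums (riemann_zeta s - (\<Sum>n<M. of_nat (Suc n) powr (- s)))"
    using sums_split_initial_segment[OF z, of M] by simp
  moreover have "(\<Sum>n<M. of_nat (Suc n) powr (- s) :: complex) = (\<Sum>n=1..<N. of_nat n powr (- s))"
    unfolding M by (rule sum.reindex_bij_witness[of _ "\<lambda>n. n - 1" Suc]) auto
  ultimately have 1: "(\<lambda>n. of_nat (n + N) powr (- s)) sums (riemann_zeta s - (\<Sum>n=1..<N. of_nat n powr (- s)))"
    by (simp add: M)
  have 2: "(\<lambda>n. of_nat (Suc (n + N)) powr (- s)) sums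
      (riemann_zeta s - (\<Sum>n=1..<N. of_nat n powr (- s)) - of_nat N powr (- s))"
    using 1 sums_Suc_iff[of "\<lambda>n. of_nat (n + N) powr (- s)"] by simp
  have "(\<lambda>n. of_nat (n + N) powr (1 - s) :: complex) \<longlonglongrightarrow> 0"
  proof (rule tendsto_norm_zero_cancel)
    have "norm (of_nat (n + N) powr (1 - s) :: complex) = real (n + N) powr (1 - Re s)" for n
      using N by (subst norm_powr_real_powr) auto
    moreover have "(\<lambda>n. real (n + N) powr (1 - Re s)) \<longlonglongrightarrow> 0"
      using s by (intro tendsto_neg_powr filterlim_compose[OF filterlim_real_sequentially] filterlim_add_const_nat_at_top) auto
    ultimately show "(\<lambda>n. norm (of_nat (n + N) powr (1 - s) :: complex)) \<longlonglongrightarrow> 0" by simp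
  qed
  from telescope_sums[OF this]
  have 3: "(\<lambda>n. of_nat (Suc (n + N)) powr (1 - s) - of_nat (n + N) powr (1 - s) :: complex) sums (0 - of_nat N powr (1 - s))"
    by simp
  have "(\<lambda>n. trapezoid_error s (n + N)) sums
     (((riemann_zeta s - (\<Sum>n=1..<N. of_nat n powr (- s)))
       + (riemann_zeta s - (\<Sum>n=1..<N. of_nat n powr (- s)) - of_nat N powr (- s))) / 2
      - (0 - of_nat N powr (1 - s)) / (1 - s))"
    unfolding trapezoid_error_def by (intro sums_diff sums_divide sums_add 1 2 3)
  also have "((riemann_zeta s - (\<Sum>n=1..<N. of_nat n powr (- s)))
       + (riemann_zeta s - (\<Sum>n=1..<N. of_nat n powr (- s)) - of_nat N powr (- s))) / 2
      - (0 - of_nat N powr (1 - s)) / (1 - s) =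
     riemann_zeta s - (\<Sum>n=1..<N. of_nat n powr (- s)) - of_nat N powr (- s) / 2 - of_nat N powr (1 - s) / (s - 1)"
  proof -
    have "s \<noteq> 1" using s by auto
    then have "(0 - of_nat N powr (1 - s)) / (1 - s) = of_nat N powr (1 - s) / (s - 1)"
      by (simp add: divide_simps) (simp add: algebra_simps)
    then show ?thesis by (simp add: field_simps)
  qed
  finally show ?thesis .
qed

text \<open>The formula with the sum of all trapezoid errors holds for \<open>Re s > 1\<close> by
  telescoping. Each error is of size \<open>n powr (- 2)\<close> locally uniformly in the right half
  plane without 1, so the sum is holomorphic there and the formula persists by analytic
  continuation. The stated bound comes from telescoping the bounds of the single errors.\<close>

lemma zeta_trapezoid:
  assumes s: "Re s > 0" "s \<noteq> 1" and N: "N > 0"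
  shows "norm (riemann_zeta s - (\<Sum>n=1..<N. of_nat n powr (- s)) - of_nat N powr (- s) / 2 - of_nat N powr (1 - s) / (s - 1))
    \<le> norm s * norm (s + 1) / (8 * (Re s + 1)) * real N powr (- Re s - 1)"
proof -
  define S where "S = {s. Re s > 0} - {1::complex}"
  have S: "open S" "connected S"
    unfolding S_def
    by (intro open_delete open_halfspace_Re_gt)
       (intro connected_open_delete convex_connected convex_halfspace_Re_gt open_halfspace_Re_gt, simp)
  define g where "g = (\<lambda>s. \<Sum>n. trapezoid_error s (n + N))"
  define f where "f = (\<lambda>s. riemann_zeta s - (\<Sum>n=1..<N. of_nat n powr (- s)) - of_nat N powr (- s) / 2 - of_nat N powr (1 - s) / (s - 1))"
  have bound: "\<exists>d>0. \<exists>M. cball z d \<subseteq> S \<and> summable M \<and> (\<forall>n. \<forall>s\<in>cball z d. norm (trapezoid_error s (n + N)) \<le> M n)"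
    if z: "z \<in> S" for z
  proof -
    obtain d where d: "d > 0" "cball z d \<subseteq> S" using S(1) z open_contains_cball by blast
    define R where "R = norm z + d"
    define M where "M = (\<lambda>n. R * (R + 1) / 8 * real (n + N) powr (- 2))"
    have "summable (\<lambda>n. real n powr (- 2))" by (simp add: summable_real_powr_iff)
    then have "summable (\<lambda>n. real (n + N) powr (- 2))" by (subst summable_iff_shift)
    then have "summable M" unfolding M_def by (rule summable_mult)
    moreover have "norm (trapezoid_error s (n + N)) \<le> M n" if "s \<in> cball z d" for n s
    proof -
      define m where "m = n + N"
      have m: "m > 0" using N by (simp add: m_def)
      have s: "Re s > 0" "s \<noteq> 1" using that d by (auto simp: S_def)
      have nz: "norm s \<le> R"
        using that norm_triangle_ineq2[of s z] by (simp add: R_def dist_norm norm_minus_commute)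
      have nz1: "norm (s + 1) \<le> R + 1" using nz norm_triangle_ineq[of s 1] by simp
      obtain y where y: "real m < y" "y < real m + 1"
        "(real m + 1) powr (- Re s - 1) - real m powr (- Re s - 1) = (- Re s - 1) * y powr (- Re s - 1 - 1)"
        using powr_add_one_diff[of "real m" "- Re s - 1"] m by auto
      have "norm (trapezoid_error s m) \<le> norm s * norm (s + 1) / (8 * (Re s + 1)) *
         (real m powr (- Re s - 1) - real (Suc m) powr (- Re s - 1))"
        using m s by (intro norm_trapezoid_error_le) auto
      also have "real m powr (- Re s - 1) - real (Suc m) powr (- Re s - 1) = (Re s + 1) * y powr (- Re s - 2)"
        using y by (simp add: algebra_simps)
      also have "norm s * norm (s + 1) / (8 * (Re s + 1)) * \<dots> = norm s * norm (s + 1) / 8 * y powr (- Re s - 2)"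
        using s by (intro divide_mult_cancel_8) auto
      also have "\<dots> \<le> R * (R + 1) / 8 * real m powr (- 2)"
      proof (intro mult_mono divide_right_mono)
        have "y powr (- Re s - 2) \<le> y powr (- 2)" using s y m by (intro powr_mono) auto
        also have "\<dots> \<le> real m powr (- 2)" using y m by (intro powr_mono2') auto
        finally show "y powr (- Re s - 2) \<le> real m powr (- 2)" .
      qed (use nz nz1 d norm_ge_zero[of s] in \<open>auto simp: R_def\<close>)
      finally show ?thesis by (simp add: M_def m_def)
    qed
    ultimately show ?thesis using d by blast
  qed
  have g_hol: "g holomorphic_on S" unfolding g_def
  proof (rule holomorphic_uniform_sequence[where f = "\<lambda>M s. \<Sum>n<M. trapezoid_error s (n + N)", OF S(1)])
    fix M show "(\<lambda>s. \<Sum>n<M. trapezoid_error s (n + N)) holomorphic_on S"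
      unfolding trapezoid_error_def
      by (intro holomorphic_on_sum holomorphic_on_diff holomorphic_on_divide holomorphic_on_add holomorphic_on_powr_right
            holomorphic_on_const holomorphic_on_ident holomorphic_on_minus) (auto simp: S_def)
  next
    fix z assume "z \<in> S"
    from bound[OF this] obtain d M where d: "d > 0" "cball z d \<subseteq> S" and M: "summable M"
      "\<forall>n. \<forall>s\<in>cball z d. norm (trapezoid_error s (n + N)) \<le> M n" by (elim exE conjE)
    have "uniform_limit (cball z d) (\<lambda>M s. \<Sum>n<M. trapezoid_error s (n + N)) (\<lambda>s. \<Sum>n. trapezoid_error s (n + N)) sequentially"
      by (rule Weierstrass_m_test[OF _ M(1)]) (use M(2) in blast)
    then show "\<exists>d>0. cball z d \<subseteq> S \<and>
      uniform_limit (cball z d) (\<lambda>M s. \<Sum>n<M. trapezoid_error s (n + N)) (\<lambda>s. \<Sum>n. trapezoid_error s (n + N)) sequentially"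
      using d by blast
  qed
  have sm: "summable (\<lambda>n. trapezoid_error s (n + N))"
  proof -
    have "s \<in> S" using s by (simp add: S_def)
    from bound[OF this] obtain d M where d: "d > 0" and M: "summable M"
      "\<forall>n. \<forall>s'\<in>cball s d. norm (trapezoid_error s' (n + N)) \<le> M n"
      by (elim exE conjE)
    have "s \<in> cball s d" using d by simp
    then have "norm (trapezoid_error s (n + N)) \<le> M n" for n by (rule bspec[OF spec[OF M(2)]])
    then show ?thesis by (rule summable_comparison_test'[OF M(1)])
  qed
  have zeta_hol: "riemann_zeta holomorphic_on S"
    using is_riemann_zeta_riemann_zeta unfolding is_riemann_zeta_def
    by (elim conjE, rule_tac holomorphic_on_subset) (auto simp: S_def)
  have f_hol: "f holomorphic_on S" unfolding f_def
    by (intro holomorphic_on_sum holomorphic_on_diff holomorphic_on_divide holomorphic_on_powr_right zeta_hol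
            holomorphic_on_const holomorphic_on_ident holomorphic_on_minus) (auto simp: S_def)
  have "f s = g s"
  proof (rule analytic_continuation_open[of "{s. Re s > 1}" S f g s])
    have "2 \<in> {s. Re s > 1}" by simp
    then show "{s. Re s > 1} \<noteq> {}" by blast
    fix w assume "w \<in> {s. Re s > 1}"
    then show "f w = g w" unfolding f_def g_def
      using trapezoid_error_sums[of w N] N by (auto simp: sums_iff)
  qed (use S f_hol g_hol s in \<open>auto simp: S_def open_halfspace_Re_gt\<close>)
  moreover have "norm (g s) \<le> norm s * norm (s + 1) / (8 * (Re s + 1)) * real N powr (- Re s - 1)"
  proof -
    define C where "C = norm s * norm (s + 1) / (8 * (Re s + 1))"
    have lim: "(\<lambda>n. real (n + N) powr (- Re s - 1)) \<longlonglongrightarrow> 0"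
      using s by (intro tendsto_neg_powr filterlim_compose[OF filterlim_real_sequentially] filterlim_add_const_nat_at_top) auto
    have sm: "(\<lambda>n. C * (real (n + N) powr (- Re s - 1) - real (Suc n + N) powr (- Re s - 1))) sums (C * (real (0 + N) powr (- Re s - 1) - 0))"
      by (intro sums_mult telescope_sums'[OF lim])
    have bd: "norm (trapezoid_error s (n + N)) \<le> C * (real (n + N) powr (- Re s - 1) - real (Suc n + N) powr (- Re s - 1))" for n
      using norm_trapezoid_error_le[of "n + N" s] s N by (simp add: C_def)
    have "norm (\<Sum>n. trapezoid_error s (n + N)) \<le> C * (real (0 + N) powr (- Re s - 1) - 0)"
      using norm_suminf_le[OF bd sums_summable[OF sm]] unfolding sums_unique[OF sm, symmetric] .
    then show ?thesis by (simp add: g_def C_def)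
  qed
  ultimately show ?thesis by (simp add: f_def)
qed

subsection \<open>Blocks of the Dirichlet series\<close>

text \<open>Half-open intervals with real end points allow splitting without overlap at any cut
  \<open>exp (a * x + c)\<close>.\<close>

definition dirichlet_sum :: "real \<Rightarrow> real \<Rightarrow> real \<Rightarrow> real \<Rightarrow> complex" where
  "dirichlet_sum sg t u v = (\<Sum>n\<in>{n::nat. u < real n \<and> real n \<le> v}. of_nat n powr (- Complex sg t))"

lemma nat_interval_eq:
  assumes "0 \<le> u"
  shows "{n::nat. u < real n \<and> real n \<le> v} = {Suc (nat \<lfloor>u\<rfloor>)..nat \<lfloor>v\<rfloor>}"
proof -
  have "u < real n \<longleftrightarrow> Suc (nat \<lfloor>u\<rfloor>) \<le> n" "real n \<le> v \<longleftrightarrow> n \<le> nat \<lfloor>v\<rfloor> \<or> (n = 0 \<and> 0 \<le> v)" if "0 < n" for n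
    using assms that by linarith+
  then have "n \<in> {n. u < real n \<and> real n \<le> v} \<longleftrightarrow> n \<in> {Suc (nat \<lfloor>u\<rfloor>)..nat \<lfloor>v\<rfloor>}" for n
    using assms by (cases "n = 0") simp_all
  then show ?thesis by blast
qed

lemma finite_nat_interval: "finite {n::nat. u < real n \<and> real n \<le> v}"
  by (rule finite_subset[of _ "{..nat \<lfloor>v\<rfloor>}"]) (auto simp: le_nat_floor)

lemma dirichlet_sum_split:
  assumes "u \<le> v" "v \<le> w"
  shows "dirichlet_sum sg t u w = dirichlet_sum sg t u v + dirichlet_sum sg t v w"
proof -
  have "{n::nat. u < real n \<and> real n \<le> w} = {n. u < real n \<and> real n \<le> v} \<union> {n. v < real n \<and> real n \<le> w}"
    using assms by auto
  then show ?thesis unfolding dirichlet_sum_def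
    by (simp only:) (rule sum.union_disjoint, auto simp: finite_nat_interval)
qed

lemma powr_Complex_eq:
  assumes "n > 0"
  shows "of_nat n powr (- Complex sg t) = of_real (real n powr (- sg)) * cis (- (t * ln (real n)))"
proof -
  have "of_nat n powr (- Complex sg t) = exp (- Complex sg t * of_real (ln (real n)))"
    using assms by (simp add: powr_def Ln_of_nat)
  also have "\<dots> = exp (of_real (- sg * ln (real n))) * cis (- (t * ln (real n)))"
    by (simp add: exp_eq_polar complex_eq_iff Re_exp Im_exp)
  also have "exp (of_real (- sg * ln (real n))) = complex_of_real (exp (- sg * ln (real n)))" by (rule exp_of_real)
  finally show ?thesis using assms by (simp add: powr_def)
qed

text \<open>Partial summation is applied once to the terms and once, backwards, to the bounds
  \<open>P\<close>. A constant \<open>P\<close> thus costs only the first weight, while a linearly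
  growing \<open>P\<close>, as Kusmin-Landau yields, costs a sum of the weights.\<close>

lemma norm_sum_by_parts_le:
  fixes w P :: "nat \<Rightarrow> real" and z :: "nat \<Rightarrow> complex"
  assumes ab: "a \<le> b"
    and w: "\<And>n. a \<le> n \<Longrightarrow> n < b \<Longrightarrow> w (Suc n) \<le> w n" "w b \<ge> 0"
    and P: "\<And>m. a \<le> m \<Longrightarrow> m \<le> b \<Longrightarrow> norm (\<Sum>n=a..m. z n) \<le> P m"
  shows "norm (\<Sum>n=a..b. of_real (w n) * z n) \<le> w a * P a + (\<Sum>n=a..<b. w (Suc n) * (P (Suc n) - P n))"
proof -
  define S where "S = (\<lambda>m. \<Sum>n=a..m. z n)"
  have id1: "(\<Sum>n=a..m. of_real (w n) * z n) = of_real (w m) * S m + (\<Sum>n=a..<m. of_real (w n - w (Suc n)) * S n)"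
    if "a \<le> m" for m
    using that by (induction m rule: dec_induct) (simp_all add: S_def algebra_simps)
  have id2: "w m * P m + (\<Sum>n=a..<m. (w n - w (Suc n)) * P n) = w a * P a + (\<Sum>n=a..<m. w (Suc n) * (P (Suc n) - P n))"
    if "a \<le> m" for m
    using that by (induction m rule: dec_induct) (simp_all add: algebra_simps)
  have "norm (\<Sum>n=a..b. of_real (w n) * z n) \<le> norm (of_real (w b) * S b) + (\<Sum>n=a..<b. norm (of_real (w n - w (Suc n)) * S n))"
    unfolding id1[OF ab] by (intro order.trans[OF norm_triangle_ineq] add_left_mono norm_sum)
  also have "\<dots> \<le> w b * P b + (\<Sum>n=a..<b. (w n - w (Suc n)) * P n)"
    using ab w P unfolding S_def norm_mult norm_of_real
    by (intro add_mono mult_mono sum_mono) (auto simp del: of_real_diff)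
  finally show ?thesis unfolding id2[OF ab] .
qed

lemma norm_dirichlet_sum_le:
  assumes u: "u > 0" and sg: "sg \<ge> 0" and M: "M \<ge> 0"
    "\<And>a b. a \<le> b \<Longrightarrow> u < real a \<Longrightarrow> real b \<le> v \<Longrightarrow> norm (\<Sum>n=a..b. cis (t * ln (real n))) \<le> M"
  shows "norm (dirichlet_sum sg t u v) \<le> u powr (- sg) * M"
proof -
  define a b where "a = Suc (nat \<lfloor>u\<rfloor>)" and "b = nat \<lfloor>v\<rfloor>"
  have set: "{n::nat. u < real n \<and> real n \<le> v} = {a..b}" using u unfolding a_def b_def by (intro nat_interval_eq) simp
  show ?thesis
  proof (cases "a \<le> b")
    case False
    then show ?thesis using M(1) unfolding dirichlet_sum_def set by simp
  next
    case True
    have au: "u < real a" and bv: "real b \<le> v"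
      using set True by (metis (mono_tags, lifting) atLeastAtMost_iff le_refl mem_Collect_eq)+
    have cnj: "norm (\<Sum>n=a..m. cis (- (t * ln (real n)))) = norm (\<Sum>n=a..m. cis (t * ln (real n)))" for m
      by (metis (no_types, lifting) cis_cnj cnj_sum complex_mod_cnj sum.cong)
    have "dirichlet_sum sg t u v = (\<Sum>n=a..b. of_real (real n powr (- sg)) * cis (- (t * ln (real n))))"
      unfolding dirichlet_sum_def set by (intro sum.cong refl powr_Complex_eq) (auto simp: a_def)
    also have "norm \<dots> \<le> real a powr (- sg) * M + (\<Sum>n=a..<b. real (Suc n) powr (- sg) * (M - M))"
    proof (rule norm_sum_by_parts_le[OF True])
      fix n assume "a \<le> n"
      then show "real (Suc n) powr (- sg) \<le> real n powr (- sg)" using sg by (intro powr_mono2') (auto simp: a_def)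
    next
      fix m assume "a \<le> m" "m \<le> b"
      then show "norm (\<Sum>n=a..m. cis (- (t * ln (real n)))) \<le> M"
        unfolding cnj using au bv by (intro M) auto
    qed simp
    also have "\<dots> = real a powr (- sg) * M" by simp
    also have "\<dots> \<le> u powr (- sg) * M" using M u au sg by (intro mult_right_mono powr_mono2') auto
    finally show ?thesis .
  qed
qed

definition ln_derivs :: "real \<Rightarrow> nat \<Rightarrow> real \<Rightarrow> real" where
  "ln_derivs c i x = (if i = 0 then c * ln x else - c * (- 1) ^ i * fact (i - 1) / x ^ i)"

lemma ln_derivs_deriv:
  assumes "x > 0"
  shows "(ln_derivs c i has_real_derivative ln_derivs c (Suc i) x) (at x)"
proof (cases i)
  case 0
  have "ln_derivs c 0 = (\<lambda>x. c * ln x)" by (simp add: ln_derivs_def fun_eq_iff)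
  moreover have "((\<lambda>x. c * ln x) has_real_derivative c * (1 / x)) (at x)"
    using assms by (auto intro!: derivative_eq_intros)
  ultimately show ?thesis using 0 by (simp add: ln_derivs_def)
next
  case (Suc m)
  have e: "ln_derivs c i = (\<lambda>x. - c * (- 1) ^ i * fact m * inverse (x ^ i))"
    using Suc by (simp add: ln_derivs_def fun_eq_iff divide_inverse)
  have "((\<lambda>x. - c * (- 1) ^ i * fact m * inverse (x ^ i)) has_real_derivative
      - c * (- 1) ^ i * fact m * (- (inverse (x ^ i) * (real i * x ^ (i - Suc 0)) * inverse (x ^ i)))) (at x)"
    using assms by (intro DERIV_cmult DERIV_inverse' DERIV_pow) auto
  moreover have "- c * (- 1) ^ i * fact m * (- (inverse (x ^ i) * (real i * x ^ (i - Suc 0)) * inverse (x ^ i)))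
      = ln_derivs c (Suc i) x"
    using assms Suc by (simp add: ln_derivs_def field_simps)
  ultimately show ?thesis unfolding e by simp
qed

lemma norm_sum_cis_sign:
  "norm (\<Sum>n\<in>A. cis ((- 1) ^ j * f n)) = norm (\<Sum>n\<in>A. cis (f n))"
proof (cases "even j")
  case False
  have "(\<Sum>n\<in>A. cis (- f n)) = cnj (\<Sum>n\<in>A. cis (f n))" by (simp add: cis_cnj)
  then have "norm (\<Sum>n\<in>A. cis (- f n)) = norm (\<Sum>n\<in>A. cis (f n))" by (simp only: complex_mod_cnj)
  then show ?thesis using False by simp
qed simp

text \<open>The factor \<open>0.51\<close> absorbs the rounding in the number of integers of \<open>(X, 1.5 X]\<close>.\<close>

lemma block_derivative_test:
  fixes j :: nat and A B t X sg Y :: real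
  assumes test: "derivative_test j A B" and j: "j \<ge> 2" and AB: "A \<ge> 0" "B \<ge> 0"
    and t: "t > 0" and X: "X \<ge> 100" and Y: "Y \<le> 1.5 * X" and sg: "sg \<ge> 0"
  shows "norm (dirichlet_sum sg t X Y) \<le> X powr (- sg) *
    (A * (1.5 ^ j) powr (2 / 2 ^ (j - 1)) * (0.51 * X) * (t * fact (j - 1) / (1.5 * X) ^ j) powr (1 / (2 ^ j - 2))
     + B * (0.51 * X) powr (1 - 2 / 2 ^ (j - 1)) * (t * fact (j - 1) / (1.5 * X) ^ j) powr (- 1 / (2 ^ j - 2)))"
proof (rule norm_dirichlet_sum_le)
  fix a b :: nat assume ab: "a \<le> b" "X < real a" "real b \<le> Y"
  \<comment> \<open>The sign makes the derivative of order \<open>j\<close> positive, as the test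
    demands; reversing the sign of the phase merely conjugates the sum.\<close>
  define D where "D = ln_derivs (- ((- 1) ^ j * t))"
  define lam where "lam = t * fact (j - 1) / (1.5 * X) ^ j"
  have "norm (\<Sum>n=a..b. cis (t * ln (real n))) = norm (\<Sum>n=a..b. cis ((-1) ^ Suc j * (t * ln (real n))))"
    by (rule norm_sum_cis_sign[symmetric])
  also have "\<dots> = norm (\<Sum>n=a..b. cis (D 0 (real n)))"
    by (simp add: D_def ln_derivs_def mult_ac)
  also have "\<dots> \<le> A * (1.5 ^ j) powr (2 / 2 ^ (j - 1)) * (0.51 * X) * lam powr (1 / (2 ^ j - 2))
     + B * (0.51 * X) powr (1 - 2 / 2 ^ (j - 1)) * lam powr (- 1 / (2 ^ j - 2))"
  proof (rule derivative_testD[OF test ab(1)])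
    have "real (Suc b - a) = real b - real a + 1" using ab by (simp add: Suc_diff_le of_nat_diff)
    then show "real (Suc b - a) \<le> 0.51 * X" using ab Y X by simp
    show "0 < lam" using t X by (simp add: lam_def)
    show "(1::real) \<le> 1.5 ^ j" by (intro one_le_power) simp
  next
    fix i x assume "real a \<le> x"
    then show "(D i has_real_derivative D (Suc i) x) (at x)"
      unfolding D_def using ab X by (intro ln_derivs_deriv) auto
  next
    fix x assume x: "real a \<le> x" "x \<le> real b"
    have x': "X \<le> x" "x \<le> 1.5 * X" "x > 0" using x ab X Y by auto
    have Dx: "D j x = t * fact (j - 1) / x ^ j"
    proof -
      have "(- 1) ^ j * (- 1) ^ j = (1::real)" by (simp flip: power_mult_distrib)
      then show ?thesis using j by (simp add: D_def ln_derivs_def)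
    qed
    have "lam \<le> D j x" unfolding Dx lam_def using x' t X by (intro divide_left_mono power_mono) auto
    moreover have "D j x \<le> t * fact (j - 1) / X ^ j" unfolding Dx using x' t X by (intro divide_left_mono power_mono) auto
    moreover have "t * fact (j - 1) / X ^ j = 1.5 ^ j * lam"
    proof -
      have "F / Z = c * (F / (c * Z))" if "c \<noteq> 0" for F Z c :: real using that by simp
      then show ?thesis unfolding lam_def power_mult_distrib by simp
    qed
    ultimately show "lam \<le> D j x \<and> D j x \<le> 1.5 ^ j * lam" by simp
  qed
  finally show "norm (\<Sum>n=a..b. cis (t * ln (real n))) \<le> A * (1.5 ^ j) powr (2 / 2 ^ (j - 1)) * (0.51 * X) * (t * fact (j - 1) / (1.5 * X) ^ j) powr (1 / (2 ^ j - 2))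
     + B * (0.51 * X) powr (1 - 2 / 2 ^ (j - 1)) * (t * fact (j - 1) / (1.5 * X) ^ j) powr (- 1 / (2 ^ j - 2))"
    unfolding lam_def .
qed (use X sg AB in \<open>auto intro!: add_nonneg_nonneg mult_nonneg_nonneg\<close>)

text \<open>Sharper than the instance of order 2 of \<open>block_derivative_test\<close>: the
  derivative of the phase varies by at most \<open>t / X - t / (1.5 * X) = t / (3 * X)\<close>, so
  no factor for the ratio of the second derivatives is lost, and the terms of lower order are kept.
  It also covers short blocks, from \<open>X \<ge> 1\<close> on. The coefficients come from
  \<open>1 / (6 * pi)\<close> and \<open>6 * sqrt 2\<close>.\<close>

lemma block_second_derivative:
  fixes t X sg Y :: real
  assumes t: "t > 0" and X: "X \<ge> 1" and Y: "Y \<le> 1.5 * X" and sg: "sg \<ge> 0" and lam: "t \<le> (1.5 * X)\<^sup>2"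
  shows "norm (dirichlet_sum sg t X Y) \<le> X powr (- sg) *
    (0.4503 * sqrt t + 0.0531 * (t / X) + 16.98 * (X / sqrt t) + 3)"
proof (rule norm_dirichlet_sum_le)
  fix a b :: nat assume ab: "a \<le> b" "X < real a" "real b \<le> Y"
  define D where "D = ln_derivs (- t)"
  define l where "l = t / (1.5 * X)\<^sup>2"
  define q where "q = sqrt t"
  have q: "q > 0" "t = q * q" using t by (auto simp: q_def)
  have l: "l > 0" "l \<le> 1" using t X lam by (auto simp: l_def)
  have sl: "sqrt l = q / (1.5 * X)" using X by (simp add: l_def real_sqrt_divide q_def)
  have "norm (\<Sum>n=a..b. cis (t * ln (real n))) = norm (\<Sum>n=a..b. cis ((-1) ^ 1 * (t * ln (real n))))"
    by (rule norm_sum_cis_sign[symmetric])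
  also have "\<dots> = norm (\<Sum>n=a..b. cis (D 0 (real n)))"
    by (simp add: D_def ln_derivs_def mult_ac)
  also have "\<dots> \<le> (t / (3 * X) / (2 * pi) + 2) * (4 * sqrt 2 / sqrt l + 1) + 1"
  proof (rule second_derivative_test[OF ab(1) _ _ _ l])
    fix x assume x: "real a \<le> x"
    then have "x > 0" using ab X by auto
    then show "(D 0 has_real_derivative D 1 x) (at x)" "(D 1 has_real_derivative D 2 x) (at x)"
      unfolding D_def using ln_derivs_deriv[of x "- t" 0] ln_derivs_deriv[of x "- t" 1] by (simp_all add: numeral_2_eq_2)
    assume "x \<le> real b"
    then show "l \<le> D 2 x" using x ab X Y t \<open>x > 0\<close>
      by (auto simp: D_def ln_derivs_def l_def intro!: divide_left_mono power_mono)
  next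
    have "D 1 (real b) - D 1 (real a) = t / real a - t / real b" by (simp add: D_def ln_derivs_def)
    also have "\<dots> \<le> t / X - t / (1.5 * X)"
      using ab X Y t by (intro diff_mono divide_left_mono) auto
    also have "\<dots> = t / (3 * X)" using X by (simp add: field_simps)
    finally show "D 1 (real b) - D 1 (real a) \<le> t / (3 * X)" .
  qed
  also have "\<dots> \<le> (0.05306 * (t / X) + 2) * (8.4852816 * (X / q) + 1) + 1"
  proof (intro add_mono mult_mono order.refl)
    have "sqrt 2 \<le> 1.4142136" by (rule real_le_lsqrt) (simp_all add: power2_eq_square)
    then have "sqrt 2 * (X / q) \<le> 1.4142136 * (X / q)" using X q by (intro mult_right_mono) auto
    moreover have "4 * sqrt 2 / sqrt l = 6 * (sqrt 2 * (X / q))" unfolding sl by simp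
    ultimately show "4 * sqrt 2 / sqrt l \<le> 8.4852816 * (X / q)" by linarith
    define V where "V = t / X"
    have V: "V \<ge> 0" using X t by (simp add: V_def)
    have "1 \<le> 0.05306 * (6 * pi)" using pi_approx by simp
    then have "V * 1 \<le> V * (0.05306 * (6 * pi))" using V by (intro mult_left_mono) auto
    then have "V / (6 * pi) \<le> 0.05306 * V" by (subst pos_divide_le_eq) (simp_all add: mult_ac)
    moreover have "t / (3 * X) / (2 * pi) = V / (6 * pi)" by (simp add: V_def)
    ultimately show "t / (3 * X) / (2 * pi) \<le> 0.05306 * (t / X)" by (simp only: V_def)
  qed (use X t l q in auto)
  also have "\<dots> = 0.05306 * 8.4852816 * ((t / X) * (X / q)) + 0.05306 * (t / X) + 2 * 8.4852816 * (X / q) + 3"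
  proof -
    have "(c * V + 2) * (d * W + 1) + 1 = c * d * (V * W) + c * V + 2 * d * W + 3" for c d V W :: real
      by (simp add: algebra_simps)
    then show ?thesis .
  qed
  also have "(t / X) * (X / q) = q" using X q by simp
  also have "0.05306 * 8.4852816 * q + 0.05306 * (t / X) + 2 * 8.4852816 * (X / q) + 3
      \<le> 0.4503 * q + 0.0531 * (t / X) + 16.98 * (X / q) + 3"
    using X q t by (intro add_mono mult_right_mono) auto
  finally show "norm (\<Sum>n=a..b. cis (t * ln (real n))) \<le> 0.4503 * sqrt t + 0.0531 * (t / X) + 16.98 * (X / sqrt t) + 3"
    by (simp add: q_def)
qed (use X sg t in auto)

text \<open>On the logarithmic scale \<open>t = exp x\<close>, \<open>X = exp y\<close>, both terms
  of a test become exponentials of linear forms in \<open>x\<close> and \<open>y\<close>. Using some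
  \<open>d \<ge> 1 - sg\<close> in place of \<open>1 - sg\<close> makes the bound valid for a whole
  range of \<open>sg\<close>.\<close>

lemma block_test_exp:
  fixes j :: nat and A B x y d sg Y al be :: real
  defines "J \<equiv> 2 ^ (j - 1) :: real" and "a \<equiv> 1 / (2 ^ j - 2)" and "c \<equiv> fact (j - 1) / 1.5 ^ j :: real"
  assumes test: "derivative_test j A B" and j: "j \<ge> 2" and AB: "A \<ge> 0" "B \<ge> 0"
    and y: "exp y \<ge> 100" and Y: "Y \<le> 1.5 * exp y" and sg: "sg \<ge> 0" "1 - sg \<le> d"
    and al: "A * (1.5 ^ j) powr (2 / J) * 0.51 * c powr a \<le> al"
    and be: "B * 0.51 powr (1 - 2 / J) * c powr (- a) \<le> be"
  shows "norm (dirichlet_sum sg (exp x) (exp y) Y)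
    \<le> al * exp (d * y + a * (x - real j * y)) + be * exp ((d - 2 / J) * y - a * (x - real j * y))"
proof -
  have "exp 0 \<le> exp y" using y exp_zero[where 'a=real] by linarith
  then have y0: "y \<ge> 0" by (simp only: exp_le_cancel_iff)
  define w where "w = exp (x - real j * y)"
  have c0: "c > 0" by (simp add: c_def)
  have lam: "exp x * fact (j - 1) / (1.5 * exp y) ^ j = c * w"
    unfolding power_mult_distrib w_def c_def by (simp add: exp_diff exp_of_nat_mult)
  have wa: "w powr a = exp (a * (x - real j * y))" "w powr (- a) = exp (- (a * (x - real j * y)))"
    unfolding w_def by (simp_all add: powr_def)
  have X: "exp y powr r = exp (r * y)" for r by (simp add: powr_def)
  have wt: "exp y powr (- sg) * exp y \<le> exp (d * y)"
  proof -
    have "exp y powr (- sg) * exp y = exp ((1 - sg) * y)" unfolding X by (simp add: exp_add[symmetric] algebra_simps)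
    also have "\<dots> \<le> exp (d * y)" using sg y0 by (simp add: mult_right_mono)
    finally show ?thesis .
  qed
  have "norm (dirichlet_sum sg (exp x) (exp y) Y) \<le> exp y powr (- sg) *
    (A * (1.5 ^ j) powr (2 / J) * (0.51 * exp y) * (c * w) powr a
     + B * (0.51 * exp y) powr (1 - 2 / J) * (c * w) powr (- a))"
    using block_derivative_test[OF test j AB exp_gt_zero y Y sg(1), of x] unfolding lam
    by (simp only: J_def a_def minus_divide_left)
  also have "\<dots> = (exp y powr (- sg) * exp y) * (A * (1.5 ^ j) powr (2 / J) * 0.51 * c powr a) * w powr a
      + (exp y powr (- sg) * exp y powr (1 - 2 / J)) * (B * 0.51 powr (1 - 2 / J) * c powr (- a)) * w powr (- a)"
    by (simp only: powr_mult) (simp add: algebra_simps)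
  also have "exp y powr (- sg) * exp y powr (1 - 2 / J) = (exp y powr (- sg) * exp y) * exp (- (2 / J) * y)"
    unfolding X by (simp add: exp_add[symmetric] algebra_simps)
  also have "(exp y powr (- sg) * exp y) * (A * (1.5 ^ j) powr (2 / J) * 0.51 * c powr a) * w powr a
      + (exp y powr (- sg) * exp y) * exp (- (2 / J) * y) * (B * 0.51 powr (1 - 2 / J) * c powr (- a)) * w powr (- a)
    \<le> exp (d * y) * al * w powr a + exp (d * y) * exp (- (2 / J) * y) * be * w powr (- a)"
  proof -
    have "0 \<le> al" "0 \<le> be" using AB by (auto intro!: order.trans[OF _ al] order.trans[OF _ be])
    then show ?thesis using wt al be AB by (intro add_mono mult_mono mult_nonneg_nonneg) auto
  qed
  also have "\<dots> = al * exp (d * y + a * (x - real j * y)) + be * exp ((d - 2 / J) * y - a * (x - real j * y))"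
    unfolding wa by (simp add: exp_add[symmetric] exp_diff[symmetric] algebra_simps)
  finally show ?thesis .
qed

lemma block_test_3:
  assumes "exp y \<ge> 100" "Y \<le> 1.5 * exp y" "sg \<ge> 0" "1 - sg \<le> d"
  shows "norm (dirichlet_sum sg (exp x) (exp y) Y)
    \<le> 1.16 * exp (x / 6 - (1 / 2 - d) * y) + 4.29 * exp (d * y - x / 6)"
proof -
  have c: "(fact (3 - 1) / 1.5 ^ 3 :: real) = 16 / 27" by (simp add: fact_numeral power3_eq_cube)
  have e: "1 / (2 ^ 3 - 2) = 1 / real 6" "1 - 2 / 2 ^ (3 - 1) = 1 / real 2" "2 / 2 ^ (3 - 1) = 1 / real 2" by simp_all
  have "(16 / 27) powr (1 / real 6) \<le> (0.917 :: real)"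
    by (rule powr_le_if_le_power) (simp_all add: power_numeral_reduce)
  moreover have "(1.5 ^ 3) powr (1 / real 2) \<le> (1.8372 :: real)"
    by (rule powr_le_if_le_power) (simp_all add: power_numeral_reduce)
  ultimately have "(1.5 ^ 3) powr (1 / real 2) * (16 / 27) powr (1 / real 6) \<le> 1.8372 * (0.917 :: real)"
    by (intro mult_mono) auto
  then have al: "1.35 * (1.5 ^ 3) powr (2 / 2 ^ (3 - 1)) * 0.51 * (fact (3 - 1) / 1.5 ^ 3) powr (1 / (2 ^ 3 - 2)) \<le> (1.16 :: real)"
    unfolding c e by simp
  have "(27 / 16) powr (1 / real 6) \<le> (1.0912 :: real)"
    by (rule powr_le_if_le_power) (simp_all add: power_numeral_reduce)
  moreover have "(16 / 27) powr (- (1 / real 6)) = (27 / 16 :: real) powr (1 / real 6)"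
    by (simp add: powr_minus powr_divide)
  moreover have "0.51 powr (1 / real 2) \<le> (0.7142 :: real)"
    by (rule powr_le_if_le_power) (simp_all add: power_numeral_reduce)
  ultimately have "0.51 powr (1 / real 2) * (16 / 27) powr (- (1 / real 6)) \<le> 0.7142 * (1.0912 :: real)"
    by (intro mult_mono) auto
  then have be: "5.5 * 0.51 powr (1 - 2 / 2 ^ (3 - 1)) * (fact (3 - 1) / 1.5 ^ 3) powr (- (1 / (2 ^ 3 - 2))) \<le> (4.29 :: real)"
    unfolding c e by (simp add: mult_ac)
  have "norm (dirichlet_sum sg (exp x) (exp y) Y)
    \<le> 1.16 * exp (d * y + 1 / (2 ^ 3 - 2) * (x - real 3 * y))
     + 4.29 * exp ((d - 2 / 2 ^ (3 - 1)) * y - 1 / (2 ^ 3 - 2) * (x - real 3 * y))"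
    by (rule block_test_exp[OF derivative_test_3 _ _ _ assms al be]) simp_all
  also have "d * y + 1 / (2 ^ 3 - 2) * (x - real 3 * y) = x / 6 - (1 / 2 - d) * y" by (simp add: field_simps)
  also have "(d - 2 / 2 ^ (3 - 1)) * y - 1 / (2 ^ 3 - 2) * (x - real 3 * y) = d * y - x / 6" by (simp add: field_simps)
  finally show ?thesis .
qed

lemma block_test_4:
  assumes "exp y \<ge> 100" "Y \<le> 1.5 * exp y" "sg \<ge> 0" "1 - sg \<le> d"
  shows "norm (dirichlet_sum sg (exp x) (exp y) Y)
    \<le> 1.05 * exp (x / 14 - (2 / 7 - d) * y) + 2.12 * exp ((d + 1 / 28) * y - x / 14)"
proof -
  have c: "(fact (4 - 1) / 1.5 ^ 4 :: real) = 32 / 27" by (simp add: fact_numeral power_numeral_reduce)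
  have e: "1 / (2 ^ 4 - 2) = 1 / real 14" "2 / 2 ^ (4 - 1) = 1 / real 4" "1 - 1 / real 4 = 3 / 4" by simp_all
  have "(32 / 27) powr (1 / real 14) \<le> (1.0123 :: real)"
    by (rule powr_le_if_le_power) (simp_all add: power_numeral_reduce)
  moreover have "(1.5 ^ 4) powr (1 / real 4) \<le> (1.5 :: real)"
    by (rule powr_le_if_le_power) simp_all
  ultimately have "(1.5 ^ 4) powr (1 / real 4) * (32 / 27) powr (1 / real 14) \<le> 1.5 * (1.0123 :: real)"
    by (intro mult_mono) auto
  then have al: "1.35 * (1.5 ^ 4) powr (2 / 2 ^ (4 - 1)) * 0.51 * (fact (4 - 1) / 1.5 ^ 4) powr (1 / (2 ^ 4 - 2)) \<le> (1.05 :: real)"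
    unfolding c e by simp
  have "(0.51 ^ 3) powr (1 / real 4) \<le> (0.6036 :: real)"
    by (rule powr_le_if_le_power) (simp_all add: power_numeral_reduce)
  moreover have "(0.51 ^ 3) powr (1 / real 4) = 0.51 powr (3 / 4 :: real)"
    by (simp add: powr_powr flip: powr_numeral)
  moreover have "(32 / 27) powr (- (1 / real 14)) \<le> (32 / 27) powr (0::real)" by (intro powr_mono) auto
  ultimately have "0.51 powr (3 / 4) * (32 / 27) powr (- (1 / real 14)) \<le> 0.6036 * (1 :: real)"
    by (intro mult_mono) auto
  then have be: "3.5 * 0.51 powr (1 - 2 / 2 ^ (4 - 1)) * (fact (4 - 1) / 1.5 ^ 4) powr (- (1 / (2 ^ 4 - 2))) \<le> (2.12 :: real)"
    unfolding c e by simp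
  have "norm (dirichlet_sum sg (exp x) (exp y) Y)
    \<le> 1.05 * exp (d * y + 1 / (2 ^ 4 - 2) * (x - real 4 * y))
     + 2.12 * exp ((d - 2 / 2 ^ (4 - 1)) * y - 1 / (2 ^ 4 - 2) * (x - real 4 * y))"
    by (rule block_test_exp[OF derivative_test_4 _ _ _ assms al be]) simp_all
  also have "d * y + 1 / (2 ^ 4 - 2) * (x - real 4 * y) = x / 14 - (2 / 7 - d) * y" by (simp add: field_simps)
  also have "(d - 2 / 2 ^ (4 - 1)) * y - 1 / (2 ^ 4 - 2) * (x - real 4 * y) = (d + 1 / 28) * y - x / 14" by (simp add: field_simps)
  finally show ?thesis .
qed

text \<open>The second inequality bounds the quotient of consecutive left-hand sides of the first,
  so they are proved together. In effect the factorial is negligible after taking the root of order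
  \<open>2 ^ j - 2\<close>.\<close>

lemma fact_le_power_105:
  assumes "j \<ge> 5"
  shows "fact (j - 1) / 1.5 ^ j \<le> (1.05 :: real) ^ (2 ^ j - 2)" "real j / 1.5 \<le> 1.05 ^ (2 ^ j)"
  using assms
proof (induction j rule: dec_induct)
  case base
  {
    case 1
    have "(1.05::real) ^ (2 ^ 5 - 2) = 1.05 ^ 30" by simp
    also have "\<dots> \<ge> fact (5 - 1) / 1.5 ^ 5" by (simp add: fact_numeral power_numeral_reduce)
    finally show ?case .
  next
    case 2
    have "(1.05::real) ^ (2 ^ 5) = 1.05 ^ 32" by simp
    also have "\<dots> \<ge> real 5 / 1.5" by (simp add: power_numeral_reduce)
    finally show ?case .
  }
next
  case (step j)
  {
    case 1
    have "fact (Suc j - 1) / 1.5 ^ Suc j = (fact (j - 1) / 1.5 ^ j) * (real j / 1.5 :: real)"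
      using step(1) by (cases j) auto
    also have "\<dots> \<le> 1.05 ^ (2 ^ j - 2) * 1.05 ^ (2 ^ j)"
      by (intro mult_mono step) auto
    also have "\<dots> = 1.05 ^ (2 ^ Suc j - 2)"
    proof -
      have "(2::nat) ^ j \<ge> 2 ^ 1" using step(1) by (intro power_increasing) auto
      then have "(2::nat) ^ j - 2 + 2 ^ j = 2 ^ Suc j - 2" by simp
      then show ?thesis by (simp only: power_add[symmetric])
    qed
    finally show ?case .
  next
    case 2
    have "real (Suc j) / 1.5 \<le> (real j / 1.5) * (real j / 1.5)"
    proof -
      have "6 * (r + 1) \<le> 4 * (r * r)" if r: "r \<ge> 5" for r :: real
      proof -
        have "6 * (r + 1) \<le> 4 * (5 * r)" using r by simp
        also have "\<dots> \<le> 4 * (r * r)" using r by (intro mult_left_mono mult_right_mono) auto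
        finally show ?thesis .
      qed
      then have "6 * (real j + 1) \<le> 4 * (real j * real j)" using step(1) by simp
      then show ?thesis by (simp add: field_simps)
    qed
    also have "\<dots> \<le> 1.05 ^ (2 ^ j) * 1.05 ^ (2 ^ j)" by (intro mult_mono step) auto
    also have "\<dots> = 1.05 ^ (2 ^ Suc j)" by (simp only: power_add[symmetric] mult_2 power_Suc)
    finally show ?case .
  }
qed

lemma ge_5_bounds:
  assumes "j \<ge> 5"
  shows "16 * real j \<le> 5 * 2 ^ (j - 1)" "(1.5 :: real) ^ j \<le> fact (j - 1)"
  using assms
proof (induction j rule: dec_induct)
  case base
  {
    case 1 show ?case by simp
  next
    case 2 show ?case by (simp add: fact_numeral power_numeral_reduce)
  }
next
  case (step j)
  have e: "(2::real) ^ (Suc j - 1) = 2 * 2 ^ (j - 1)" using step(1) by (simp add: power_eq_if)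
  {
    case 1 show ?case unfolding e using step by simp
  next
    case 2
    have "(1.5 :: real) ^ Suc j = 1.5 ^ j * 1.5" by simp
    also have "\<dots> \<le> fact (j - 1) * real j" using step by (intro mult_mono) auto
    also have "\<dots> = fact (Suc j - 1)" using step(1) by (cases j) auto
    finally show ?case .
  }
qed

text \<open>The constants are independent of \<open>j\<close> since each factor is extremal at
  \<open>j = 5\<close> or bounded uniformly: \<open>j / 2 ^ (j - 1) \<le> 5 / 16\<close> handles the
  power of \<open>1.5 ^ j\<close>, and \<open>c = fact (j - 1) / 1.5 ^ j\<close> satisfies
  \<open>c \<ge> 1\<close> and \<open>c powr a \<le> 1.05\<close>.\<close>

lemma block_test_ge_5:
  fixes j :: nat
  defines "a \<equiv> 1 / (2 ^ j - 2)"
  assumes j: "j \<ge> 5" and y: "exp y \<ge> 100" "Y \<le> 1.5 * exp y" "sg \<ge> 0" "1 - sg \<le> d"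
  shows "norm (dirichlet_sum sg (exp x) (exp y) Y)
    \<le> 0.95 * exp (d * y + a * (x - real j * y)) + 1.2 * exp ((d - 2 / 2 ^ (j - 1)) * y - a * (x - real j * y))"
  unfolding a_def
proof (rule block_test_exp[OF derivative_test_ge_5[OF j] _ _ _ y])
  define J :: real where "J = 2 ^ (j - 1)"
  define c :: real where "c = fact (j - 1) / 1.5 ^ j"
  have J16: "J \<ge> 16" using j power_increasing[of 4 "j - 1" "2::real"] by (simp add: J_def)
  have jJ: "real j * (2 / J) \<le> 5 / 8" using ge_5_bounds(1)[OF j] J16 by (simp add: J_def field_simps)
  have c1: "c \<ge> 1" using ge_5_bounds(2)[OF j] by (simp add: c_def)
  define n :: nat where "n = 2 ^ j - 2"
  have "(2::nat) ^ j \<ge> 2 ^ 5" using j by (intro power_increasing) auto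
  then have n: "n > 0" "real n = 2 ^ j - 2" by (auto simp: n_def of_nat_diff)
  have "c powr (1 / real n) \<le> 1.05"
    using fact_le_power_105(1)[OF j] c1 n by (intro powr_le_if_le_power) (auto simp: c_def n_def)
  then have ca: "c powr (1 / (2 ^ j - 2)) \<le> 1.05" by (simp add: n)
  have "(1.5 ^ j) powr (2 / J) = 1.5 powr (real j * (2 / J))"
    by (simp add: powr_powr flip: powr_realpow)
  also have "\<dots> \<le> 1.5 powr (5 / 8)" using jJ by (intro powr_mono) auto
  also have "\<dots> = (1.5 ^ 5) powr (1 / real 8)" by (simp add: powr_powr flip: powr_numeral)
  also have "\<dots> \<le> 1.2885" by (rule powr_le_if_le_power) (simp_all add: power_numeral_reduce)
  finally have "(1.5 ^ j) powr (2 / J) * c powr (1 / (2 ^ j - 2)) \<le> 1.2885 * 1.05"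
    using ca by (intro mult_mono) auto
  then show "1.35 * (1.5 ^ j) powr (2 / 2 ^ (j - 1)) * 0.51 * (fact (j - 1) / 1.5 ^ j) powr (1 / (2 ^ j - 2)) \<le> (0.95 :: real)"
    unfolding J_def[symmetric] c_def[symmetric] by (simp add: mult_ac)
  have "c powr (- (1 / (2 ^ j - 2))) \<le> c powr 0" using c1 n by (intro powr_mono) auto
  then have ca': "c powr (- (1 / (2 ^ j - 2))) \<le> 1" using c1 by simp
  have "0.51 powr (1 - 2 / J) \<le> (0.51 :: real) powr (7 / 8)"
    using J16 by (intro powr_mono') (auto simp: field_simps)
  also have "\<dots> = (0.51 ^ 7) powr (1 / real 8)" by (simp add: powr_powr flip: powr_numeral)
  also have "\<dots> \<le> 0.555" by (rule powr_le_if_le_power) (simp_all add: power_numeral_reduce)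
  finally have "0.51 powr (1 - 2 / J) * c powr (- (1 / (2 ^ j - 2))) \<le> 0.555 * 1"
    using ca' by (intro mult_mono) auto
  then show "2.1 * 0.51 powr (1 - 2 / 2 ^ (j - 1)) * (fact (j - 1) / 1.5 ^ j) powr (- (1 / (2 ^ j - 2))) \<le> (1.2 :: real)"
    unfolding J_def[symmetric] c_def[symmetric] by (simp add: mult_ac)
qed (use j in auto)

section \<open>Rational bounds for the exponential function\<close>

definition exp_taylor :: "real \<Rightarrow> real" where
  "exp_taylor u = 1 + u + u\<^sup>2 / 2 + u ^ 3 / 6 + u ^ 4 / 24 + u ^ 5 / 120"

text \<open>The degree is odd, so the Lagrange remainder carries the even power \<open>u ^ 6\<close>
  and is nonnegative for negative \<open>u\<close> as well.\<close>

lemma exp_taylor_le: "exp_taylor u \<le> exp u"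
proof -
  obtain v where v: "exp u = (\<Sum>m<6. u ^ m / fact m) + exp v / fact 6 * u ^ 6"
    using Maclaurin_exp_le[of u 6] by auto
  have "0 \<le> exp v / fact 6 * u ^ 6" by simp
  moreover have "(\<Sum>m<6. u ^ m / fact m) = exp_taylor u"
    by (simp add: exp_taylor_def eval_nat_numeral fact_numeral lessThan_Suc)
  ultimately show ?thesis using v by linarith
qed

lemma exp_le_by_taylor:
  assumes n: "n > 0" and P: "exp_taylor (- (q / real n)) > 0" "1 \<le> r * exp_taylor (- (q / real n)) ^ n"
  shows "exp q \<le> r"
proof -
  have "exp_taylor (- (q / real n)) ^ n \<le> exp (- (q / real n)) ^ n"
    using P by (intro power_mono exp_taylor_le) auto
  also have "\<dots> = exp (- q)" using n by (simp flip: exp_of_nat_mult)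
  finally have le: "exp_taylor (- (q / real n)) ^ n \<le> exp (- q)" .
  have pos: "exp_taylor (- (q / real n)) ^ n > 0" using P by simp
  have "r > 0" using P(2) pos by (smt (verit) mult_nonpos_nonneg)
  then have "1 \<le> r * exp (- q)" using P(2) le by (meson mult_left_mono less_imp_le order.trans)
  then have "1 * exp q \<le> (r * exp (- q)) * exp q" by (intro mult_right_mono) auto
  also have "\<dots> = r" by (simp add: exp_minus)
  finally show ?thesis by simp
qed

lemma le_exp_by_taylor:
  assumes n: "n > 0" and P: "exp_taylor (q / real n) \<ge> 0" "r \<le> exp_taylor (q / real n) ^ n"
  shows "r \<le> exp q"
proof -
  have "exp_taylor (q / real n) ^ n \<le> exp (q / real n) ^ n"
    using P by (intro power_mono exp_taylor_le) auto
  also have "\<dots> = exp q" using n by (simp flip: exp_of_nat_mult)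
  finally show ?thesis using P by linarith
qed

lemma block_test_2:
  assumes y: "y \<ge> 0" "Y \<le> 1.5 * exp y" and sg: "sg \<ge> 0" "1 - sg \<le> d" and x: "x \<le> 2 * y + 0.8"
  shows "norm (dirichlet_sum sg (exp x) (exp y) Y)
    \<le> 0.4503 * exp (x / 2 - (1 - d) * y) + 0.0531 * exp (x - (2 - d) * y)
      + 16.98 * exp (d * y - x / 2) + 3 * exp (- (1 - d) * y)"
proof -
  have "(exp (x / 2))\<^sup>2 = exp x" by (simp add: power2_eq_square exp_add[symmetric])
  then have sq: "sqrt (exp x) = exp (x / 2)" by (intro real_sqrt_unique) auto
  \<comment> \<open>0.8 lies just below \<open>2 * ln 1.5\<close>. The hypothesis on
    \<open>x\<close> thus gives \<open>t \<le> (1.5 * X)\<^sup>2\<close>, which is what the second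
    derivative test needs for \<open>lam \<le> 1\<close>.\<close>
  have "exp (0.8 :: real) \<le> 1.5\<^sup>2"
    by (rule exp_le_by_taylor[of 2]) (simp_all add: exp_taylor_def power_numeral_reduce)
  then have "exp (2 * y) * exp (0.8 :: real) \<le> exp (2 * y) * 1.5\<^sup>2" by simp
  moreover have "exp x \<le> exp (2 * y) * exp 0.8" using x by (simp add: exp_add[symmetric])
  moreover have "exp (2 * y) * 1.5\<^sup>2 = (1.5 * exp y)\<^sup>2" by (simp add: power_mult_distrib power2_eq_square exp_add[symmetric])
  ultimately have lam: "exp x \<le> (1.5 * exp y)\<^sup>2" by linarith
  have X: "exp y powr r = exp (r * y)" for r by (simp add: powr_def)
  have "exp y powr (- sg) = exp (- sg * y)" by (rule X)
  also have "\<dots> \<le> exp (- (1 - d) * y)"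
  proof -
    have "- sg * y \<le> - (1 - d) * y" using sg y by (intro mult_right_mono) auto
    then show ?thesis by simp
  qed
  finally have wt: "exp y powr (- sg) \<le> exp (- (1 - d) * y)" .
  have "norm (dirichlet_sum sg (exp x) (exp y) Y) \<le> exp y powr (- sg) *
    (0.4503 * sqrt (exp x) + 0.0531 * (exp x / exp y) + 16.98 * (exp y / sqrt (exp x)) + 3)"
    using y sg lam by (intro block_second_derivative) auto
  also have "\<dots> \<le> exp (- (1 - d) * y) * (0.4503 * sqrt (exp x) + 0.0531 * (exp x / exp y) + 16.98 * (exp y / sqrt (exp x)) + 3)"
    using wt by (intro mult_right_mono) (auto intro!: add_nonneg_nonneg)
  also have "\<dots> = 0.4503 * (exp (- (1 - d) * y) * exp (x / 2)) + 0.0531 * (exp (- (1 - d) * y) * exp x / exp y)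
      + 16.98 * (exp (- (1 - d) * y) * exp y / exp (x / 2)) + 3 * exp (- (1 - d) * y)"
    unfolding sq by (simp add: algebra_simps)
  also have "\<dots> = 0.4503 * exp (x / 2 - (1 - d) * y) + 0.0531 * exp (x - (2 - d) * y)
      + 16.98 * exp (d * y - x / 2) + 3 * exp (- (1 - d) * y)"
  proof -
    have "- (1 - d) * y + x / 2 = x / 2 - (1 - d) * y" "- (1 - d) * y + x - y = x - (2 - d) * y"
      "- (1 - d) * y + y - x / 2 = d * y - x / 2" by (simp_all add: algebra_simps)
    then show ?thesis by (simp only: exp_add[symmetric] exp_diff[symmetric])
  qed
  finally show ?thesis .
qed

section \<open>Summation of block bounds over a range\<close>

lemma ln_three_halves: "0.4 \<le> ln (3 / 2 :: real)" "1 / ln (3 / 2 :: real) \<le> 2.47"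
proof -
  have "exp (100 / 247 :: real) \<le> 3 / 2"
    by (rule exp_le_by_taylor[of 1]) (simp_all add: exp_taylor_def power_numeral_reduce)
  then have "100 / 247 \<le> ln (3 / 2 :: real)" by (subst ln_ge_iff) simp_all
  then show "0.4 \<le> ln (3 / 2 :: real)" "1 / ln (3 / 2 :: real) \<le> 2.47"
    by (auto simp: field_simps)
qed

text \<open>The last block is cut off at \<open>exp y1\<close>, which is why \<open>block\<close>
  admits every \<open>Y\<close> up to \<open>1.5 * exp y\<close> and not only the full
  block.\<close>

lemma range_le_sum_blocks:
  fixes f :: "real \<Rightarrow> real"
  defines "L \<equiv> ln (3 / 2)"
  assumes block: "\<And>y Y. y0 \<le> y \<Longrightarrow> y \<le> y1 \<Longrightarrow> exp y \<le> Y \<Longrightarrow> Y \<le> exp y1 \<Longrightarrow> Y \<le> 1.5 * exp y \<Longrightarrow>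
      norm (dirichlet_sum sg t (exp y) Y) \<le> f y"
    and y: "y0 \<le> y1"
  shows "norm (dirichlet_sum sg t (exp y0) (exp y1)) \<le> (\<Sum>i<nat \<lceil>(y1 - y0) / L\<rceil>. f (y0 + real i * L))"
proof -
  have L: "L > 0" by (simp add: L_def)
  define I where "I = nat \<lceil>(y1 - y0) / L\<rceil>"
  have "(y1 - y0) / L \<le> real I" unfolding I_def by linarith
  then have I: "y1 \<le> y0 + real I * L" using L by (simp add: field_simps)
  have lt: "y0 + real i * L < y1" if "i < I" for i
  proof -
    have "real i < (y1 - y0) / L" using that unfolding I_def by linarith
    then show ?thesis using L by (simp add: field_simps)
  qed
  have "norm (dirichlet_sum sg t (exp y0) (exp (min (y0 + real m * L) y1))) \<le> (\<Sum>i<m. f (y0 + real i * L))" if "m \<le> I" for m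
    using that
  proof (induction m)
    case 0
    have "{n::nat. exp y0 < real n \<and> real n \<le> exp y0} = {}" by auto
    then have "dirichlet_sum sg t (exp y0) (exp y0) = 0" unfolding dirichlet_sum_def by (simp only: sum.empty)
    then show ?case using y by simp
  next
    case (Suc m)
    define y where "y = y0 + real m * L"
    define Y where "Y = exp (min (y0 + real (Suc m) * L) y1)"
    have y1: "y < y1" using lt[of m] Suc by (simp add: y_def)
    have e: "exp (y0 + real (Suc m) * L) = 1.5 * exp y"
      by (simp add: y_def L_def algebra_simps exp_add)
    have Y: "exp y \<le> Y" "Y \<le> exp y1" "Y \<le> 1.5 * exp y" "y0 \<le> y"
      using y1 L unfolding e[symmetric] by (auto simp: Y_def y_def algebra_simps)
    have "dirichlet_sum sg t (exp y0) Y = dirichlet_sum sg t (exp y0) (exp y) + dirichlet_sum sg t (exp y) Y"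
      using Y by (intro dirichlet_sum_split) auto
    moreover have "norm (dirichlet_sum sg t (exp y) Y) \<le> f y" using Y y1 by (intro block) auto
    moreover have "norm (dirichlet_sum sg t (exp y0) (exp y)) \<le> (\<Sum>i<m. f (y0 + real i * L))"
      using Suc y1 by (simp add: y_def min_def split: if_splits)
    ultimately show ?case
      using norm_triangle_ineq[of "dirichlet_sum sg t (exp y0) (exp y)" "dirichlet_sum sg t (exp y) Y"]
      unfolding Y_def[symmetric] by (simp add: y_def[symmetric])
  qed
  from this[of I] I show ?thesis by (simp add: min_def I_def split: if_splits)
qed

lemma sum_exp_decreasing:
  fixes c g y0 L :: real
  assumes c: "0 < c" and L: "L = ln (3 / 2)" and g: "1 \<le> g * (1 - exp (- c * L))"
  shows "(\<Sum>i<I. exp (- c * (y0 + real i * L))) \<le> g * exp (- c * y0)"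
proof -
  define q where "q = exp (- c * L)"
  have q: "0 < q" "q < 1" using c by (auto simp: q_def L)
  have "(\<Sum>i<I. exp (- c * (y0 + real i * L))) = exp (- c * y0) * (\<Sum>i<I. q ^ i)"
    by (simp add: sum_distrib_left q_def exp_of_nat_mult[symmetric] exp_add[symmetric] algebra_simps)
  also have "(\<Sum>i<I. q ^ i) = (1 - q ^ I) / (1 - q)" using q by (subst sum_gp_strict) auto
  also have "\<dots> \<le> 1 / (1 - q)" using q by (intro divide_right_mono) auto
  also have "\<dots> \<le> g" using g q unfolding q_def[symmetric] by (simp add: field_simps)
  finally show ?thesis by (simp add: mult.commute)
qed

text \<open>The blocks are counted from the top: the last one starts at or below \<open>y1\<close>,
  so the one \<open>i\<close> places earlier starts at or below \<open>y1 - i * L\<close>, and the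
  series is dominated by its largest term.\<close>

lemma sum_exp_increasing:
  fixes c g y0 y1 L :: real
  assumes c: "0 < c" and L: "L = ln (3 / 2)" and g: "1 \<le> g * (1 - exp (- c * L))"
  shows "(\<Sum>i<nat \<lceil>(y1 - y0) / L\<rceil>. exp (c * (y0 + real i * L))) \<le> g * exp (c * y1)"
proof -
  define I where "I = nat \<lceil>(y1 - y0) / L\<rceil>"
  have L0: "L > 0" by (simp add: L)
  have "(\<Sum>i<I. exp (c * (y0 + real i * L))) = (\<Sum>i<I. exp (c * (y0 + real (I - Suc i) * L)))"
    by (rule sum.nat_diff_reindex[symmetric])
  also have "\<dots> \<le> (\<Sum>i<I. exp (- c * (- y1 + real i * L)))"
  proof (rule sum_mono)
    fix i assume i: "i \<in> {..<I}"
    have "real I - 1 < (y1 - y0) / L" using i unfolding I_def by simp linarith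
    then have "(real I - 1) * L \<le> y1 - y0" using L0 by (simp add: field_simps)
    moreover have "real (I - Suc i) = real I - 1 - real i" using i by (simp add: of_nat_diff)
    ultimately have "y0 + real (I - Suc i) * L \<le> y1 - real i * L" by (simp add: algebra_simps)
    then have "c * (y0 + real (I - Suc i) * L) \<le> c * (y1 - real i * L)" using c by (intro mult_left_mono) auto
    then show "exp (c * (y0 + real (I - Suc i) * L)) \<le> exp (- c * (- y1 + real i * L))" by (simp add: algebra_simps)
  qed
  also have "\<dots> \<le> g * exp (- c * (- y1))" by (rule sum_exp_decreasing[OF c L g])
  finally show ?thesis by (simp add: I_def)
qed

text \<open>A certificate in rational arithmetic: \<open>r\<close> is an upper bound for
  \<open>(2 / 3) powr (m / n)\<close>, checked through \<open>r ^ n * 1.5 ^ m \<ge> 1\<close>, and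
  \<open>G\<close> is at least \<open>1 / (1 - r)\<close>.\<close>

lemma geometric_factor:
  fixes c G r L :: real
  assumes L: "L = ln (3 / 2)" and c: "real m / real n \<le> c" "n > 0"
    and r: "0 \<le> r" "1 \<le> r ^ n * 1.5 ^ m" and G: "0 \<le> G" "1 \<le> G * (1 - r)"
  shows "1 \<le> G * (1 - exp (- c * L))"
proof -
  have "exp (- c * L) \<le> r"
  proof (rule power_le_imp_le_base)
    have "exp (- c * L) ^ Suc (n - 1) = exp (- (real n * c) * L)"
      using c(2) by (simp add: exp_of_nat_mult[symmetric] mult_ac)
    also have "\<dots> \<le> exp (- real m * L)"
      using c by (simp add: L mult_right_mono field_simps)
    also have "\<dots> = (1 / 1.5) ^ m" by (simp add: L exp_minus exp_of_nat_mult power_one_over inverse_eq_divide power_divide)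
    also have "\<dots> \<le> r ^ n" using r(2) by (simp add: field_simps)
    finally show "exp (- c * L) ^ Suc (n - 1) \<le> r ^ Suc (n - 1)" using c(2) by simp
  qed (rule r)
  then have "G * (1 - r) \<le> G * (1 - exp (- c * L))" using G by (intro mult_left_mono) auto
  then show ?thesis using G by linarith
qed

text \<open>The geometric factor \<open>1 / (1 - exp (- c * L))\<close> is unbounded as
  \<open>c\<close> tends to 0; counting the blocks, each of logarithmic length at least 0.4, gives a
  bound that is uniform in small \<open>c\<close>.\<close>

lemma sum_exp_count:
  fixes c y0 y1 L :: real
  assumes c: "0 \<le> c" and L: "L = ln (3 / 2)" and le: "y1 - y0 \<le> 0.4 * real m"
  shows "(\<Sum>i<nat \<lceil>(y1 - y0) / L\<rceil>. exp (c * (y0 + real i * L))) \<le> real m * exp (c * y1)"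
proof -
  define I where "I = nat \<lceil>(y1 - y0) / L\<rceil>"
  have L0: "L \<ge> 0.4" "L > 0" using ln_three_halves by (auto simp: L)
  have "y1 - y0 \<le> real m * L" using le mult_left_mono[OF L0(1), of "real m"] by linarith
  then have "(y1 - y0) / L \<le> real m" using L0 by (simp add: field_simps)
  then have I: "I \<le> m" unfolding I_def by linarith
  have "(\<Sum>i<I. exp (c * (y0 + real i * L))) \<le> (\<Sum>i<I. exp (c * y1))"
  proof (rule sum_mono)
    fix i assume "i \<in> {..<I}"
    then have "real i < (y1 - y0) / L" unfolding I_def by simp linarith
    then have "y0 + real i * L \<le> y1" using L0 by (simp add: field_simps)
    then show "exp (c * (y0 + real i * L)) \<le> exp (c * y1)" using c by (simp add: mult_left_mono)
  qed
  also have "\<dots> \<le> real m * exp (c * y1)" using I by (simp add: mult_right_mono)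
  finally show ?thesis by (simp add: I_def)
qed

text \<open>Because \<open>d \<le> 2 / 7\<close>, the two decreasing series have rates at least 5/7
  and 12/7, which gives the factors 3.98 and 2. The increasing series is left to the hypothesis on
  \<open>G\<close>, since it depends on the range whether a geometric factor or a count of blocks is
  better.\<close>

lemma range_2:
  fixes x y0 y1 d sg G :: real
  defines "L \<equiv> ln (3 / 2)"
  assumes y: "0 \<le> y0" "y0 \<le> y1" "x \<le> 2 * y0 + 0.8" and sg: "sg \<ge> 0" "1 - sg \<le> d" and d: "d \<le> 2 / 7"
    and G: "(\<Sum>i<nat \<lceil>(y1 - y0) / L\<rceil>. exp (d * (y0 + real i * L))) \<le> G * exp (d * y1)"
  shows "norm (dirichlet_sum sg (exp x) (exp y0) (exp y1))
    \<le> 1.7922 * exp (x / 2 - (1 - d) * y0) + 0.1062 * exp (x - (2 - d) * y0)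
      + 16.98 * G * exp (d * y1 - x / 2) + 11.94 * exp (- (1 - d) * y0)"
proof -
  let ?I = "{..<nat \<lceil>(y1 - y0) / L\<rceil>}"
  have g1: "1 \<le> 3.98 * (1 - exp (- (1 - d) * L))"
    by (rule geometric_factor[of _ 5 7 _ "0.74874"]) (use d in \<open>simp_all add: L_def power_numeral_reduce\<close>)
  have g2: "1 \<le> 2 * (1 - exp (- (2 - d) * L))"
    by (rule geometric_factor[of _ 12 7 _ "0.5"]) (use d in \<open>simp_all add: L_def power_numeral_reduce\<close>)
  have "norm (dirichlet_sum sg (exp x) (exp y0) (exp y1)) \<le> (\<Sum>i\<in>?I.
     0.4503 * exp (x / 2 - (1 - d) * (y0 + real i * L)) + 0.0531 * exp (x - (2 - d) * (y0 + real i * L))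
      + 16.98 * exp (d * (y0 + real i * L) - x / 2) + 3 * exp (- (1 - d) * (y0 + real i * L)))"
    unfolding L_def by (rule range_le_sum_blocks[OF _ y(2)], rule block_test_2) (use y sg in auto)
  also have "\<dots> = (0.4503 * exp (x / 2) + 3) * (\<Sum>i\<in>?I. exp (- (1 - d) * (y0 + real i * L)))
      + 0.0531 * exp x * (\<Sum>i\<in>?I. exp (- (2 - d) * (y0 + real i * L)))
      + 16.98 * exp (- x / 2) * (\<Sum>i\<in>?I. exp (d * (y0 + real i * L)))"
  proof -
    have 1: "exp (x / 2 - (1 - d) * z) = exp (x / 2) * exp (- (1 - d) * z)" for z
      by (simp only: exp_add[symmetric]) (simp add: algebra_simps)
    have 2: "exp (x - (2 - d) * z) = exp x * exp (- (2 - d) * z)" for z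
      by (simp only: exp_add[symmetric]) (simp add: algebra_simps)
    have 3: "exp (d * z - x / 2) = exp (- x / 2) * exp (d * z)" for z
      by (simp only: exp_add[symmetric]) simp
    show ?thesis unfolding 1 2 3 sum.distrib sum_distrib_left[symmetric] distrib_right
      by (simp add: sum_distrib_left mult.assoc)
  qed
  also have "\<dots> \<le> (0.4503 * exp (x / 2) + 3) * (3.98 * exp (- (1 - d) * y0))
      + 0.0531 * exp x * (2 * exp (- (2 - d) * y0)) + 16.98 * exp (- x / 2) * (G * exp (d * y1))"
    using d by (intro add_mono mult_left_mono sum_exp_decreasing[OF _ L_def[THEN meta_eq_to_obj_eq] g1]
        sum_exp_decreasing[OF _ L_def[THEN meta_eq_to_obj_eq] g2] G) (auto intro: add_nonneg_nonneg)
  also have "\<dots> = 0.4503 * 3.98 * (exp (x / 2) * exp (- (1 - d) * y0)) + 0.1062 * (exp x * exp (- (2 - d) * y0))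
      + 16.98 * G * (exp (d * y1) * exp (- x / 2)) + 11.94 * exp (- (1 - d) * y0)"
    by (simp add: algebra_simps)
  also have "\<dots> \<le> 1.7922 * (exp (x / 2) * exp (- (1 - d) * y0)) + 0.1062 * (exp x * exp (- (2 - d) * y0))
      + 16.98 * G * (exp (d * y1) * exp (- x / 2)) + 11.94 * exp (- (1 - d) * y0)"
    by (intro add_mono order.refl mult_right_mono) auto
  also have "\<dots> = 1.7922 * exp (x / 2 - (1 - d) * y0) + 0.1062 * exp (x - (2 - d) * y0)
      + 16.98 * G * exp (d * y1 - x / 2) + 11.94 * exp (- (1 - d) * y0)"
    by (simp only: exp_add[symmetric]) (simp add: algebra_simps)
  finally show ?thesis .
qed

lemma range_3:
  fixes x y0 y1 d sg G G3 :: real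
  defines "L \<equiv> ln (3 / 2)"
  assumes y: "5 \<le> y0" "y0 \<le> y1" and sg: "sg \<ge> 0" "1 - sg \<le> d" and d: "d \<le> 2 / 7"
    and G3: "1 \<le> G3 * (1 - exp (- (1 / 2 - d) * L))"
    and G: "(\<Sum>i<nat \<lceil>(y1 - y0) / L\<rceil>. exp (d * (y0 + real i * L))) \<le> G * exp (d * y1)"
  shows "norm (dirichlet_sum sg (exp x) (exp y0) (exp y1))
    \<le> 1.16 * G3 * exp (x / 6 - (1 / 2 - d) * y0) + 4.29 * G * exp (d * y1 - x / 6)"
proof -
  let ?I = "{..<nat \<lceil>(y1 - y0) / L\<rceil>}"
  have "100 \<le> exp (5 :: real)"
    by (rule le_exp_by_taylor[of 5]) (simp_all add: exp_taylor_def power_numeral_reduce)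
  then have e100: "100 \<le> exp z" if "5 \<le> z" for z :: real using that by (meson exp_le_cancel_iff order.trans)
  have "norm (dirichlet_sum sg (exp x) (exp y0) (exp y1)) \<le> (\<Sum>i\<in>?I.
     1.16 * exp (x / 6 - (1 / 2 - d) * (y0 + real i * L)) + 4.29 * exp (d * (y0 + real i * L) - x / 6))"
    unfolding L_def by (rule range_le_sum_blocks[OF _ y(2)], rule block_test_3) (use y sg e100 in auto)
  also have "\<dots> = 1.16 * exp (x / 6) * (\<Sum>i\<in>?I. exp (- (1 / 2 - d) * (y0 + real i * L)))
      + 4.29 * exp (- x / 6) * (\<Sum>i\<in>?I. exp (d * (y0 + real i * L)))"
  proof -
    have 1: "exp (x / 6 - (1 / 2 - d) * z) = exp (x / 6) * exp (- (1 / 2 - d) * z)" for z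
      by (simp only: exp_add[symmetric]) (simp add: algebra_simps)
    have 3: "exp (d * z - x / 6) = exp (- x / 6) * exp (d * z)" for z
      by (simp only: exp_add[symmetric]) simp
    show ?thesis unfolding 1 3 sum.distrib by (simp add: sum_distrib_left mult.assoc)
  qed
  also have "\<dots> \<le> 1.16 * exp (x / 6) * (G3 * exp (- (1 / 2 - d) * y0)) + 4.29 * exp (- x / 6) * (G * exp (d * y1))"
    using d by (intro add_mono mult_left_mono sum_exp_decreasing[OF _ L_def[THEN meta_eq_to_obj_eq] G3] G) auto
  also have "\<dots> = 1.16 * G3 * (exp (x / 6) * exp (- (1 / 2 - d) * y0)) + 4.29 * G * (exp (d * y1) * exp (- x / 6))"
    by (simp add: algebra_simps)
  also have "\<dots> = 1.16 * G3 * exp (x / 6 - (1 / 2 - d) * y0) + 4.29 * G * exp (d * y1 - x / 6)"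
    by (simp only: exp_add[symmetric]) (simp add: algebra_simps)
  finally show ?thesis .
qed

section \<open>The two ends of the series: trivial bound and tail\<close>

lemma sum_powr_le:
  fixes d v :: real
  assumes d: "0 < d" "d \<le> 1" and v: "1 \<le> v" and m: "real m \<le> v"
  shows "(\<Sum>n=1..m. real n powr (- (1 - d))) \<le> 1 - 1 / d + v powr d / d"
proof -
  \<comment> \<open>The term \<open>n = 1\<close> is kept exact. The negative constant this leaves
    compensates the pole of \<open>v powr d / d\<close> at \<open>d = 0\<close>, so the bound
    remains useful for narrow strips.\<close>
  have "(\<Sum>n=1..m. real n powr (- (1 - d))) \<le> 1 - 1 / d + real m powr d / d" if "m \<ge> 1" for m
    using that
  proof (induction m rule: dec_induct)
    case (step m)
    then obtain y where y: "real m < y" "y < real m + 1" "(real m + 1) powr d - real m powr d = d * y powr (d - 1)"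
      using powr_add_one_diff[of "real m" d] by auto
    have "(real m + 1) powr (- (1 - d)) \<le> y powr (- (1 - d))" using y d by (intro powr_mono2') auto
    also have "\<dots> = ((real m + 1) powr d - real m powr d) / d" using y d by simp
    finally show ?case using step.IH by (simp add: diff_divide_distrib add.commute)
  qed simp
  then have "m \<ge> 1 \<Longrightarrow> ?thesis"
    using m d by (smt (verit) divide_right_mono powr_mono2 of_nat_0_le_iff)
  moreover have "0 \<le> 1 - 1 / d + v powr d / d"
  proof -
    have "1 \<le> v powr d" using v d by (simp add: ge_one_powr_ge_zero)
    then have "1 / d \<le> v powr d / d" using d by (intro divide_right_mono) auto
    then show ?thesis by simp
  qed
  ultimately show ?thesis by (cases "m \<ge> 1") auto
qed

lemma powr_minus_le_of_nat:
  assumes "n \<ge> (1::nat)" "1 - sg \<le> d"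
  shows "real n powr (- sg) \<le> real n powr (- (1 - d))"
  using assms by (intro powr_mono) auto

lemma norm_dirichlet_sum_trivial:
  assumes d: "0 < d" "d \<le> 1" "1 - sg \<le> d" and v: "1 \<le> v"
  shows "norm (dirichlet_sum sg t 0 v) \<le> 1 - 1 / d + v powr d / d"
proof -
  have set: "{n::nat. 0 < real n \<and> real n \<le> v} = {1..nat \<lfloor>v\<rfloor>}" using nat_interval_eq[of 0 v] by simp
  have "norm (dirichlet_sum sg t 0 v) \<le> (\<Sum>n=1..nat \<lfloor>v\<rfloor>. norm (of_nat n powr (- Complex sg t)))"
    unfolding dirichlet_sum_def set by (rule norm_sum)
  also have "\<dots> \<le> (\<Sum>n=1..nat \<lfloor>v\<rfloor>. real n powr (- (1 - d)))"
  proof (rule sum_mono)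
    fix n assume "n \<in> {1..nat \<lfloor>v\<rfloor>}"
    then show "norm (of_nat n powr (- Complex sg t)) \<le> real n powr (- (1 - d))"
      using powr_minus_le_of_nat[OF _ d(3), of n] by (simp add: powr_Complex_eq norm_mult)
  qed
  also have "\<dots> \<le> 1 - 1 / d + v powr d / d" using v d by (intro sum_powr_le) auto
  finally show ?thesis .
qed

text \<open>For \<open>n > exp (- 1.6) * t\<close> the increments of \<open>t * ln n\<close> are
  positive, decreasing and at most \<open>exp 1.6 < 2 * pi\<close>, so one application of
  Kusmin-Landau covers every partial sum. Its bound grows linearly in the end point; partial
  summation turns the growth into the sum of the weights with factor \<open>2 / t\<close>.\<close>

lemma norm_dirichlet_sum_tail:
  fixes t u v d sg :: real
  assumes t: "t \<ge> 29" and u: "u = exp (- 1.6) * t" "u \<le> v" and sg: "sg \<ge> 0" "1 - sg \<le> d" and d: "0 < d" "d \<le> 1"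
  shows "norm (dirichlet_sum sg t u v) \<le> 2.1 * u powr (- (1 - d)) + 2 / t * (1 - 1 / d + v powr d / d)"
proof -
  have e1: "exp (1.6 :: real) \<le> 4.9535"
    by (rule exp_le_by_taylor[of 8]) (simp_all add: exp_taylor_def power_numeral_reduce)
  have e2: "exp (- 1.6 :: real) \<le> 0.2019"
    by (rule exp_le_by_taylor[of 8]) (simp_all add: exp_taylor_def power_numeral_reduce)
  have "0.2 \<le> exp (- 1.6 :: real)"
    by (rule le_exp_by_taylor[of 4]) (simp_all add: exp_taylor_def power_numeral_reduce)
  then have u5: "u \<ge> 0.2 * t" "u \<le> 0.2019 * t" unfolding u using t e2 by (auto intro: mult_right_mono)
  have u1: "u \<ge> 1" using u5 t by simp
  define a b where "a = Suc (nat \<lfloor>u\<rfloor>)" and "b = nat \<lfloor>v\<rfloor>"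
  have set: "{n::nat. u < real n \<and> real n \<le> v} = {a..b}" using u1 unfolding a_def b_def by (intro nat_interval_eq) simp
  have rhs: "2 / t * (\<Sum>n=1..b. real n powr (- (1 - d))) \<le> 2 / t * (1 - 1 / d + v powr d / d)"
    using t u u1 d by (intro mult_left_mono sum_powr_le) (auto simp: b_def)
  show ?thesis
  proof (cases "a \<le> b")
    case False
    have "0 \<le> 2 / t * (\<Sum>n=1..b. real n powr (- (1 - d)))" using t by (intro mult_nonneg_nonneg sum_nonneg) auto
    moreover have "0 \<le> 2.1 * u powr (- (1 - d))" by simp
    ultimately show ?thesis using rhs False unfolding dirichlet_sum_def set by simp
  next
    case True
    have au: "u < real a" "real a \<le> u + 1" using u1 by (auto simp: a_def) linarith+
    define G where "G = (\<lambda>n. t * ln (real (Suc n)) - t * ln (real n))"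
    have G: "G n = t * ln (1 + 1 / real n)" if "n \<ge> 1" for n
    proof -
      have "ln (real (Suc n)) - ln (real n) = ln (real (Suc n) / real n)" using that by (simp add: ln_div)
      also have "real (Suc n) / real n = 1 + 1 / real n" using that by (simp add: field_simps)
      finally show ?thesis by (simp add: G_def right_diff_distrib[symmetric])
    qed
    have a1: "a \<ge> 1" by (simp add: a_def)
    have Ghi: "G a \<le> 4.9535"
    proof -
      have "ln (1 + 1 / real a) \<le> 1 / real a" by (rule ln_add_one_self_le_self) simp
      then have "G a \<le> t * (1 / real a)" unfolding G[OF a1] using t by (intro mult_left_mono) auto
      also have "\<dots> \<le> t / u" using au u1 t by (simp add: frac_le)
      also have "\<dots> = exp 1.6" unfolding u using t by (simp add: exp_minus field_simps)
      finally show ?thesis using e1 by linarith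
    qed
    have Glo: "t / real (Suc n) \<le> G n" if "n \<ge> 1" for n
    proof -
      have "ln (1 / (1 + 1 / real n)) \<le> 1 / (1 + 1 / real n) - 1"
        by (intro ln_le_minus_one) (simp add: add_pos_nonneg)
      then have "1 - 1 / (1 + 1 / real n) \<le> ln (1 + 1 / real n)"
      proof -
        define w where "w = 1 + 1 / real n"
        have "w > 0" unfolding w_def by (simp add: add_pos_nonneg)
        then have "ln (1 / w) = - ln w" by (simp add: ln_div)
        then show ?thesis using \<open>ln (1 / (1 + 1 / real n)) \<le> _\<close> unfolding w_def[symmetric] by linarith
      qed
      moreover have "1 - 1 / (1 + 1 / real n) = 1 / real (Suc n)" using that by (simp add: field_simps)
      ultimately have "t * (1 / real (Suc n)) \<le> t * ln (1 + 1 / real n)" using t by (intro mult_left_mono) auto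
      then show ?thesis using G[OF that] by simp
    qed
    \<comment> \<open>The linear part comes from \<open>G m \<ge> t / (m + 1)\<close>, and 1.51
      exceeds \<open>2 / (2 * pi - exp 1.6)\<close>.\<close>
    define P where "P = (\<lambda>m::nat. 2 * real (Suc m) / t + 1.51)"
    have S: "norm (\<Sum>n=a..m. cis (- (t * ln (real n)))) \<le> P m" if "a \<le> m" for m
    proof -
      have "norm (\<Sum>n=a..m. cis (- (t * ln (real n)))) = norm (\<Sum>n=a..m. cis (t * ln (real n)))"
        using norm_sum_cis_sign[of 1 "\<lambda>n. t * ln (real n)" "{a..m}"] by simp
      also have "\<dots> \<le> 2 / G m + 2 / (2 * pi - G a)"
        unfolding G_def
      proof (rule Kusmin_Landau_antimono[OF that])
        fix n assume n: "a \<le> n" "n < m"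
        have "1 / real (Suc n) \<le> 1 / real n" using n a1 by (intro divide_left_mono) auto
        then have "ln (1 + 1 / real (Suc n)) \<le> ln (1 + 1 / real n)" using n a1 by (subst ln_le_cancel_iff) (auto intro: add_pos_nonneg)
        then have "G (Suc n) \<le> G n" using G[of n] G[of "Suc n"] n a1 t by (simp add: mult_left_mono)
        then show "t * ln (real (Suc (Suc n))) - t * ln (real (Suc n)) \<le> t * ln (real (Suc n)) - t * ln (real n)"
          by (simp add: G_def)
      next
        have "0 < t / real (Suc m)" using t by simp
        then have "0 < G m" using Glo[of m] that a1 by linarith
        then show "0 < t * ln (real (Suc m)) - t * ln (real m)" by (simp add: G_def)
        show "t * ln (real (Suc a)) - t * ln (real a) < 2 * pi" using Ghi pi_approx by (simp add: G_def)
      qed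
      also have "\<dots> \<le> 2 / (t / real (Suc m)) + 2 / (2 * 3.1415 - 4.9535)"
      proof (intro add_mono divide_left_mono)
        have pos: "0 < t / real (Suc m)" using t by simp
        show "t / real (Suc m) \<le> G m" using Glo[of m] that a1 by simp
        then show "0 < G m * (t / real (Suc m))" using pos by (intro mult_pos_pos) auto
        have "3.1415 \<le> pi" using pi_approx by simp
        then show "2 * 3.1415 - 4.9535 \<le> 2 * pi - G a" "0 < (2 * pi - G a) * (2 * 3.1415 - 4.9535)"
          using Ghi by (auto intro!: mult_pos_pos)
      qed auto
      also have "\<dots> \<le> P m" by (simp add: P_def)
      finally show ?thesis .
    qed
    have Pn: "P (Suc n) - P n = 2 / t" for n unfolding P_def by (simp add: add_divide_distrib distrib_left)
    have "dirichlet_sum sg t u v = (\<Sum>n=a..b. of_real (real n powr (- sg)) * cis (- (t * ln (real n))))"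
      unfolding dirichlet_sum_def set by (intro sum.cong refl powr_Complex_eq) (auto simp: a_def)
    also have "norm \<dots> \<le> real a powr (- sg) * P a + (\<Sum>n=a..<b. real (Suc n) powr (- sg) * (P (Suc n) - P n))"
      using sg a1 by (intro norm_sum_by_parts_le[OF True] S powr_mono2') auto
    also have "\<dots> = real a powr (- sg) * P a + 2 / t * (\<Sum>n=a..<b. real (Suc n) powr (- sg))"
      unfolding Pn by (simp add: sum_distrib_left mult.commute)
    also have "\<dots> \<le> u powr (- (1 - d)) * 2.1 + 2 / t * (\<Sum>n=1..b. real n powr (- (1 - d)))"
    proof (intro add_mono mult_mono mult_left_mono)
      have "real a powr (- sg) \<le> real a powr (- (1 - d))" using a1 sg by (intro powr_minus_le_of_nat) auto
      also have "\<dots> \<le> u powr (- (1 - d))" using au u1 d by (intro powr_mono2') auto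
      finally show "real a powr (- sg) \<le> u powr (- (1 - d))" .
      have "2 * real (Suc a) \<le> 2 * (0.2019 * t + 2)" using au u5 by simp
      also have "\<dots> \<le> 0.59 * t" using t by simp
      finally have "2 * real (Suc a) / t \<le> 0.59" using t by (simp add: divide_le_eq)
      then have "2 * real (Suc a) / t + 1.51 \<le> 0.59 + 1.51" by (rule add_right_mono)
      then show "P a \<le> 2.1" unfolding P_def by simp
      have "(\<Sum>n=a..<b. real (Suc n) powr (- sg)) = (\<Sum>n=Suc a..b. real n powr (- sg))"
        using sum.shift_bounds_Suc_ivl[of "\<lambda>n. real n powr (- sg)" a b]
        by (simp only: atLeastLessThanSuc_atLeastAtMost)
      also have "\<dots> \<le> (\<Sum>n=Suc a..b. real n powr (- (1 - d)))"
        using sg by (intro sum_mono powr_minus_le_of_nat) auto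
      also have "\<dots> \<le> (\<Sum>n=1..b. real n powr (- (1 - d)))" by (rule sum_mono2) auto
      finally show "(\<Sum>n=a..<b. real (Suc n) powr (- sg)) \<le> (\<Sum>n=1..b. real n powr (- (1 - d)))" .
    qed (use t in \<open>auto simp: P_def intro!: sum_nonneg\<close>)
    finally show ?thesis using rhs by linarith
  qed
qed

lemma norm_zeta_minus_sum:
  assumes N: "N \<ge> (1::nat)" and t: "t > 0" and sg: "0 < sg" "sg < 1" "1 - sg \<le> d" and d: "0 < d" "d \<le> 2 / 7"
  shows "norm (riemann_zeta (Complex sg t) - (\<Sum>n=1..<N. of_nat n powr (- Complex sg t)))
    \<le> real N powr (- (1 - d)) / 2 + real N powr d / t + (t\<^sup>2 + 2.5) / (8 * (2 - d)) * real N powr (- (2 - d))"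
proof -
  let ?s = "Complex sg t"
  have s: "Re ?s > 0" "?s \<noteq> 1" using sg t by (auto simp: complex_eq_iff)
  define A B C where "A = riemann_zeta ?s - (\<Sum>n=1..<N. of_nat n powr (- ?s))"
    and "B = of_nat N powr (- ?s) / 2" and "C = of_nat N powr (1 - ?s) / (?s - 1)"
  have nN: "norm (of_nat N powr z) = real N powr Re z" for z using N by (subst norm_powr_real_powr) auto
  have 1: "norm (A - B - C) \<le> norm ?s * norm (?s + 1) / (8 * (Re ?s + 1)) * real N powr (- Re ?s - 1)"
    unfolding A_def B_def C_def using s N by (intro zeta_trapezoid) auto
  have "norm ?s * norm (?s + 1) / (8 * (Re ?s + 1)) * real N powr (- Re ?s - 1)
      \<le> (t\<^sup>2 + 2.5) / (8 * (2 - d)) * real N powr (- (2 - d))"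
  proof (intro mult_mono frac_le)
    \<comment> \<open>2.5 is the mean of 1 and 4, so \<open>(1 + t\<^sup>2) * (4 + t\<^sup>2) \<le>
      (t\<^sup>2 + 2.5)\<^sup>2\<close>.\<close>
    have "norm ?s * norm (?s + 1) = sqrt ((sg\<^sup>2 + t\<^sup>2) * ((sg + 1)\<^sup>2 + t\<^sup>2))"
      by (simp add: cmod_def real_sqrt_mult)
    also have "\<dots> \<le> sqrt ((1\<^sup>2 + t\<^sup>2) * (2\<^sup>2 + t\<^sup>2))"
      using sg t by (intro real_sqrt_le_mono mult_mono add_mono power_mono) auto
    also have "\<dots> \<le> sqrt ((t\<^sup>2 + 2.5)\<^sup>2)"
      by (intro real_sqrt_le_mono) (simp add: power2_eq_square algebra_simps)
    also have "\<dots> = t\<^sup>2 + 2.5" by (simp add: add_nonneg_nonneg)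
    finally show "norm ?s * norm (?s + 1) \<le> t\<^sup>2 + 2.5" .
    show "real N powr (- Re ?s - 1) \<le> real N powr (- (2 - d))" using N sg by (intro powr_mono) auto
  qed (use sg d t in \<open>auto intro: add_nonneg_nonneg\<close>)
  with 1 have 1: "norm (A - B - C) \<le> (t\<^sup>2 + 2.5) / (8 * (2 - d)) * real N powr (- (2 - d))" by linarith
  have 2: "norm B \<le> real N powr (- (1 - d)) / 2"
    unfolding B_def using powr_minus_le_of_nat[OF N sg(3)] by (simp add: norm_divide nN)
  have 3: "norm C \<le> real N powr d / t"
  proof -
    have "t \<le> norm (?s - 1)" using abs_Im_le_cmod[of "?s - 1"] t by simp
    moreover have "real N powr (1 - sg) \<le> real N powr d" using N sg by (intro powr_mono) auto
    ultimately show ?thesis unfolding C_def using t by (simp add: norm_divide nN frac_le)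
  qed
  have "norm A = norm ((A - B - C) + B + C)" by simp
  then have "norm A \<le> norm (A - B - C) + norm B + norm C"
    using norm_triangle_ineq[of "A - B - C + B" C] norm_triangle_ineq[of "A - B - C" B] by linarith
  with 1 2 3 show ?thesis unfolding A_def by linarith
qed

text \<open>The series is truncated near \<open>t\<^sup>2\<close>. Then the pole term
  \<open>N powr d / t\<close> and the cost of the Kusmin-Landau tail are both of order
  \<open>t powr (2 * d - 1)\<close>, and the Euler-Maclaurin error of order
  \<open>t\<^sup>2 * N powr (d - 2)\<close> is smaller still.\<close>

lemma norm_zeta_le_dirichlet_sum:
  fixes x d sg :: real
  assumes x: "x \<ge> 3.4" and sg: "0 < sg" "sg < 1" "1 - sg \<le> d" and d: "0 < d" "d \<le> 2 / 7"
  shows "norm (riemann_zeta (Complex sg (exp x))) \<le> norm (dirichlet_sum sg (exp x) 0 (exp (x - 1.6)))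
    + (2.1 * exp (- (1 - d) * (x - 1.6)) + (2 / d + 1.01) * exp (- (1 - 2 * d) * x) + 0.64 * exp (- 2 * (1 - d) * x))"
proof -
  define t where "t = exp x"
  have "29 \<le> exp (3.4 :: real)"
    by (rule le_exp_by_taylor[of 4]) (simp_all add: exp_taylor_def power_numeral_reduce)
  also have "\<dots> \<le> t" using x by (simp add: t_def)
  finally have t: "t \<ge> 29" .
  define N where "N = nat \<lceil>t\<^sup>2\<rceil>"
  have t2: "t\<^sup>2 \<ge> 29\<^sup>2" using t by (intro power_mono) auto
  then have N: "real N \<ge> t\<^sup>2" "real N \<le> t\<^sup>2 + 1" "real N - 1 \<le> t\<^sup>2" "N \<ge> 1" unfolding N_def by (simp_all, linarith+)
  have tp: "(t\<^sup>2) powr r = exp (2 * r * x)" for r by (simp add: t_def powr_def power2_eq_square ln_mult)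
  define u where "u = exp (- 1.6) * t"
  have ueq: "u = exp (x - 1.6)" by (simp add: u_def t_def exp_add[symmetric])
  have uN: "u \<le> real N - 1"
  proof -
    have "u \<le> t" unfolding ueq t_def by simp
    also have "\<dots> \<le> 29 * t - 1" using t by simp
    also have "29 * t - 1 \<le> t\<^sup>2 - 1" using t by (simp add: power2_eq_square mult_right_mono)
    finally show ?thesis using N by linarith
  qed
  have set: "{n::nat. 0 < real n \<and> real n \<le> real N - 1} = {1..<N}" using N(4) by auto
  have "dirichlet_sum sg t 0 (real N - 1) = dirichlet_sum sg t 0 u + dirichlet_sum sg t u (real N - 1)"
    using uN by (intro dirichlet_sum_split) (auto simp: ueq)
  then have "norm (\<Sum>n=1..<N. of_nat n powr (- Complex sg t)) \<le> norm (dirichlet_sum sg t 0 u) + norm (dirichlet_sum sg t u (real N - 1))"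
    unfolding dirichlet_sum_def[of _ _ 0 "real N - 1"] set by (simp add: norm_triangle_ineq)
  moreover have "norm (dirichlet_sum sg t u (real N - 1)) \<le> 2.1 * exp (- (1 - d) * (x - 1.6)) + 2 / d * exp (- (1 - 2 * d) * x)"
  proof -
    have "norm (dirichlet_sum sg t u (real N - 1)) \<le> 2.1 * u powr (- (1 - d)) + 2 / t * (1 - 1 / d + (real N - 1) powr d / d)"
      using t uN sg d by (intro norm_dirichlet_sum_tail) (auto simp: u_def)
    also have "2 / t * (1 - 1 / d + (real N - 1) powr d / d) \<le> 2 / t * (0 + (t\<^sup>2) powr d / d)"
    proof (intro mult_left_mono add_mono divide_right_mono powr_mono2)
      show "1 - 1 / d \<le> 0" using d by (simp add: field_simps)
      show "0 \<le> real N - 1" "real N - 1 \<le> t\<^sup>2" using N by auto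
    qed (use d t in auto)
    also have "2 / t * (0 + (t\<^sup>2) powr d / d) = 2 / d * (exp (2 * d * x) / exp x)"
      unfolding tp by (simp add: t_def)
    also have "exp (2 * d * x) / exp x = exp (- (1 - 2 * d) * x)" by (simp add: exp_diff[symmetric] algebra_simps)
    also have "u powr (- (1 - d)) = exp (- (1 - d) * (x - 1.6))" by (simp add: ueq powr_def)
    finally show ?thesis by simp
  qed
  moreover have "norm (riemann_zeta (Complex sg t) - (\<Sum>n=1..<N. of_nat n powr (- Complex sg t)))
      \<le> 1.01 * exp (- (1 - 2 * d) * x) + 0.64 * exp (- 2 * (1 - d) * x)"
  proof -
    have "norm (riemann_zeta (Complex sg t) - (\<Sum>n=1..<N. of_nat n powr (- Complex sg t)))
      \<le> real N powr (- (1 - d)) / 2 + real N powr d / t + (t\<^sup>2 + 2.5) / (8 * (2 - d)) * real N powr (- (2 - d))"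
      using N t sg d by (intro norm_zeta_minus_sum) auto
    also have "real N powr (- (1 - d)) / 2 \<le> 0.5 * exp (- 2 * (1 - d) * x)"
    proof -
      have "real N powr (- (1 - d)) \<le> (t\<^sup>2) powr (- (1 - d))" using N d t by (intro powr_mono2') auto
      then show ?thesis unfolding tp by simp
    qed
    also have "real N powr d / t \<le> 1.01 * exp (- (1 - 2 * d) * x)"
    proof -
      have "real N \<le> 1.01 * t\<^sup>2" using N t2 by simp
      then have "real N powr d \<le> (1.01 * t\<^sup>2) powr d" using d by (intro powr_mono2) auto
      also have "\<dots> = 1.01 powr d * (t\<^sup>2) powr d" by (rule powr_mult)
      also have "\<dots> \<le> 1.01 powr 1 * exp (2 * d * x)" unfolding tp using d by (intro mult_mono powr_mono) auto
      finally have "real N powr d \<le> 1.01 * exp (2 * d * x)" by simp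
      then have "real N powr d / t \<le> 1.01 * exp (2 * d * x) / exp x" unfolding t_def by (rule divide_right_mono) simp
      also have "\<dots> = 1.01 * (exp (2 * d * x) / exp x)" by simp
      also have "exp (2 * d * x) / exp x = exp (- (1 - 2 * d) * x)" by (simp add: exp_diff[symmetric] algebra_simps)
      finally show ?thesis .
    qed
    also have "(t\<^sup>2 + 2.5) / (8 * (2 - d)) * real N powr (- (2 - d)) \<le> 0.14 * exp (- 2 * (1 - d) * x)"
    proof -
      have "(t\<^sup>2 + 2.5) / (8 * (2 - d)) * real N powr (- (2 - d)) \<le> (1.01 * t\<^sup>2) / 12 * (t\<^sup>2) powr (- (2 - d))"
        using t2 d N t by (intro mult_mono frac_le powr_mono2') auto
      also have "(1.01 * t\<^sup>2) / 12 * (t\<^sup>2) powr (- (2 - d)) = 1.01 / 12 * (t\<^sup>2 * (t\<^sup>2) powr (- (2 - d)))" by simp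
      also have "t\<^sup>2 * (t\<^sup>2) powr (- (2 - d)) = exp (2 * x) * exp (2 * (- (2 - d)) * x)"
        unfolding tp by (simp add: t_def exp_double)
      also have "\<dots> = exp (- 2 * (1 - d) * x)" by (simp add: exp_add[symmetric] algebra_simps)
      also have "1.01 / 12 * exp (- 2 * (1 - d) * x) \<le> 0.14 * exp (- 2 * (1 - d) * x)" by simp
      finally show ?thesis .
    qed
    finally show ?thesis by simp
  qed
  moreover have "norm (riemann_zeta (Complex sg t)) \<le> norm (riemann_zeta (Complex sg t) - (\<Sum>n=1..<N. of_nat n powr (- Complex sg t)))
      + norm (\<Sum>n=1..<N. of_nat n powr (- Complex sg t))"
    using norm_triangle_sub[of "riemann_zeta (Complex sg t)" "\<Sum>n=1..<N. of_nat n powr (- Complex sg t)"] by linarith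
  ultimately show ?thesis unfolding t_def[symmetric] ueq[symmetric]
    by (simp add: distrib_right)
qed

subsection \<open>Bounds by sums of exponentials\<close>

text \<open>Encoding the terms as data lets convexity, monotonicity and the numerical checks be
  proved once for all lists. The offset \<open>c0\<close> stays in the exponent, so that at a
  rational point every exponential has a rational argument.\<close>

definition exp_sum :: "(real \<times> real \<times> real) list \<Rightarrow> real \<Rightarrow> real" where
  "exp_sum cs x = (\<Sum>(C, c, c0)\<leftarrow>cs. C * exp (c * x + c0))"

lemma exp_sum_simps [simp]:
  "exp_sum [] x = 0"
  "exp_sum ((C, c, c0) # cs) x = C * exp (c * x + c0) + exp_sum cs x"
  "exp_sum (cs @ ds) x = exp_sum cs x + exp_sum ds x"
  by (simp_all add: exp_sum_def)

definition exp_shift :: "real \<Rightarrow> (real \<times> real \<times> real) list \<Rightarrow> (real \<times> real \<times> real) list" where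
  "exp_shift l cs = map (\<lambda>(C, c, c0). (C, c - l, c0)) cs"

lemma exp_shift_simps [simp]:
  "exp_shift l [] = []"
  "exp_shift l ((C, c, c0) # cs) = (C, c - l, c0) # exp_shift l cs"
  "exp_shift l (cs @ ds) = exp_shift l cs @ exp_shift l ds"
  by (simp_all add: exp_shift_def)

lemma exp_sum_shift: "exp_sum cs x = exp (l * x) * exp_sum (exp_shift l cs) x"
proof (induction cs)
  case (Cons a cs)
  obtain C c c0 where a: "a = (C, c, c0)" by (cases a)
  have "exp (c * x + c0) = exp (l * x) * exp ((c - l) * x + c0)"
    by (simp add: exp_add[symmetric] algebra_simps)
  then show ?case using Cons by (simp add: a algebra_simps)
qed simp

definition nonneg_coeffs :: "(real \<times> real \<times> real) list \<Rightarrow> bool" where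
  "nonneg_coeffs cs \<longleftrightarrow> (\<forall>(C, c, c0)\<in>set cs. 0 \<le> C)"

lemma nonneg_coeffs_simps [simp]:
  "nonneg_coeffs []"
  "nonneg_coeffs ((C, c, c0) # cs) \<longleftrightarrow> 0 \<le> C \<and> nonneg_coeffs cs"
  "nonneg_coeffs (cs @ ds) \<longleftrightarrow> nonneg_coeffs cs \<and> nonneg_coeffs ds"
  by (auto simp: nonneg_coeffs_def)

lemma exp_sum_convex:
  assumes "nonneg_coeffs cs" "0 \<le> u" "u \<le> 1"
  shows "exp_sum cs ((1 - u) * x0 + u * x1) \<le> (1 - u) * exp_sum cs x0 + u * exp_sum cs x1"
  using assms(1)
proof (induction cs)
  case (Cons a cs)
  obtain C c c0 where a: "a = (C, c, c0)" by (cases a)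
  have "exp ((1 - u) * (c * x0 + c0) + u * (c * x1 + c0)) \<le> (1 - u) * exp (c * x0 + c0) + u * exp (c * x1 + c0)"
    using convex_onD[OF exp_convex, of u "c * x0 + c0" "c * x1 + c0"] assms by simp
  moreover have "(1 - u) * (c * x0 + c0) + u * (c * x1 + c0) = c * ((1 - u) * x0 + u * x1) + c0"
    by (simp add: algebra_simps)
  ultimately have "C * exp (c * ((1 - u) * x0 + u * x1) + c0) \<le> C * ((1 - u) * exp (c * x0 + c0) + u * exp (c * x1 + c0))"
    using Cons.prems by (intro mult_left_mono) (auto simp: a)
  then show ?case using Cons by (simp add: a algebra_simps)
qed simp

text \<open>The left-hand side, divided by \<open>exp (l * x)\<close>, is convex in \<open>x\<close>, so that the bound need only
  be checked at the end points of the interval.\<close>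

lemma le_linear_exp_if_endpoints:
  assumes Z: "Z \<le> K + exp_sum cs x" and K: "K \<le> 0" and cs: "nonneg_coeffs cs"
    and x: "x0 \<le> x" "x \<le> x1" and l: "0 \<le> l" and r: "0 \<le> r" "r \<le> exp (- l * x1)"
    and e0: "K * r + exp_sum (exp_shift l cs) x0 \<le> be * x0"
    and e1: "K * r + exp_sum (exp_shift l cs) x1 \<le> be * x1"
  shows "Z \<le> be * x * exp (l * x)"
proof -
  have cs': "nonneg_coeffs (exp_shift l cs)" using cs by (auto simp: nonneg_coeffs_def exp_shift_def)
  have "K * r + exp_sum (exp_shift l cs) x \<le> be * x"
  proof (cases "x0 = x1")
    case True then show ?thesis using e0 x by simp
  next
    case False
    define u where "u = (x - x0) / (x1 - x0)"
    have u: "0 \<le> u" "u \<le> 1" using x False by (auto simp: u_def divide_simps)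
    have xe: "x = (1 - u) * x0 + u * x1"
    proof -
      have "u * (x1 - x0) = x - x0" using False by (simp add: u_def)
      then show ?thesis by (simp add: algebra_simps)
    qed
    have "exp_sum (exp_shift l cs) x \<le> (1 - u) * exp_sum (exp_shift l cs) x0 + u * exp_sum (exp_shift l cs) x1"
      unfolding xe by (rule exp_sum_convex[OF cs' u])
    also have "\<dots> \<le> (1 - u) * (be * x0 - K * r) + u * (be * x1 - K * r)"
      using u e0 e1 by (intro add_mono mult_left_mono) auto
    also have "\<dots> = be * x - K * r" unfolding xe by (simp add: algebra_simps)
    finally show ?thesis by simp
  qed
  \<comment> \<open>\<open>K \<le> 0\<close> makes this term concave, which would spoil the end
    point argument; it is replaced by the constant \<open>K * r\<close>, an upper bound on the whole
    interval.\<close>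
  moreover have "K * exp (- l * x) \<le> K * r"
  proof (rule mult_left_mono_neg[OF _ K])
    have "- l * x1 \<le> - l * x" using x l by (simp add: mult_left_mono)
    then show "r \<le> exp (- l * x)" using r by (meson exp_le_cancel_iff order.trans)
  qed
  ultimately have "K * exp (- l * x) + exp_sum (exp_shift l cs) x \<le> be * x" by linarith
  then have "exp (l * x) * (K * exp (- l * x) + exp_sum (exp_shift l cs) x) \<le> exp (l * x) * (be * x)"
    by (intro mult_left_mono) auto
  moreover have "exp (l * x) * (K * exp (- l * x) + exp_sum (exp_shift l cs) x) = K + exp_sum cs x"
  proof -
    have "exp (l * x) * exp (- l * x) = 1" by (simp add: exp_add[symmetric])
    then have "exp (l * x) * (K * exp (- l * x)) = K" by (metis mult.commute mult.left_commute mult_1_right)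
    then show ?thesis unfolding exp_sum_shift[of cs x l] by (simp add: distrib_left)
  qed
  moreover have "exp (l * x) * (be * x) = be * x * exp (l * x)" by simp
  ultimately show ?thesis using Z by linarith
qed

text \<open>With \<open>t = exp x\<close>, these lists bound the sum over \<open>n \<le> exp (a x + c)\<close> taken trivially, the part of
  the zeta function beyond \<open>exp (x - 1.6)\<close>, and the ranges starting at \<open>exp (a x + c)\<close> on which the
  tests of orders 2 and 3 are used.\<close>

definition cs_triv :: "real \<Rightarrow> real \<Rightarrow> real \<Rightarrow> (real \<times> real \<times> real) list" where
  "cs_triv d a c = [(1 / d, d * a, d * c)]"

definition cs_tail :: "real \<Rightarrow> (real \<times> real \<times> real) list" where
  "cs_tail d = [(2.1, - (1 - d), (1 - d) * 1.6), (2 / d + 1.01, - (1 - 2 * d), 0), (0.64, - 2 * (1 - d), 0)]"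

definition cs_2 :: "real \<Rightarrow> real \<Rightarrow> real \<Rightarrow> real \<Rightarrow> (real \<times> real \<times> real) list" where
  "cs_2 d a c G = [(1.7922, 1 / 2 - (1 - d) * a, - (1 - d) * c), (0.1062, 1 - (2 - d) * a, - (2 - d) * c),
     (16.98 * G, d - 1 / 2, - 1.6 * d), (11.94, - (1 - d) * a, - (1 - d) * c)]"

definition cs_3 :: "real \<Rightarrow> real \<Rightarrow> real \<Rightarrow> real \<Rightarrow> real \<Rightarrow> real \<Rightarrow> real \<Rightarrow> (real \<times> real \<times> real) list" where
  "cs_3 d a c a' c' G3 G = [(1.16 * G3, 1 / 6 - (1 / 2 - d) * a, - (1 / 2 - d) * c), (4.29 * G, d * a' - 1 / 6, d * c')]"

text \<open>Only \<open>1 - sg \<le> d\<close> is required, so a bound computed for one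
  \<open>d\<close> applies to all narrower strips, hence to all larger \<open>k\<close>. The
  condition on \<open>x\<close> ensures \<open>exp x \<ge> 29\<close>, as the tail estimate
  needs.\<close>

locale zeta_strip =
  fixes sg d x :: real
  assumes x: "x \<ge> 3.4" and sg: "0 < sg" "sg < 1" "1 - sg \<le> d" and d: "0 < d" "d \<le> 2 / 7"
begin

abbreviation "Z \<equiv> norm (riemann_zeta (Complex sg (exp x)))"

lemma trivial_part:
  assumes "0 \<le> a * x + c"
  shows "norm (dirichlet_sum sg (exp x) 0 (exp (a * x + c))) \<le> 1 - 1 / d + exp_sum (cs_triv d a c) x"
proof -
  have "norm (dirichlet_sum sg (exp x) 0 (exp (a * x + c))) \<le> 1 - 1 / d + exp (a * x + c) powr d / d"
    using assms sg d by (intro norm_dirichlet_sum_trivial) auto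
  also have "exp (a * x + c) powr d = exp (d * a * x + d * c)" by (simp add: powr_def algebra_simps)
  finally show ?thesis by (simp add: cs_triv_def)
qed

lemma tail_part: "Z \<le> norm (dirichlet_sum sg (exp x) 0 (exp (1 * x - 1.6))) + exp_sum (cs_tail d) x"
proof -
  have e: "- (1 - d) * (x - 1.6) = - (1 - d) * x + (1 - d) * 1.6" by (simp add: field_simps)
  show ?thesis
    using norm_zeta_le_dirichlet_sum[OF x sg d] unfolding e by (simp add: cs_tail_def)
qed

lemma part_2:
  assumes y: "0 \<le> a * x + c" "a * x + c \<le> x - 1.6" "x \<le> 2 * (a * x + c) + 0.8"
    and G: "1 \<le> G * (1 - exp (- d * ln (3 / 2))) \<or> x - 1.6 - (a * x + c) \<le> 0.4 * real m \<and> G = real m"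
  shows "norm (dirichlet_sum sg (exp x) (exp (a * x + c)) (exp (1 * x - 1.6))) \<le> exp_sum (cs_2 d a c G) x"
proof -
  have "(\<Sum>i<nat \<lceil>(x - 1.6 - (a * x + c)) / ln (3 / 2)\<rceil>. exp (d * (a * x + c + real i * ln (3 / 2)))) \<le> G * exp (d * (x - 1.6))"
    using G
  proof
    assume "1 \<le> G * (1 - exp (- d * ln (3 / 2)))"
    then show ?thesis by (rule sum_exp_increasing[OF d(1) refl])
  next
    assume G: "x - 1.6 - (a * x + c) \<le> 0.4 * real m \<and> G = real m"
    then show ?thesis using sum_exp_count[OF less_imp_le[OF d(1)] refl, of "x - 1.6" "a * x + c" m] by simp
  qed
  from range_2[OF y sg(1)[THEN less_imp_le] sg(3) d(2) this]
  have "norm (dirichlet_sum sg (exp x) (exp (a * x + c)) (exp (x - 1.6)))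
    \<le> 1.7922 * exp (x / 2 - (1 - d) * (a * x + c)) + 0.1062 * exp (x - (2 - d) * (a * x + c))
      + 16.98 * G * exp (d * (x - 1.6) - x / 2) + 11.94 * exp (- (1 - d) * (a * x + c))" .
  also have "x / 2 - (1 - d) * (a * x + c) = (1 / 2 - (1 - d) * a) * x + - (1 - d) * c" by (simp add: algebra_simps)
  also have "x - (2 - d) * (a * x + c) = (1 - (2 - d) * a) * x + - (2 - d) * c" by (simp add: algebra_simps)
  also have "d * (x - 1.6) - x / 2 = (d - 1 / 2) * x + - 1.6 * d" by (simp add: algebra_simps)
  also have "- (1 - d) * (a * x + c) = - (1 - d) * a * x + - (1 - d) * c" by (simp add: algebra_simps)
  finally show ?thesis by (simp add: cs_2_def)
qed

lemma part_3:
  assumes y: "5 \<le> a * x + c" "a * x + c \<le> a' * x + c'"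
    and G3: "1 \<le> G3 * (1 - exp (- (1 / 2 - d) * ln (3 / 2)))"
    and G: "1 \<le> G * (1 - exp (- d * ln (3 / 2))) \<or> a' * x + c' - (a * x + c) \<le> 0.4 * real m \<and> G = real m"
  shows "norm (dirichlet_sum sg (exp x) (exp (a * x + c)) (exp (a' * x + c'))) \<le> exp_sum (cs_3 d a c a' c' G3 G) x"
proof -
  have "(\<Sum>i<nat \<lceil>(a' * x + c' - (a * x + c)) / ln (3 / 2)\<rceil>. exp (d * (a * x + c + real i * ln (3 / 2)))) \<le> G * exp (d * (a' * x + c'))"
    using G
  proof
    assume "1 \<le> G * (1 - exp (- d * ln (3 / 2)))"
    then show ?thesis by (rule sum_exp_increasing[OF d(1) refl])
  next
    assume G: "a' * x + c' - (a * x + c) \<le> 0.4 * real m \<and> G = real m"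
    then show ?thesis using sum_exp_count[OF less_imp_le[OF d(1)] refl, of "a' * x + c'" "a * x + c" m] by simp
  qed
  from range_3[OF y sg(1)[THEN less_imp_le] sg(3) d(2) G3 this]
  have "norm (dirichlet_sum sg (exp x) (exp (a * x + c)) (exp (a' * x + c')))
    \<le> 1.16 * G3 * exp (x / 6 - (1 / 2 - d) * (a * x + c)) + 4.29 * G * exp (d * (a' * x + c') - x / 6)" .
  also have "x / 6 - (1 / 2 - d) * (a * x + c) = (1 / 6 - (1 / 2 - d) * a) * x + - (1 / 2 - d) * c" by (simp add: algebra_simps)
  also have "d * (a' * x + c') - x / 6 = (d * a' - 1 / 6) * x + d * c'" by (simp add: algebra_simps)
  finally show ?thesis by (simp add: cs_3_def)
qed

text \<open>The three regimes differ in the treatment of the part up to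
  \<open>exp (x - 1.6)\<close>: T estimates it trivially, II uses order 2 above a cut
  \<open>exp (a * x + c)\<close>, III inserts a range of order 3 between two cuts.\<close>

lemma regime_T: "Z \<le> 1 - 1 / d + exp_sum (cs_triv d 1 (- 1.6) @ cs_tail d) x"
  using trivial_part[of 1 "- 1.6"] tail_part x by simp

lemma regime_II:
  assumes y: "0 \<le> a * x + c" "a * x + c \<le> x - 1.6" "x \<le> 2 * (a * x + c) + 0.8"
    and G: "1 \<le> G * (1 - exp (- d * ln (3 / 2))) \<or> x - 1.6 - (a * x + c) \<le> 0.4 * real m \<and> G = real m"
  shows "Z \<le> 1 - 1 / d + exp_sum (cs_triv d a c @ cs_2 d a c G @ cs_tail d) x"
proof -
  have "dirichlet_sum sg (exp x) 0 (exp (1 * x - 1.6)) = dirichlet_sum sg (exp x) 0 (exp (a * x + c))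
      + dirichlet_sum sg (exp x) (exp (a * x + c)) (exp (1 * x - 1.6))"
    using y by (intro dirichlet_sum_split) auto
  then show ?thesis
    using trivial_part[OF y(1)] part_2[OF y G] tail_part
      norm_triangle_ineq[of "dirichlet_sum sg (exp x) 0 (exp (a * x + c))" "dirichlet_sum sg (exp x) (exp (a * x + c)) (exp (1 * x - 1.6))"]
    by simp
qed

lemma regime_III:
  assumes y: "5 \<le> a * x + c" "a * x + c \<le> a' * x + c'" "a' * x + c' \<le> x - 1.6" "x \<le> 2 * (a' * x + c') + 0.8"
    and G3: "1 \<le> G3 * (1 - exp (- (1 / 2 - d) * ln (3 / 2)))"
    and G: "1 \<le> G * (1 - exp (- d * ln (3 / 2)))"
  shows "Z \<le> 1 - 1 / d + exp_sum (cs_triv d a c @ cs_3 d a c a' c' G3 G @ cs_2 d a' c' G @ cs_tail d) x"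
proof -
  have "dirichlet_sum sg (exp x) (exp (a * x + c)) (exp (1 * x - 1.6))
     = dirichlet_sum sg (exp x) (exp (a * x + c)) (exp (a' * x + c')) + dirichlet_sum sg (exp x) (exp (a' * x + c')) (exp (1 * x - 1.6))"
    using y by (intro dirichlet_sum_split) auto
  moreover have "dirichlet_sum sg (exp x) 0 (exp (1 * x - 1.6)) = dirichlet_sum sg (exp x) 0 (exp (a * x + c))
      + dirichlet_sum sg (exp x) (exp (a * x + c)) (exp (1 * x - 1.6))"
    using y by (intro dirichlet_sum_split) auto
  ultimately have "dirichlet_sum sg (exp x) 0 (exp (1 * x - 1.6)) = dirichlet_sum sg (exp x) 0 (exp (a * x + c))
      + (dirichlet_sum sg (exp x) (exp (a * x + c)) (exp (a' * x + c')) + dirichlet_sum sg (exp x) (exp (a' * x + c')) (exp (1 * x - 1.6)))"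
    by simp
  then show ?thesis
    using trivial_part[of a c] part_3[OF y(1,2) G3 disjI1[OF G]] part_2[of a' c' G] y G tail_part
      norm_triangle_ineq[of "dirichlet_sum sg (exp x) 0 (exp (a * x + c))" "dirichlet_sum sg (exp x) (exp (a * x + c)) (exp (a' * x + c')) + dirichlet_sum sg (exp x) (exp (a' * x + c')) (exp (1 * x - 1.6))"]
      norm_triangle_ineq[of "dirichlet_sum sg (exp x) (exp (a * x + c)) (exp (a' * x + c'))" "dirichlet_sum sg (exp x) (exp (a' * x + c')) (exp (1 * x - 1.6))"]
    by simp
qed

end

subsection \<open>Large arguments\<close>

text \<open>The distance \<open>1 - zeta_sigma k\<close> of the abscissa from 1.\<close>

definition strip_width :: "nat \<Rightarrow> real" where
  "strip_width k = real k / (2 ^ k - 2)"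

lemma two_power_minus_two_pos: "k \<ge> 2 \<Longrightarrow> (2::real) ^ k - 2 > 0"
  using power_increasing[of 2 k "2::real"] by simp

lemma strip_width_antimono:
  assumes "2 \<le> j" "j \<le> k"
  shows "strip_width k \<le> strip_width j"
  using assms(2)
proof (induction k rule: dec_induct)
  case (step n)
  have n: "n \<ge> 2" using step assms by simp
  define q where "q = (2::real) ^ n"
  have q: "q > 2" using two_power_minus_two_pos[OF n] by (simp add: q_def)
  have "1 * q \<le> real n * q" using q n by (intro mult_right_mono) auto
  moreover have "real (Suc n) * (q - 2) = real n * q + q - 2 * real n - 2" by (simp add: algebra_simps)
  moreover have "real n * (2 * q - 2) = 2 * (real n * q) - 2 * real n" by (simp add: algebra_simps)
  ultimately have "real (Suc n) * (q - 2) \<le> real n * (2 * q - 2)" by linarith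
  then have "strip_width (Suc n) \<le> strip_width n"
    using q by (simp add: strip_width_def q_def[symmetric] divide_simps)
  then show ?case using step by simp
qed simp

lemma strip_width_values:
  "strip_width 4 = 2 / 7" "strip_width 5 = 1 / 6" "strip_width 6 = 3 / 31" "strip_width 7 = 1 / 18"
  by (simp_all add: strip_width_def)

lemma exp_sum_antimono:
  assumes "list_all (\<lambda>(C, c, c0). 0 \<le> C \<and> c \<le> 0) cs" "x0 \<le> x"
  shows "exp_sum cs x \<le> exp_sum cs x0"
  using assms(1)
proof (induction cs)
  case (Cons a cs)
  obtain C c c0 where a: "a = (C, c, c0)" by (cases a)
  have "c * x \<le> c * x0" using Cons.prems assms(2) by (intro mult_left_mono_neg) (auto simp: a)
  then have "C * exp (c * x + c0) \<le> C * exp (c * x0 + c0)"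
    using Cons.prems by (intro mult_left_mono) (auto simp: a)
  then show ?case using Cons by (simp add: a)
qed simp

lemma block_count:
  assumes "y0 \<le> y1"
  shows "real (nat \<lceil>(y1 - y0) / ln (3 / 2)\<rceil>) \<le> 2.47 * (y1 - y0) + 1"
proof -
  have "(y1 - y0) * (1 / ln (3 / 2)) \<le> (y1 - y0) * 2.47"
    using assms ln_three_halves(2) by (intro mult_left_mono) auto
  then have 1: "(y1 - y0) / ln (3 / 2) \<le> 2.47 * (y1 - y0)" by (simp add: mult.commute)
  have "0 \<le> (y1 - y0) / ln (3 / 2)" using assms by simp
  then have "real (nat \<lceil>(y1 - y0) / ln (3 / 2)\<rceil>) \<le> (y1 - y0) / ln (3 / 2) + 1" by linarith
  also have "\<dots> \<le> 2.47 * (y1 - y0) + 1" using 1 by (rule add_right_mono)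
  finally show ?thesis .
qed

text \<open>For ranges where the block bound does not vary geometrically: every block is charged the
  same, at 2.47 blocks per unit of \<open>y\<close>, since
  \<open>1 / ln 1.5 \<le> 2.47\<close>.\<close>

lemma range_count:
  fixes M E :: real
  assumes block: "\<And>y Y. y0 \<le> y \<Longrightarrow> y \<le> y1 \<Longrightarrow> exp y \<le> Y \<Longrightarrow> Y \<le> exp y1 \<Longrightarrow> Y \<le> 1.5 * exp y \<Longrightarrow>
      norm (dirichlet_sum sg t (exp y) Y) \<le> M * E"
    and y: "y0 \<le> y1" and M: "0 \<le> M * E"
  shows "norm (dirichlet_sum sg t (exp y0) (exp y1)) \<le> M * (2.47 * (y1 - y0) + 1) * E"
proof -
  have "norm (dirichlet_sum sg t (exp y0) (exp y1)) \<le> (\<Sum>i<nat \<lceil>(y1 - y0) / ln (3 / 2)\<rceil>. M * E)"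
    by (rule range_le_sum_blocks[OF block y])
  also have "\<dots> = M * E * real (nat \<lceil>(y1 - y0) / ln (3 / 2)\<rceil>)" by simp
  also have "\<dots> \<le> M * E * (2.47 * (y1 - y0) + 1)" by (intro mult_left_mono block_count y M)
  finally show ?thesis by (simp only: mult_ac)
qed

text \<open>At the boundary \<open>y = J x / (J (j - 1) + 1)\<close> between the ranges of the tests of orders
  \<open>j\<close> and \<open>j + 1\<close> the first terms of both tests and the second term of the latter agree.\<close>

lemma exponent_first:
  fixes J r dl x y a :: real
  assumes J: "J \<ge> 2" and r: "r \<ge> 2" and a: "a = 1 / (2 * J - 2)" and dl: "dl \<le> r * a"
    and y: "J / (J * (r - 1) + 1) * x \<le> y"
  shows "dl * y + a * (x - r * y) \<le> (dl * J - 1 / 2) / (J * (r - 1) + 1) * x"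
proof -
  define P where "P = J * (r - 1) + 1"
  have "0 \<le> J * (r - 1)" using J r by (intro mult_nonneg_nonneg) auto
  then have P: "P > 0" unfolding P_def by linarith
  have "(dl - r * a) * y \<le> (dl - r * a) * (J / P * x)"
    using dl y by (intro mult_left_mono_neg) (auto simp: P_def)
  moreover have "(dl - r * a) * (J / P * x) + a * x = (dl * J - 1 / 2) / P * x"
  proof -
    have "a * (2 * J - 2) = 1" using J by (simp add: a)
    then have "a * (P - r * J) = - 1 / 2" by (simp add: P_def algebra_simps)
    then have "a * P = a * r * J - 1 / 2" by (simp add: algebra_simps)
    then have "(dl - r * a) * J + a * P = dl * J - 1 / 2" by (simp add: algebra_simps)
    moreover have "(dl - r * a) * (J / P) + a = ((dl - r * a) * J + a * P) / P" using P by (simp add: add_divide_distrib)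
    ultimately have "(dl - r * a) * (J / P) + a = (dl * J - 1 / 2) / P" by simp
    then have "((dl - r * a) * (J / P) + a) * x = (dl * J - 1 / 2) / P * x" by simp
    then show ?thesis by (simp only: distrib_right mult.assoc)
  qed
  ultimately show ?thesis unfolding P_def[symmetric] by (simp add: algebra_simps)
qed

lemma exponent_second:
  fixes J r dl x y a :: real
  assumes J: "J \<ge> 4" and r: "r \<ge> 3" and a: "a = 1 / (2 * J - 2)" and dl: "0 \<le> dl - 2 / J + r * a"
    and y: "y \<le> J / (J * (r - 2) + 2) * x"
  shows "(dl - 2 / J) * y - a * (x - r * y) \<le> (dl * (J / 2) - 1 / 2) / (J / 2 * (r - 2) + 1) * x"
proof -
  define P where "P = J * (r - 2) + 2"
  have "0 \<le> J * (r - 2)" using J r by (intro mult_nonneg_nonneg) auto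
  then have P: "P > 0" unfolding P_def by linarith
  have "(dl - 2 / J + r * a) * y \<le> (dl - 2 / J + r * a) * (J / P * x)"
    using dl y by (intro mult_left_mono) (auto simp: P_def)
  moreover have "(dl - 2 / J + r * a) * (J / P * x) - a * x = (dl * J - 1) / P * x"
  proof -
    have "a * (2 * J - 2) = 1" using J by (simp add: a)
    then have "a * (r * J - P) = 1" by (simp add: P_def algebra_simps)
    then have "(dl - 2 / J + r * a) * J - a * P = dl * J - 1" using J by (simp add: algebra_simps)
    moreover have "(dl - 2 / J + r * a) * (J / P) - a = ((dl - 2 / J + r * a) * J - a * P) / P"
      using P by (simp add: diff_divide_distrib)
    ultimately have "(dl - 2 / J + r * a) * (J / P) - a = (dl * J - 1) / P" by simp
    then have "((dl - 2 / J + r * a) * (J / P) - a) * x = (dl * J - 1) / P * x" by simp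
    then show ?thesis by (simp only: left_diff_distrib mult.assoc)
  qed
  moreover have e: "(dl * (J / 2) - 1 / 2) / (J / 2 * (r - 2) + 1) = (dl * J - 1) / P"
  proof -
    have ee: "dl * (J / 2) - 1 / 2 = (dl * J - 1) / 2" "J / 2 * (r - 2) + 1 = P / 2" by (simp_all add: P_def field_simps)
    show ?thesis unfolding ee using P by (simp add: divide_simps)
  qed
  moreover have "(dl - 2 / J) * y - a * (x - r * y) = (dl - 2 / J + r * a) * y - a * x" by (simp add: algebra_simps)
  ultimately show ?thesis unfolding e by linarith
qed

text \<open>Measures how far the exponent at a boundary between two orders lies below the target
  \<open>tau = x / (2 * K - 2)\<close> when \<open>dl = kk / (2 * K - 2)\<close>. The sign of the
  loss is that of \<open>K - J * (kk - r + 1)\<close>.\<close>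

lemma exponent_excess:
  fixes J K x kk r :: real
  assumes K: "K \<ge> 2" and P: "J * (r - 1) + 1 > 0"
  shows "(kk / (2 * K - 2) * J - 1 / 2) / (J * (r - 1) + 1) * x
    = x / (2 * K - 2) - x / (2 * K - 2) * (K - J * (kk - r + 1)) / (J * (r - 1) + 1)"
proof -
  have "(kk / (2 * K - 2) * J - 1 / 2) * (2 * K - 2) = (J * (r - 1) + 1) - (K - J * (kk - r + 1))"
    using K by (simp add: field_simps)
  then have "kk / (2 * K - 2) * J - 1 / 2 = ((J * (r - 1) + 1) - (K - J * (kk - r + 1))) / (2 * K - 2)"
    using K by (simp add: eq_divide_eq)
  moreover have "((P - W) / D) / P * x = x / D - x / D * W / P" if "P > 0" for P W D :: real
    using that by (simp add: field_simps diff_divide_distrib)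
  ultimately show ?thesis using P by presburger
qed

lemma Suc_le_two_power: "real (Suc n) \<le> 2 ^ n"
  by (induction n) auto

context
  fixes k :: nat and x dl K tau :: real
  assumes k: "k \<ge> 5" and x: "x > 0"
  defines "K \<equiv> 2 ^ (k - 1)" and "dl \<equiv> strip_width k" and "tau \<equiv> x / (2 ^ k - 2)"
begin

lemma K: "K \<ge> 16" "(2::real) ^ k = 2 * K" "dl = real k / (2 * K - 2)" "tau = x / (2 * K - 2)" "tau > 0" "dl > 0" "dl * x = real k * tau"
proof -
  show K: "K \<ge> 16" using power_increasing[of 4 "k - 1" "2::real"] k by (simp add: K_def)
  show K2: "(2::real) ^ k = 2 * K" using k by (simp add: K_def power_eq_if)
  show "dl = real k / (2 * K - 2)" "tau = x / (2 * K - 2)" by (simp_all add: dl_def strip_width_def tau_def K2)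
  then show "tau > 0" "dl > 0" "dl * x = real k * tau" using K x k by simp_all
qed

lemma exponent_eq:
  assumes j: "2 \<le> j"
  shows "(dl * 2 ^ (j - 1) - 1 / 2) / (2 ^ (j - 1) * (real j - 1) + 1) * x
    = tau - tau * (K - 2 ^ (j - 1) * (real k - real j + 1)) / (2 ^ (j - 1) * (real j - 1) + 1)"
proof -
  have "(0::real) \<le> 2 ^ (j - 1) * (real j - 1)" using j by simp
  then show ?thesis unfolding K(3,4) using K(1) by (intro exponent_excess) auto
qed

text \<open>With \<open>K = 2 ^ (k - 1)\<close> and \<open>J = 2 ^ (j - 1)\<close> the loss is
  nonnegative because \<open>k - j + 1 \<le> 2 ^ (k - j)\<close>. Equality holds for
  \<open>j = k\<close> and \<open>j = k - 1\<close>, the critical orders.\<close>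

lemma exponent_le_tau:
  assumes j: "2 \<le> j" "j \<le> k"
  shows "(dl * 2 ^ (j - 1) - 1 / 2) / (2 ^ (j - 1) * (real j - 1) + 1) * x \<le> tau"
proof -
  have "2 ^ (j - 1) * real (Suc (k - j)) \<le> 2 ^ (j - 1) * 2 ^ (k - j)"
    by (intro mult_left_mono Suc_le_two_power) simp
  also have "\<dots> = K" using j by (simp add: K_def power_add[symmetric])
  finally have "0 \<le> K - 2 ^ (j - 1) * real (Suc (k - j))" by simp
  moreover have "real (Suc (k - j)) = real k - real j + 1" using j by (simp add: of_nat_diff)
  ultimately have "0 \<le> K - 2 ^ (j - 1) * (real k - real j + 1)" by (simp only:)
  moreover have "(0::real) \<le> 2 ^ (j - 1) * (real j - 1) + 1" using j by simp
  ultimately show ?thesis unfolding exponent_eq[OF j(1)] using K(5) by simp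
qed

text \<open>Both exponents are linear in \<open>y\<close>. The first does not increase, as
  \<open>dl \<le> j * a\<close>, so it is largest at the lower boundary of the range of order
  \<open>j\<close>; the second does not decrease and is largest at the upper one. For
  \<open>j = k\<close> the first is constantly \<open>tau\<close>, so \<open>lo\<close> then places
  no condition on \<open>y\<close>.\<close>

lemma block_bound:
  assumes j: "5 \<le> j" "j \<le> k" and y: "exp y \<ge> 100" "Y \<le> 1.5 * exp y"
    and lo: "j = k \<and> q = tau \<or> 2 ^ (j - 1) / (2 ^ (j - 1) * (real j - 1) + 1) * x \<le> y
        \<and> q = (dl * 2 ^ (j - 1) - 1 / 2) / (2 ^ (j - 1) * (real j - 1) + 1) * x"
    and hi: "y \<le> 2 ^ (j - 2) / (2 ^ (j - 2) * (real (j - 1) - 1) + 1) * x"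
  shows "norm (dirichlet_sum (1 - dl) (exp x) (exp y) Y)
    \<le> 0.95 * exp q + 1.2 * exp ((dl * 2 ^ (j - 2) - 1 / 2) / (2 ^ (j - 2) * (real (j - 1) - 1) + 1) * x)"
proof -
  define J :: real where "J = 2 ^ (j - 1)"
  define a where "a = 1 / (2 * J - 2)"
  have J: "J \<ge> 16" "(2::real) ^ j = 2 * J" "(2::real) ^ (j - 2) = J / 2" using j power_increasing[of 4 "j - 1" "2::real"]
    by (auto simp: J_def power_eq_if numeral_2_eq_2)
  have dja: "dl \<le> real j * a"
    using strip_width_antimono[of j k] j by (simp add: dl_def a_def strip_width_def J(2))
  have d1: "1 - (1 - dl) \<le> dl" by simp
  have dl1: "dl \<le> 1" using strip_width_antimono[of 5 k] k strip_width_values by (simp add: dl_def)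
  have A: "dl * y + a * (x - real j * y) \<le> q"
    using lo
  proof
    assume "j = k \<and> q = tau"
    then have e: "dl = real j * a" "q = a * x" using K(3,4) by (auto simp: a_def J_def K_def)
    show ?thesis unfolding e by (simp add: algebra_simps)
  next
    assume "2 ^ (j - 1) / (2 ^ (j - 1) * (real j - 1) + 1) * x \<le> y
        \<and> q = (dl * 2 ^ (j - 1) - 1 / 2) / (2 ^ (j - 1) * (real j - 1) + 1) * x"
    then show ?thesis unfolding J_def[symmetric]
      using exponent_first[of J "real j" a dl x y] J j a_def dja by auto
  qed
  have B: "(dl - 2 / J) * y - a * (x - real j * y) \<le> (dl * (J / 2) - 1 / 2) / (J / 2 * (real j - 2) + 1) * x"
  proof (rule exponent_second)
    have "2 / J \<le> real j * a"
    proof -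
      have "2 * (2 * J - 2) \<le> 5 * J" using J by simp
      also have "\<dots> \<le> real j * J" using j J by (intro mult_right_mono) auto
      finally show ?thesis using J by (simp add: a_def field_simps)
    qed
    then show "0 \<le> dl - 2 / J + real j * a" using K(6) by simp
    have "J / 2 * (real (j - 1) - 1) + 1 = (J * (real j - 2) + 2) / 2" using j by (simp add: of_nat_diff field_simps)
    then have "J / 2 / (J / 2 * (real (j - 1) - 1) + 1) = J / (J * (real j - 2) + 2)" by simp
    then show "y \<le> J / (J * (real j - 2) + 2) * x" using hi unfolding J(3) by (simp only:)
  qed (use J j a_def in auto)
  have "norm (dirichlet_sum (1 - dl) (exp x) (exp y) Y)
    \<le> 0.95 * exp (dl * y + a * (x - real j * y)) + 1.2 * exp ((dl - 2 / J) * y - a * (x - real j * y))"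
    using block_test_ge_5[OF j(1) y, of "1 - dl" dl x] dl1 unfolding J(2) a_def J_def[symmetric] by simp
  also have "\<dots> \<le> 0.95 * exp q + 1.2 * exp ((dl * (J / 2) - 1 / 2) / (J / 2 * (real j - 2) + 1) * x)"
    using A B by (intro add_mono mult_left_mono) auto
  finally show ?thesis unfolding J(3) using j by (simp add: of_nat_diff)
qed

text \<open>The order is the least \<open>j \<ge> 5\<close> whose lower boundary is at or below
  \<open>y\<close>, or \<open>k\<close> if there is none below \<open>k\<close>. Minimality supplies
  the upper boundary, except at \<open>j = 5\<close>, where 8/25 is the boundary between orders 4
  and 5. The constant is 0.95 + 1.2.\<close>

lemma block_bound_tau:
  assumes y: "exp y \<ge> 100" "Y \<le> 1.5 * exp y" and y25: "y \<le> 8 / 25 * x"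
  shows "norm (dirichlet_sum (1 - dl) (exp x) (exp y) Y) \<le> 2.15 * exp tau"
proof -
  define p where "p = (\<lambda>j. 5 \<le> j \<and> (j = k \<or> 2 ^ (j - 1) / (2 ^ (j - 1) * (real j - 1) + 1) * x \<le> y))"
  define j where "j = (LEAST j. p j)"
  have pk: "p k" using k by (simp add: p_def)
  have pj: "p j" unfolding j_def by (rule LeastI[of p, OF pk])
  have jk: "j \<le> k" unfolding j_def by (rule Least_le[of p, OF pk])
  have j5: "5 \<le> j" using pj by (simp add: p_def)
  have hi: "y \<le> 2 ^ (j - 2) / (2 ^ (j - 2) * (real (j - 1) - 1) + 1) * x"
  proof (cases "j = 5")
    case True then show ?thesis using y25 by simp
  next
    case False
    have "\<not> p (j - 1)" using not_less_Least[of "j - 1" p] j5 unfolding j_def[symmetric] by simp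
    moreover have "j - 1 - 1 = j - 2" by simp
    ultimately show ?thesis using False j5 unfolding p_def by auto
  qed
  define q where "q = (if j = k then tau else (dl * 2 ^ (j - 1) - 1 / 2) / (2 ^ (j - 1) * (real j - 1) + 1) * x)"
  have q: "q \<le> tau" using exponent_le_tau[of j] j5 jk by (simp add: q_def)
  have "norm (dirichlet_sum (1 - dl) (exp x) (exp y) Y)
    \<le> 0.95 * exp q + 1.2 * exp ((dl * 2 ^ (j - 2) - 1 / 2) / (2 ^ (j - 2) * (real (j - 1) - 1) + 1) * x)"
    using j5 jk y hi pj by (intro block_bound) (auto simp: q_def p_def)
  also have "\<dots> \<le> 0.95 * exp tau + 1.2 * exp tau"
  proof -
    have "j - 1 - 1 = j - 2" by simp
    then have "exp ((dl * 2 ^ (j - 2) - 1 / 2) / (2 ^ (j - 2) * (real (j - 1) - 1) + 1) * x) \<le> exp tau"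
      using exponent_le_tau[of "j - 1"] j5 jk unfolding exp_le_cancel_iff by simp
    moreover have "exp q \<le> exp tau" using q by simp
    ultimately show ?thesis by (intro add_mono mult_left_mono) auto
  qed
  finally show ?thesis by simp
qed

end

section \<open>Certified evaluation of sums of exponentials\<close>

lemma exp_taylor_horner: "exp_taylor u = 1 + u * (1 + u / 2 * (1 + u / 3 * (1 + u / 4 * (1 + u / 5))))"
  by (simp add: exp_taylor_def power2_eq_square power3_eq_cube power4_eq_xxxx eval_nat_numeral field_simps)

text \<open>\<open>exp_chain q [w\<^sub>0, \<dots>, w\<^sub>n]\<close> certifies \<open>exp q \<le> w\<^sub>0\<close> by repeated squaring, starting from a bound
  \<open>exp (q / 2 ^ n) \<le> w\<^sub>n\<close> that a Taylor polynomial of \<open>exp (- q / 2 ^ n)\<close> provides.\<close>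

fun exp_chain :: "real \<Rightarrow> real list \<Rightarrow> bool" where
  "exp_chain q [] = False"
| "exp_chain q [w] = (0 \<le> w \<and> 1 \<le> w * (1 + - q * (1 + - q / 2 * (1 + - q / 3 * (1 + - q / 4 * (1 + - q / 5))))))"
| "exp_chain q (w # v # ws) = (v * v \<le> w \<and> exp_chain (q / 2) (v # ws))"

lemma exp_le_chain: "exp_chain q (w # ws) \<Longrightarrow> exp q \<le> w"
proof (induction ws arbitrary: q w)
  case Nil
  then have "1 \<le> w * exp_taylor (- q)" by (simp add: exp_taylor_horner)
  also have "\<dots> \<le> w * exp (- q)" using Nil by (intro mult_left_mono exp_taylor_le) auto
  finally show ?case by (simp add: exp_minus field_simps)
next
  case (Cons v ws)
  then have IH: "exp (q / 2) \<le> v" by simp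
  have "exp q = exp (q / 2) * exp (q / 2)" by (simp add: exp_add[symmetric])
  also have "\<dots> \<le> v * v" using IH by (intro mult_mono) (auto intro: order.trans[OF _ IH])
  finally show ?case using Cons.prems by simp
qed

lemma exp_le_millionth: "q \<le> - 14 \<Longrightarrow> exp q \<le> (1 / 1000000 :: real)"
proof -
  assume "q \<le> - 14"
  then have "exp q \<le> exp (- 14)" by simp
  also have "exp (- 14 :: real) \<le> 1 / 1000000"
    by (rule exp_le_chain[of _ _ "[9151 / 10000000, 121 / 4000, 1739 / 10000, 4169 / 10000, 645653 / 1000000]"]) simp
  finally show ?thesis .
qed

text \<open>An empty chain stands for the bound \<open>exp q \<le> 1 / 1000000\<close>.\<close>

fun exp_sum_chains :: "(real \<times> real \<times> real) list \<Rightarrow> real \<Rightarrow> real list list \<Rightarrow> real \<Rightarrow> bool" where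
  "exp_sum_chains [] x wss s = (0 \<le> s)"
| "exp_sum_chains ((C, c, c0) # cs) x [] s = False"
| "exp_sum_chains ((C, c, c0) # cs) x ([] # wss) s =
    (0 \<le> C \<and> c * x + c0 \<le> - 14 \<and> exp_sum_chains cs x wss (s - C * (1 / 1000000)))"
| "exp_sum_chains ((C, c, c0) # cs) x ((w # ws) # wss) s =
    (0 \<le> C \<and> exp_chain (c * x + c0) (w # ws) \<and> exp_sum_chains cs x wss (s - C * w))"

lemma exp_sum_le_chains: "exp_sum_chains cs x wss s \<Longrightarrow> exp_sum cs x \<le> s"
proof (induction cs x wss s rule: exp_sum_chains.induct)
  case (3 C c c0 cs x wss s)
  then have "C * exp (c * x + c0) \<le> C * (1 / 1000000)" by (intro mult_left_mono exp_le_millionth) auto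
  moreover have "exp_sum cs x \<le> s - C * (1 / 1000000)" using 3 by simp
  ultimately show ?case by simp
next
  case (4 C c c0 cs x w ws wss s)
  then have "C * exp (c * x + c0) \<le> C * w" by (intro mult_left_mono exp_le_chain) auto
  moreover have "exp_sum cs x \<le> s - C * w" using 4 by simp
  ultimately show ?case by simp
qed simp_all

text \<open>The end point criterion with every exponential replaced by a certificate, so that its
  premises are rational arithmetic. The chain for \<open>exp (l * x1)\<close> is what certifies the
  lower bound \<open>r\<close> for \<open>exp (- l * x1)\<close>.\<close>

lemma le_linear_exp_if_chains:
  assumes Z: "Z \<le> K + exp_sum cs x" and K: "K \<le> 0" and cs: "nonneg_coeffs cs"
    and x: "x0 \<le> x" "x \<le> x1" and l: "0 \<le> l"
    and r: "exp_chain (l * x1) (w # ws)" "0 \<le> r" "r * w \<le> 1"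
    and e0: "exp_sum_chains (exp_shift l cs) x0 wss0 (be * x0 - K * r)"
    and e1: "exp_sum_chains (exp_shift l cs) x1 wss1 (be * x1 - K * r)"
  shows "Z \<le> be * x * exp (l * x)"
proof (rule le_linear_exp_if_endpoints[OF Z K cs x l r(2)])
  have "r * exp (l * x1) \<le> r * w" using r by (intro mult_left_mono exp_le_chain) auto
  then show "r \<le> exp (- l * x1)" using r(3) by (simp add: exp_minus field_simps)
  show "K * r + exp_sum (exp_shift l cs) x0 \<le> be * x0" using exp_sum_le_chains[OF e0] by linarith
  show "K * r + exp_sum (exp_shift l cs) x1 \<le> be * x1" using exp_sum_le_chains[OF e1] by linarith
qed

text \<open>Here and below, the rate \<open>d\<close> belongs to the increasing series of orders 2
  and 3, the rate \<open>1 / 2 - d\<close> to the decreasing series of order 3. The values of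
  \<open>d\<close> are the widths 2/7, 1/6, 3/31 and 1/18 for \<open>k\<close> from 4 to 7, whose
  denominators give the names.\<close>

lemma geometric_factors_7:
  "1 \<le> 183 / 20 * (1 - exp (- (2 / 7) * ln (3 / 2 :: real)))"
  "1 \<le> 301 / 25 * (1 - exp (- (1 / 2 - 2 / 7) * ln (3 / 2 :: real)))"
  by (rule geometric_factor[of _ 2 7 _ "0.8907"]; simp add: power_divide)
     (rule geometric_factor[of _ 3 14 _ "0.9169"]; simp add: power_divide)

lemma geometric_factors_6:
  "1 \<le> 1531 / 100 * (1 - exp (- (1 / 6) * ln (3 / 2 :: real)))"
  "1 \<le> 198 / 25 * (1 - exp (- (1 / 2 - 1 / 6) * ln (3 / 2 :: real)))"
  by (rule geometric_factor[of _ 1 6 _ "0.93467"]; simp add: power_divide)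
     (rule geometric_factor[of _ 1 3 _ "0.8736"]; simp add: power_divide)

lemma geometric_factors_31:
  "1 \<le> 26 * (1 - exp (- (3 / 31) * ln (3 / 2 :: real)))"
  "1 \<le> 166 / 25 * (1 - exp (- (1 / 2 - 3 / 31) * ln (3 / 2 :: real)))"
  by (rule geometric_factor[of _ 3 31 _ "0.96153"]; simp add: power_divide)
     (rule geometric_factor[of _ 25 62 _ "0.8492"]; simp add: power_divide)

lemma geometric_factors_18:
  "1 \<le> 45 * (1 - exp (- (1 / 18) * ln (3 / 2 :: real)))"
  "1 \<le> 607 / 100 * (1 - exp (- (1 / 2 - 1 / 18) * ln (3 / 2 :: real)))"
  by (rule geometric_factor[of _ 1 18 _ "0.97774"]; simp add: power_divide)
     (rule geometric_factor[of _ 4 9 _ "0.8351"]; simp add: power_divide)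

lemma hundred_le_exp: "5 \<le> z \<Longrightarrow> 100 \<le> exp (z :: real)"
proof -
  assume "5 \<le> z"
  then have "exp 5 \<le> exp z" by simp
  moreover have "100 \<le> exp (5 :: real)"
    by (rule le_exp_by_taylor[of 5]) (simp_all add: exp_taylor_def power_numeral_reduce)
  ultimately show ?thesis by linarith
qed

lemma times_exp_minus_le:
  fixes u :: real
  assumes "0 < u"
  shows "u * exp (- u) \<le> 6 / u\<^sup>2"
proof -
  have "u ^ 3 / 6 \<le> exp_taylor u" using assms by (simp add: exp_taylor_def)
  also have "\<dots> \<le> exp u" by (rule exp_taylor_le)
  finally have "u ^ 3 * exp (- u) \<le> 6" by (simp add: exp_minus field_simps)
  then show ?thesis using assms by (simp add: field_simps power2_eq_square power3_eq_cube)
qed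

lemma norm_dirichlet_sum_split:
  "u \<le> v \<Longrightarrow> v \<le> w \<Longrightarrow>
    norm (dirichlet_sum sg t u w) \<le> norm (dirichlet_sum sg t u v) + norm (dirichlet_sum sg t v w)"
  using dirichlet_sum_split[of u v w sg t] norm_triangle_ineq by metis

section \<open>Assembling the ranges for large arguments\<close>

context zeta_strip
begin

text \<open>At \<open>d = 1 / 6\<close> the cut \<open>3 / 5 * x\<close> makes the first exponent of
  the order 2 list vanish and leaves all the others negative. The sum is therefore nonincreasing in
  \<open>x\<close>, and a single evaluation at 90 suffices.\<close>

lemma zeta_le_low_sum:
  assumes dd: "d = 1 / 6" and xx: "90 \<le> x"
  shows "Z \<le> norm (dirichlet_sum sg (exp x) 0 (exp (3 / 5 * x))) + 2"
proof -
  have "norm (dirichlet_sum sg (exp x) (exp (3 / 5 * x)) (exp (1 * x - 1.6))) + exp_sum (cs_tail (1 / 6)) x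
      \<le> exp_sum (cs_2 (1 / 6) (3 / 5) 0 (1531 / 100) @ cs_tail (1 / 6)) x"
    using part_2[of "3 / 5" 0 "1531 / 100"] xx geometric_factors_6(1) unfolding dd by simp
  also have "\<dots> \<le> exp_sum (cs_2 (1 / 6) (3 / 5) 0 (1531 / 100) @ cs_tail (1 / 6)) 90"
    by (rule exp_sum_antimono) (use xx in \<open>simp_all add: cs_2_def cs_tail_def\<close>)
  also have "\<dots> \<le> 2" by (rule exp_sum_le_chains[of _ _ "[[1], [2 / 15625, 113 / 10000, 53 / 500, 13 / 40, 57 / 100, 15097 / 20000], [], [], [], [], []]"]) (simp add: cs_2_def cs_tail_def)
  finally have "norm (dirichlet_sum sg (exp x) (exp (3 / 5 * x)) (exp (1 * x - 1.6))) + exp_sum (cs_tail d) x \<le> 2"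
    unfolding dd .
  then show ?thesis
    using tail_part norm_dirichlet_sum_split[of 0 "exp (3 / 5 * x)" "exp (1 * x - 1.6)" sg "exp x"] xx by simp
qed

end

context
  fixes k :: nat and x dl K tau :: real
  assumes k: "k \<ge> 5" and x: "x \<ge> 90"
  defines "K \<equiv> 2 ^ (k - 1)" and "dl \<equiv> strip_width k" and "tau \<equiv> x / (2 ^ k - 2)"
begin

lemma x_pos: "x > 0" using x by simp

lemma dl_bounds: "0 < dl" "dl \<le> 1 / 6" "dl * x = real k * tau" "tau > 0"
proof -
  show "dl \<le> 1 / 6" using strip_width_antimono[of 5 k] k strip_width_values(2) by (simp add: dl_def)
  show "0 < dl" "dl * x = real k * tau" "tau > 0" using K[OF k x_pos] by (simp_all add: dl_def tau_def)
qed

lemma strip_low: "zeta_strip (1 - dl) (1 / 6) x"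
  using dl_bounds x by unfold_locales auto

lemma strip_dl: "zeta_strip (1 - dl) dl x"
  using dl_bounds x by unfold_locales auto

text \<open>The trivial bound is \<open>1 + (exp tau - 1) / dl\<close> since
  \<open>dl * (x / k) = tau\<close>. With \<open>exp tau - 1 \<le> tau * exp tau\<close> the
  denominator \<open>dl\<close> cancels and only \<open>x / k\<close> remains.\<close>

lemma first_range_bound:
  "norm (dirichlet_sum (1 - dl) (exp x) 0 (exp (x / k))) \<le> (1 + x / k) * exp tau"
proof -
  have "norm (dirichlet_sum (1 - dl) (exp x) 0 (exp (x / k))) \<le> 1 - 1 / dl + exp (x / k) powr dl / dl"
    using dl_bounds x by (intro norm_dirichlet_sum_trivial) auto
  also have "exp (x / k) powr dl = exp tau"
  proof -
    have "dl * (x / k) = tau" using dl_bounds(3) k by (simp add: field_simps)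
    then show ?thesis by (simp add: powr_def mult.commute)
  qed
  also have "1 - 1 / dl + exp tau / dl = 1 + (exp tau - 1) / dl" by (simp add: diff_divide_distrib)
  also have "(exp tau - 1) / dl \<le> (tau * exp tau) / dl"
  proof (rule divide_right_mono)
    have "(1 + - tau) * exp tau \<le> exp (- tau) * exp tau" by (intro mult_right_mono exp_ge_add_one_self) auto
    then show "exp tau - 1 \<le> tau * exp tau" by (simp add: exp_minus algebra_simps)
  qed (use dl_bounds in simp)
  also have "tau * exp tau / dl = x / k * exp tau" using dl_bounds k by (simp add: field_simps)
  also have "1 \<le> exp tau" using dl_bounds by simp
  finally show ?thesis by (simp add: algebra_simps)
qed

context
  fixes p3 p4 :: real
  assumes p4: "exp (- (tau * (K - 8 * (real k - 3)) / 25)) \<le> p4"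
    and p3: "exp (- (tau * (K - 4 * (real k - 2)) / 9)) \<le> p3"
begin

text \<open>8/25 and 4/9 are the boundaries between orders 4 and 5 and between orders 3 and 4;
  \<open>p4\<close> and \<open>p3\<close> record the decay relative to \<open>exp tau\<close> that
  the loss in the exponent produces there.\<close>

lemma exp_boundary:
  "exp ((dl * 8 - 1 / 2) / 25 * x) \<le> p4 * exp tau" "exp ((dl * 4 - 1 / 2) / 9 * x) \<le> p3 * exp tau"
proof -
  have e: "exp (tau - q) = exp (- q) * exp tau" for q by (simp add: exp_add[symmetric])
  have e4: "(dl * 8 - 1 / 2) / 25 * x = tau - tau * (K - 8 * (real k - 3)) / 25"
    using exponent_eq[OF k x_pos, of 4] by (simp add: dl_def tau_def K_def add.commute)
  show "exp ((dl * 8 - 1 / 2) / 25 * x) \<le> p4 * exp tau" unfolding e4 e using p4 by (intro mult_right_mono) auto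
  have e3: "(dl * 4 - 1 / 2) / 9 * x = tau - tau * (K - 4 * (real k - 2)) / 9"
    using exponent_eq[OF k x_pos, of 3] by (simp add: dl_def tau_def K_def add.commute)
  show "exp ((dl * 4 - 1 / 2) / 9 * x) \<le> p3 * exp tau" unfolding e3 e using p3 by (intro mult_right_mono) auto
qed

lemma range_4_bound:
  "norm (dirichlet_sum (1 - dl) (exp x) (exp (8 / 25 * x)) (exp (4 / 9 * x)))
    \<le> (1.05 * p4 + 2.12 * p3) * exp tau * (2.47 * (4 / 9 * x - 8 / 25 * x) + 1)"
  unfolding mult.assoc mult.commute[of "exp tau"] unfolding mult.assoc[symmetric]
proof (rule range_count)
  fix y Y :: real
  assume y: "8 / 25 * x \<le> y" "y \<le> 4 / 9 * x" "Y \<le> 1.5 * exp y"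
  have "100 \<le> exp y" using y x by (intro hundred_le_exp) simp
  then have "norm (dirichlet_sum (1 - dl) (exp x) (exp y) Y)
      \<le> 1.05 * exp (x / 14 - (2 / 7 - dl) * y) + 2.12 * exp ((dl + 1 / 28) * y - x / 14)"
    using y dl_bounds by (intro block_test_4) auto
  also have "\<dots> \<le> 1.05 * (p4 * exp tau) + 2.12 * (p3 * exp tau)"
  proof (intro add_mono mult_left_mono)
    have "(2 / 7 - dl) * (8 / 25 * x) \<le> (2 / 7 - dl) * y" using y dl_bounds by (intro mult_left_mono) auto
    then have "x / 14 - (2 / 7 - dl) * y \<le> (dl * 8 - 1 / 2) / 25 * x" by (simp add: field_simps)
    then have "exp (x / 14 - (2 / 7 - dl) * y) \<le> exp ((dl * 8 - 1 / 2) / 25 * x)" by (simp only: exp_le_cancel_iff)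
    then show "exp (x / 14 - (2 / 7 - dl) * y) \<le> p4 * exp tau" using exp_boundary(1) by linarith
    have "(dl + 1 / 28) * y \<le> (dl + 1 / 28) * (4 / 9 * x)" using y dl_bounds by (intro mult_left_mono) auto
    then have "(dl + 1 / 28) * y - x / 14 \<le> (dl * 4 - 1 / 2) / 9 * x" by (simp add: field_simps)
    then have "exp ((dl + 1 / 28) * y - x / 14) \<le> exp ((dl * 4 - 1 / 2) / 9 * x)" by (simp only: exp_le_cancel_iff)
    then show "exp ((dl + 1 / 28) * y - x / 14) \<le> p3 * exp tau" using exp_boundary(2) by linarith
  qed auto
  finally show "norm (dirichlet_sum (1 - dl) (exp x) (exp y) Y) \<le> (1.05 * p4 + 2.12 * p3) * exp tau"
    by (simp add: algebra_simps)
next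
  have "0 \<le> p3" "0 \<le> p4" using p3 p4 by (meson exp_ge_zero order.trans)+
  then show "0 \<le> (1.05 * p4 + 2.12 * p3) * exp tau" by simp
qed (use x in simp)

lemma range_3_bound:
  "norm (dirichlet_sum (1 - dl) (exp x) (exp (4 / 9 * x)) (exp (3 / 5 * x))) \<le> 9.2 * p3 * exp tau + 4.31"
proof -
  \<comment> \<open>The number of blocks of length 0.4 in a range of length
    \<open>(3 / 5 - 4 / 9) * x\<close>. Counting is chosen because \<open>dl\<close> may be
    arbitrarily small; the factor linear in \<open>x\<close> is harmless against
    \<open>exp (- x / 15)\<close>.\<close>
  define m where "m = nat \<lceil>7 / 18 * x\<rceil>"
  have m: "7 / 18 * x \<le> real m" "real m \<le> 7 / 18 * x + 1" using x unfolding m_def by linarith+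
  have "1 \<le> 7.92 * (1 - exp (- (1 / 2 - dl) * ln (3 / 2)))"
    by (rule geometric_factor[of _ 1 3 _ "0.8736"]) (use dl_bounds in \<open>simp_all add: power_divide\<close>)
  then have "norm (dirichlet_sum (1 - dl) (exp x) (exp (4 / 9 * x + 0)) (exp (3 / 5 * x + 0)))
      \<le> exp_sum (cs_3 dl (4 / 9) 0 (3 / 5) 0 7.92 (real m)) x"
    using x m by (intro zeta_strip.part_3[OF strip_dl, where m = m] disjI2) auto
  also have "\<dots> = 1.16 * 7.92 * exp ((1 / 6 - (1 / 2 - dl) * (4 / 9)) * x) + 4.29 * real m * exp ((dl * (3 / 5) - 1 / 6) * x)"
    by (simp add: cs_3_def)
  also have "\<dots> \<le> 1.16 * 7.92 * (p3 * exp tau) + 4.31"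
  proof (intro add_mono mult_left_mono)
    have "1 / 6 - (1 / 2 - dl) * (4 / 9) = (dl * 4 - 1 / 2) / 9" by (simp add: field_simps)
    then show "exp ((1 / 6 - (1 / 2 - dl) * (4 / 9)) * x) \<le> p3 * exp tau" using exp_boundary(2) by (simp only:)
    have "(dl * (3 / 5) - 1 / 6) * x \<le> - (1 / 15) * x" using dl_bounds x by (intro mult_right_mono) auto
    moreover have "4.29 * real m \<le> 4.29 * 0.401 * x" using m x by simp
    ultimately have "4.29 * real m * exp ((dl * (3 / 5) - 1 / 6) * x) \<le> (4.29 * 0.401 * x) * exp (- (x / 15))"
      using x by (intro mult_mono[of "4.29 * real m"]) auto
    also have "\<dots> = 25.80435 * (x / 15 * exp (- (x / 15)))" by simp
    also have "\<dots> \<le> 25.80435 * (6 / (x / 15)\<^sup>2)" using x by (intro mult_left_mono times_exp_minus_le) auto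
    also have "\<dots> \<le> 25.80435 * (6 / 6\<^sup>2)" using x by (intro mult_left_mono divide_left_mono power_mono) auto
    also have "\<dots> \<le> 4.31" by simp
    finally show "4.29 * real m * exp ((dl * (3 / 5) - 1 / 6) * x) \<le> 4.31" .
  qed auto
  also have "1.16 * 7.92 * (p3 * exp tau) \<le> 9.2 * (p3 * exp tau)"
  proof (rule mult_right_mono)
    have "0 \<le> p3" using p3 by (meson exp_ge_zero order.trans)
    then show "0 \<le> p3 * exp tau" by simp
  qed simp
  finally show ?thesis by simp
qed

text \<open>Collects all ranges but the critical one, from \<open>exp (x / k)\<close> to
  \<open>exp (8 / 25 * x)\<close>, whose cost \<open>H\<close> depends on how large \<open>k\<close>
  is. The constant 7.4 contains 1 from the first range, 4.31 from order 3 and 2 from beyond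
  \<open>exp (3 / 5 * x)\<close>.\<close>

lemma zeta_le_if_middle_range:
  assumes H: "norm (dirichlet_sum (1 - dl) (exp x) (exp (x / k)) (exp (8 / 25 * x))) \<le> H * exp tau"
  shows "norm (riemann_zeta (Complex (1 - dl) (exp x)))
    \<le> (x / k + H + (1.05 * p4 + 2.12 * p3) * (2.47 * (4 / 9 * x - 8 / 25 * x) + 1) + 9.2 * p3 + 7.4) * exp tau"
proof -
  have "x / k \<le> x / 5" using k x by (intro divide_left_mono) auto
  then have "x / k \<le> 8 / 25 * x" "x / k \<le> 3 / 5 * x" using x by linarith+
  then have "norm (dirichlet_sum (1 - dl) (exp x) 0 (exp (3 / 5 * x)))
    \<le> norm (dirichlet_sum (1 - dl) (exp x) 0 (exp (x / k)))
      + (norm (dirichlet_sum (1 - dl) (exp x) (exp (x / k)) (exp (8 / 25 * x)))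
      + (norm (dirichlet_sum (1 - dl) (exp x) (exp (8 / 25 * x)) (exp (4 / 9 * x)))
      + norm (dirichlet_sum (1 - dl) (exp x) (exp (4 / 9 * x)) (exp (3 / 5 * x)))))"
    using norm_dirichlet_sum_split[of 0 "exp (x / k)" "exp (3 / 5 * x)" "1 - dl" "exp x"]
      norm_dirichlet_sum_split[of "exp (x / k)" "exp (8 / 25 * x)" "exp (3 / 5 * x)" "1 - dl" "exp x"]
      norm_dirichlet_sum_split[of "exp (8 / 25 * x)" "exp (4 / 9 * x)" "exp (3 / 5 * x)" "1 - dl" "exp x"] x by simp
  then have "norm (riemann_zeta (Complex (1 - dl) (exp x)))
    \<le> (1 + x / k) * exp tau + H * exp tau
      + (1.05 * p4 + 2.12 * p3) * exp tau * (2.47 * (4 / 9 * x - 8 / 25 * x) + 1) + (9.2 * p3 * exp tau + 4.31) + 2"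
    using zeta_strip.zeta_le_low_sum[OF strip_low refl x] first_range_bound H range_4_bound range_3_bound by linarith
  moreover have "6.31 * 1 \<le> 6.31 * exp tau" using dl_bounds by (intro mult_left_mono) auto
  moreover have "z \<le> a + b + c + (e + 4.31) + 2 \<Longrightarrow> 6.31 * 1 \<le> 6.31 * u \<Longrightarrow> z \<le> a + b + c + e + 6.31 * u"
    for z a b c e u :: real by simp
  ultimately have "norm (riemann_zeta (Complex (1 - dl) (exp x)))
    \<le> (1 + x / k) * exp tau + H * exp tau
      + (1.05 * p4 + 2.12 * p3) * exp tau * (2.47 * (4 / 9 * x - 8 / 25 * x) + 1) + 9.2 * p3 * exp tau + 6.31 * exp tau" by blast
  also have "\<dots> = (x / k + H + (1.05 * p4 + 2.12 * p3) * (2.47 * (4 / 9 * x - 8 / 25 * x) + 1) + 9.2 * p3 + 7.31) * exp tau"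
    by algebra
  also have "\<dots> \<le> (x / k + H + (1.05 * p4 + 2.12 * p3) * (2.47 * (4 / 9 * x - 8 / 25 * x) + 1) + 9.2 * p3 + 7.4) * exp tau"
    by (intro mult_right_mono add_left_mono) auto
  finally show ?thesis .
qed

end

lemma low_range_bound:
  assumes "5 \<le> x / k" "x / k \<le> c * x" "c \<le> 8 / 25"
  shows "norm (dirichlet_sum (1 - dl) (exp x) (exp (x / k)) (exp (c * x))) \<le> 2.15 * (2.47 * (c * x - x / k) + 1) * exp tau"
proof (rule range_count)
  fix y Y :: real
  assume y: "x / k \<le> y" "y \<le> c * x" "Y \<le> 1.5 * exp y"
  have "c * x \<le> 8 / 25 * x" using assms x by (intro mult_right_mono) auto
  then show "norm (dirichlet_sum (1 - dl) (exp x) (exp y) Y) \<le> 2.15 * exp tau"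
    unfolding dl_def tau_def using y assms
    by (intro block_bound_tau[OF k x_pos] hundred_le_exp) auto
qed (use assms in auto)

text \<open>Order 5 being below \<open>k\<close>, both ends of its range carry decay factors,
  \<open>p5\<close> at 16/65 and \<open>p4\<close> at 8/25, in place of the uniform 2.15.\<close>

lemma range_5_bound:
  assumes k6: "k \<ge> 6" and p4: "exp (- (tau * (K - 8 * (real k - 3)) / 25)) \<le> p4"
    and p5: "exp (- (tau * (K - 16 * (real k - 4)) / 65)) \<le> p5"
  shows "norm (dirichlet_sum (1 - dl) (exp x) (exp (16 / 65 * x)) (exp (8 / 25 * x)))
    \<le> (0.95 * p5 + 1.2 * p4) * (2.47 * (8 / 25 * x - 16 / 65 * x) + 1) * exp tau"
proof (rule range_count)
  fix y Y :: real
  assume y: "16 / 65 * x \<le> y" "y \<le> 8 / 25 * x" "Y \<le> 1.5 * exp y"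
  have e: "exp (tau - q) = exp (- q) * exp tau" for q by (simp add: exp_add[symmetric])
  have e4: "(dl * 8 - 1 / 2) / 25 * x = tau - tau * (K - 8 * (real k - 3)) / 25"
    using exponent_eq[OF k x_pos, of 4] by (simp add: dl_def tau_def K_def add.commute)
  have q4: "exp ((dl * 8 - 1 / 2) / 25 * x) \<le> p4 * exp tau" unfolding e4 e using p4 by (intro mult_right_mono) auto
  have e5: "(dl * 16 - 1 / 2) / 65 * x = tau - tau * (K - 16 * (real k - 4)) / 65"
    using exponent_eq[OF k x_pos, of 5] by (simp add: dl_def tau_def K_def add.commute)
  have q5: "exp ((dl * 16 - 1 / 2) / 65 * x) \<le> p5 * exp tau" unfolding e5 e using p5 by (intro mult_right_mono) auto
  have "100 \<le> exp y" using y x by (intro hundred_le_exp) simp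
  then have "norm (dirichlet_sum (1 - dl) (exp x) (exp y) Y)
      \<le> 0.95 * exp ((dl * 16 - 1 / 2) / 65 * x) + 1.2 * exp ((dl * 8 - 1 / 2) / 25 * x)"
    using block_bound[OF k x_pos, of 5 y Y "(dl * 16 - 1 / 2) / 65 * x"] y k unfolding dl_def by simp
  also have "\<dots> \<le> 0.95 * (p5 * exp tau) + 1.2 * (p4 * exp tau)"
    using q4 q5 by (intro add_mono mult_left_mono) auto
  finally show "norm (dirichlet_sum (1 - dl) (exp x) (exp y) Y) \<le> (0.95 * p5 + 1.2 * p4) * exp tau"
    by (simp add: algebra_simps)
next
  have "0 \<le> p5" "0 \<le> p4" using p5 p4 by (meson exp_ge_zero order.trans)+
  then show "0 \<le> (0.95 * p5 + 1.2 * p4) * exp tau" by simp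
qed (use x in simp)

end

context zeta_strip
begin

text \<open>For \<open>d = 2 / 7\<close> the first exponent of the test of order 4 does not depend
  on \<open>y\<close>, so the blocks between \<open>x / 4\<close> and \<open>4 / 9 * x\<close> are
  the only source of a multiple of \<open>x * exp (x / 14)\<close>. Their second terms form a
  geometric series ending at \<open>exp (x / 14)\<close>. All other terms, divided by
  \<open>exp (x / 14)\<close>, are nonincreasing and are evaluated at 54.\<close>

lemma regime_4_high:
  assumes dd: "d = 2 / 7" and xx: "54 \<le> x"
  shows "Z \<le> 1.546 * x * exp (1 / 14 * x)"
proof -
  let ?D = "\<lambda>u v. norm (dirichlet_sum sg (exp x) u v)"
  let ?cs = "cs_triv (2 / 7) (1 / 4) 0 @ cs_3 (2 / 7) (4 / 9) 0 (13 / 20) 0 (301 / 25) (183 / 20)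
    @ cs_2 (2 / 7) (13 / 20) 0 (183 / 20) @ cs_tail (2 / 7)"
  have "?D (exp (1 / 4 * x)) (exp (4 / 9 * x)) \<le> (\<Sum>i<nat \<lceil>(4 / 9 * x - 1 / 4 * x) / ln (3 / 2)\<rceil>.
      1.05 * exp (x / 14) + 2.12 * exp (- (x / 14)) * exp (9 / 28 * (1 / 4 * x + real i * ln (3 / 2))))"
  proof (rule range_le_sum_blocks)
    fix y Y :: real
    assume y: "1 / 4 * x \<le> y" "Y \<le> 1.5 * exp y"
    have "100 \<le> exp y" using y xx by (intro hundred_le_exp) simp
    then have "?D (exp y) Y \<le> 1.05 * exp (x / 14 - (2 / 7 - d) * y) + 2.12 * exp ((d + 1 / 28) * y - x / 14)"
      using y sg by (intro block_test_4) auto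
    also have "exp ((d + 1 / 28) * y - x / 14) = exp (- (x / 14)) * exp (9 / 28 * y)"
      by (simp only: exp_add[symmetric] dd) simp
    finally show "?D (exp y) Y \<le> 1.05 * exp (x / 14) + 2.12 * exp (- (x / 14)) * exp (9 / 28 * y)"
      by (simp add: dd)
  qed (use xx in simp)
  also have "\<dots> = real (nat \<lceil>(4 / 9 * x - 1 / 4 * x) / ln (3 / 2)\<rceil>) * (1.05 * exp (x / 14)) + 2.12 * exp (- (x / 14))
      * (\<Sum>i<nat \<lceil>(4 / 9 * x - 1 / 4 * x) / ln (3 / 2)\<rceil>. exp (9 / 28 * (1 / 4 * x + real i * ln (3 / 2))))"
    by (simp add: sum.distrib sum_distrib_left)
  also have "\<dots> \<le> (2.47 * (4 / 9 * x - 1 / 4 * x) + 1) * (1.05 * exp (x / 14)) + 2.12 * exp (- (x / 14)) * (8.2 * exp (9 / 28 * (4 / 9 * x)))"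
  proof (intro add_mono mult_right_mono mult_left_mono block_count sum_exp_increasing refl)
    show "1 \<le> 8.2 * (1 - exp (- (9 / 28) * ln (3 / 2 :: real)))"
      by (rule geometric_factor[of _ 9 28 _ "0.8779"]; simp add: power_divide)
  qed (use xx in auto)
  also have "2.12 * exp (- (x / 14)) * (8.2 * exp (9 / 28 * (4 / 9 * x))) = 2.12 * 8.2 * exp (x / 14)"
    by (simp add: exp_add[symmetric])
  finally have r4: "?D (exp (1 / 4 * x)) (exp (4 / 9 * x))
    \<le> (2.47 * (4 / 9 * x - 1 / 4 * x) + 1) * (1.05 * exp (x / 14)) + 2.12 * 8.2 * exp (x / 14)" .
  have "?D 0 (exp (1 / 4 * x)) \<le> 1 - 7 / 2 + exp_sum (cs_triv (2 / 7) (1 / 4) 0) x"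
    using trivial_part[of "1 / 4" 0] xx unfolding dd by simp
  moreover have "?D (exp (4 / 9 * x)) (exp (13 / 20 * x)) \<le> exp_sum (cs_3 (2 / 7) (4 / 9) 0 (13 / 20) 0 (301 / 25) (183 / 20)) x"
    using part_3[of "4 / 9" 0 "13 / 20" 0 "301 / 25" "183 / 20"] xx geometric_factors_7 unfolding dd by simp
  moreover have "?D (exp (13 / 20 * x)) (exp (1 * x - 1.6)) \<le> exp_sum (cs_2 (2 / 7) (13 / 20) 0 (183 / 20)) x"
    using part_2[of "13 / 20" 0 "183 / 20"] xx geometric_factors_7(1) unfolding dd by simp
  moreover have "?D 0 (exp (1 * x - 1.6)) \<le> ?D 0 (exp (1 / 4 * x)) + (?D (exp (1 / 4 * x)) (exp (4 / 9 * x))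
      + (?D (exp (4 / 9 * x)) (exp (13 / 20 * x)) + ?D (exp (13 / 20 * x)) (exp (1 * x - 1.6))))"
    using norm_dirichlet_sum_split[of 0 "exp (1 / 4 * x)" "exp (1 * x - 1.6)" sg "exp x"]
      norm_dirichlet_sum_split[of "exp (1 / 4 * x)" "exp (4 / 9 * x)" "exp (1 * x - 1.6)" sg "exp x"]
      norm_dirichlet_sum_split[of "exp (4 / 9 * x)" "exp (13 / 20 * x)" "exp (1 * x - 1.6)" sg "exp x"] xx by simp
  ultimately have "Z \<le> exp_sum ?cs x + ?D (exp (1 / 4 * x)) (exp (4 / 9 * x))"
    using tail_part unfolding dd exp_sum_simps by linarith
  also have "exp_sum ?cs x = exp (1 / 14 * x) * exp_sum (exp_shift (1 / 14) ?cs) x"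
    by (rule exp_sum_shift)
  also have "exp_sum (exp_shift (1 / 14) ?cs) x \<le> exp_sum (exp_shift (1 / 14) ?cs) 54"
    by (rule exp_sum_antimono) (use xx in \<open>simp_all add: cs_triv_def cs_2_def cs_3_def cs_tail_def\<close>)
  also have "\<dots> \<le> 21"
    by (rule exp_sum_le_chains[of _ _ "[[1], [1], [601 / 10000, 49 / 200, 247 / 500, 35109 / 50000], [73 / 500, 191 / 500, 61747 / 100000], [231 / 5000000, 679 / 100000, 103 / 1250, 287 / 1000, 107 / 200, 73097 / 100000], [], [], [], [], []]"]) (simp add: cs_triv_def cs_2_def cs_3_def cs_tail_def)
  also have "exp (1 / 14 * x) * 21 + ?D (exp (1 / 4 * x)) (exp (4 / 9 * x))
    \<le> (21 + 1.05 * (2.47 * (4 / 9 * x - 1 / 4 * x) + 1) + 2.12 * 8.2) * exp (1 / 14 * x)"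
    using r4 by (simp add: algebra_simps)
  also have "\<dots> \<le> 1.546 * x * exp (1 / 14 * x)" using xx by (intro mult_right_mono) (auto simp: field_simps)
  finally show ?thesis by simp
qed

end

lemma zeta_5_high:
  assumes x: "x \<ge> 100"
  shows "norm (riemann_zeta (Complex (1 - strip_width 5) (exp x))) \<le> 1.546 * x * exp (x / (2 ^ 5 - 2))"
proof -
  let ?E = "exp (x / (2 ^ 5 - 2))" and ?H = "2.15 * (2.47 * (8 / 25 * x - x / real 5) + 1)"
  have "norm (riemann_zeta (Complex (1 - strip_width 5) (exp x)))
    \<le> (x / real 5 + ?H + (1.05 * 1 + 2.12 * 0.2275) * (2.47 * (4 / 9 * x - 8 / 25 * x) + 1) + 9.2 * 0.2275 + 7.4) * ?E"
  proof (rule zeta_le_if_middle_range)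
    have e: "exp (- (40 / 27) :: real) \<le> 1137 / 5000"
      by (rule exp_le_chain[of _ _ "[298 / 625, 690481 / 1000000]"]) simp
    have "exp (- (x / (2 ^ 5 - 2) * (2 ^ (5 - 1) - 4 * (real 5 - 2)) / 9)) \<le> exp (- (40 / 27))" using x by simp
    from order.trans[OF this e] show "exp (- (x / (2 ^ 5 - 2) * (2 ^ (5 - 1) - 4 * (real 5 - 2)) / 9)) \<le> 0.2275" by simp
    show "norm (dirichlet_sum (1 - strip_width 5) (exp x) (exp (x / real 5)) (exp (8 / 25 * x))) \<le> ?H * ?E"
      by (rule low_range_bound) (use x in auto)
  qed (use x in auto)
  also have "\<dots> \<le> 1.546 * x * ?E" using x by (intro mult_right_mono) (auto simp: field_simps)
  finally show ?thesis .
qed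

lemma zeta_6_high:
  assumes x: "x \<ge> 140"
  shows "norm (riemann_zeta (Complex (1 - strip_width 6) (exp x))) \<le> 1.546 * x * exp (x / (2 ^ 6 - 2))"
proof -
  let ?E = "exp (x / (2 ^ 6 - 2))" and ?H = "2.15 * (2.47 * (8 / 25 * x - x / real 6) + 1)"
  have "norm (riemann_zeta (Complex (1 - strip_width 6) (exp x)))
    \<le> (x / real 6 + ?H + (1.05 * 1 + 2.12 * 0.1) * (2.47 * (4 / 9 * x - 8 / 25 * x) + 1) + 9.2 * 0.1 + 7.4) * ?E"
  proof (rule zeta_le_if_middle_range)
    have e: "exp (- 4 :: real) \<le> 917 / 50000"
      by (rule exp_le_chain[of _ _ "[677 / 5000, 3679 / 10000, 30327 / 50000]"]) simp
    have "exp (- (x / (2 ^ 6 - 2) * (2 ^ (6 - 1) - 4 * (real 6 - 2)) / 9)) \<le> exp (- 4)" using x by simp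
    from order.trans[OF this e] show "exp (- (x / (2 ^ 6 - 2) * (2 ^ (6 - 1) - 4 * (real 6 - 2)) / 9)) \<le> 0.1" by simp
    show "norm (dirichlet_sum (1 - strip_width 6) (exp x) (exp (x / real 6)) (exp (8 / 25 * x))) \<le> ?H * ?E"
      by (rule low_range_bound) (use x in auto)
  qed (use x in auto)
  also have "\<dots> \<le> 1.546 * x * ?E" using x by (intro mult_right_mono) (auto simp: field_simps)
  finally show ?thesis .
qed

lemma linear_le_two_power:
  assumes "n0 \<ge> 1" "n0 \<le> n" "a * real n0 - b \<le> 2 ^ (n0 - 1)" "a \<le> 2 ^ (n0 - 1)"
  shows "a * real n - b \<le> 2 ^ (n - 1)"
  using assms(2)
proof (induction n rule: dec_induct)
  case (step n)
  have "(2::real) ^ (n0 - 1) \<le> 2 ^ (n - 1)" using step by (intro power_increasing) auto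
  moreover have "(2::real) ^ (Suc n - 1) = 2 * 2 ^ (n - 1)" using step assms(1) by (simp add: power_eq_if)
  moreover have "a * real (Suc n) - b = a * real n - b + a" by (simp add: algebra_simps)
  ultimately show ?case using step assms(4) by linarith
qed (use assms in simp)

text \<open>\<open>tau\<close> alone may be tiny, but \<open>kk * tau\<close> is at least 5. Once
  the excess \<open>W\<close> is bounded below by a multiple of \<open>kk\<close>, the decay is
  uniform in \<open>kk\<close>.\<close>

lemma exp_minus_excess_le:
  fixes tau W kk c D q p :: real
  assumes "5 \<le> kk * tau" "0 < tau" "c * kk \<le> W" "0 \<le> c" "0 < D" "q \<le> c * 5 / D" "exp (- q) \<le> p"
  shows "exp (- (tau * W / D)) \<le> p"
proof -
  have "c * 5 \<le> c * (kk * tau)" using assms by (intro mult_left_mono) auto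
  also have "\<dots> = tau * (c * kk)" by simp
  also have "\<dots> \<le> tau * W" using assms by (intro mult_left_mono) auto
  finally have "c * 5 / D \<le> tau * W / D" using assms by (intro divide_right_mono) auto
  then have "- (tau * W / D) \<le> - q" using assms by linarith
  then have "exp (- (tau * W / D)) \<le> exp (- q)" by (simp only: exp_le_cancel_iff)
  then show ?thesis using assms by linarith
qed

lemma square_add_two_le_two_power: "k \<ge> 7 \<Longrightarrow> real k * real k + 2 \<le> 2 ^ k"
proof (induction k rule: dec_induct)
  case (step k)
  have "7 * real k \<le> real k * real k" using step by (intro mult_right_mono) auto
  moreover have "real (Suc k) * real (Suc k) = real k * real k + 2 * real k + 1" by (simp add: algebra_simps)
  moreover have "(2::real) ^ Suc k = 2 * 2 ^ k" by simp
  ultimately show ?case using step by linarith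
qed simp

text \<open>The threshold says \<open>k * tau \<ge> 5\<close>. Since the width is at most 1/18 it
  forces \<open>x \<ge> 90\<close>, and since \<open>k\<^sup>2 \<le> 2 ^ k - 2\<close> it forces
  \<open>x / k \<ge> 5\<close>, so that the blocks of the critical range are long enough for the
  tests.\<close>

lemma zeta_ge_7_high:
  assumes k: "k \<ge> 7" and u: "5 \<le> strip_width k * x"
  shows "norm (riemann_zeta (Complex (1 - strip_width k) (exp x))) \<le> 1.546 * x * exp (x / (2 ^ k - 2))"
proof -
  define tau where "tau = x / (2 ^ k - 2)"
  have w: "strip_width k > 0" "strip_width k \<le> 1 / 18"
    using strip_width_antimono[of 7 k] k strip_width_values(4) two_power_minus_two_pos[of k] by (auto simp: strip_width_def)
  have x0: "0 < x" using u w by (smt (verit) mult_nonneg_nonpos)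
  have "strip_width k * x \<le> 1 / 18 * x" using w x0 by (intro mult_right_mono) auto
  then have x: "x \<ge> 90" using u by simp
  have kt: "5 \<le> real k * tau" and t0: "0 < tau"
    using u x0 two_power_minus_two_pos[of k] k by (auto simp: tau_def strip_width_def)
  have xk: "5 \<le> x / k"
  proof -
    have "real k * real k \<le> 2 ^ k - 2" using square_add_two_le_two_power[OF k] by simp
    then have "tau * (real k * real k) \<le> tau * (2 ^ k - 2)" using t0 by (intro mult_left_mono) auto
    also have "\<dots> = x" using two_power_minus_two_pos[of k] k by (simp add: tau_def)
    finally have "real k * tau \<le> x / k" using k by (simp add: field_simps)
    then show ?thesis using kt by linarith
  qed
  have x7: "x / k \<le> x / 7" using k x0 by (intro divide_left_mono) auto
  \<comment> \<open>tangents at \<open>k = 7\<close>, which make the excess exponents multiples of \<open>k\<close>\<close>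
  have K7: "88 / 7 * real k - 24 \<le> 2 ^ (k - 1)" "72 / 7 * real k - 8 \<le> 2 ^ (k - 1)"
    by (rule linear_le_two_power[of 7]; use k in simp)+
  have e3: "exp (- (22 / 7) :: real) \<le> 4319 / 100000"
      by (rule exp_le_chain[of _ _ "[1039 / 5000, 2279 / 5000, 84391 / 125000]"]) simp
  have p3: "exp (- (tau * (2 ^ (k - 1) - 4 * (real k - 2)) / 9)) \<le> 0.05"
    by (rule exp_minus_excess_le[of "real k" _ "44 / 7" _ 9 "22 / 7", OF kt t0]) (use K7 e3 in auto)
  show ?thesis
  proof (cases "k \<le> 8")
    case True
    have e4: "exp (- (32 / 35) :: real) \<le> 4009 / 10000"
      by (rule exp_le_chain[of _ _ "[79137 / 125000]"]) simp
    have p4: "exp (- (tau * (2 ^ (k - 1) - 8 * (real k - 3)) / 25)) \<le> 0.402"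
      by (rule exp_minus_excess_le[of "real k" _ "32 / 7" _ 25 "32 / 35", OF kt t0]) (use K7 e4 in auto)
    have x8: "x / 8 \<le> x / k" using True k x0 by (intro divide_left_mono) auto
    let ?H = "2.15 * (2.47 * (8 / 25 * x - x / k) + 1)"
    have "norm (riemann_zeta (Complex (1 - strip_width k) (exp x)))
      \<le> (x / k + ?H + (1.05 * 0.402 + 2.12 * 0.05) * (2.47 * (4 / 9 * x - 8 / 25 * x) + 1) + 9.2 * 0.05 + 7.4) * exp tau"
      unfolding tau_def
    proof (rule zeta_le_if_middle_range)
      show "norm (dirichlet_sum (1 - strip_width k) (exp x) (exp (x / real k)) (exp (8 / 25 * x))) \<le> ?H * exp (x / (2 ^ k - 2))"
        by (rule low_range_bound) (use k x xk x7 in auto)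
    qed (use k x p3 p4 in \<open>auto simp: tau_def\<close>)
    also have "\<dots> \<le> 1.546 * x * exp tau"
    proof (rule mult_right_mono)
      have "v + 2.15 * (2.47 * (8 / 25 * x - v) + 1) + (1.05 * 0.402 + 2.12 * 0.05) * (2.47 * (4 / 9 * x - 8 / 25 * x) + 1) + 9.2 * 0.05 + 7.4 \<le> 1.546 * x"
        if "x / 8 \<le> v" for v using x that by (simp add: field_simps)
      from this[OF x8] show "x / k + ?H + (1.05 * 0.402 + 2.12 * 0.05) * (2.47 * (4 / 9 * x - 8 / 25 * x) + 1) + 9.2 * 0.05 + 7.4 \<le> 1.546 * x" .
    qed simp
    finally show ?thesis unfolding tau_def .
  next
    case False
    then have k9: "k \<ge> 9" by simp
    have K9: "320 / 9 * real k - 64 \<le> 2 ^ (k - 1)" "280 / 9 * real k - 24 \<le> 2 ^ (k - 1)"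
      by (rule linear_le_two_power[of 9]; use k9 in simp)+
    have e4: "exp (- (208 / 45) :: real) \<le> 9847 / 1000000"
      by (rule exp_le_chain[of _ _ "[9923 / 100000, 63 / 200, 1403 / 2500, 93637 / 125000]"]) simp
    have p4: "exp (- (tau * (2 ^ (k - 1) - 8 * (real k - 3)) / 25)) \<le> 0.02"
      by (rule exp_minus_excess_le[of "real k" _ "208 / 9" _ 25 "208 / 45", OF kt t0]) (use K9 e4 in auto)
    have e5: "exp (- (3 / 2) :: real) \<le> 279 / 1250"
      by (rule exp_le_chain[of _ _ "[1181 / 2500, 171823 / 250000]"]) simp
    have p5: "exp (- (tau * (2 ^ (k - 1) - 16 * (real k - 4)) / 65)) \<le> 0.24"
      by (rule exp_minus_excess_le[of "real k" _ "176 / 9" _ 65 "3 / 2", OF kt t0]) (use K9 e5 in auto)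
    have x16: "x / k \<le> 16 / 65 * x" using x7 x0 by linarith
    \<comment> \<open>Charging 2.15 per block up to 8/25 would tend to
      \<open>2.15 * 2.47 * 8 / 25 > 1.546\<close> times \<open>x\<close> as \<open>k\<close> grows;
      hence the range of order 5, from 16/65 on, is estimated with its decay factors.\<close>
    let ?H1 = "2.15 * (2.47 * (16 / 65 * x - x / k) + 1)" and ?H2 = "(0.95 * 0.24 + 1.2 * 0.02) * (2.47 * (8 / 25 * x - 16 / 65 * x) + 1)"
    have "norm (riemann_zeta (Complex (1 - strip_width k) (exp x)))
      \<le> (x / k + (?H1 + ?H2) + (1.05 * 0.02 + 2.12 * 0.05) * (2.47 * (4 / 9 * x - 8 / 25 * x) + 1) + 9.2 * 0.05 + 7.4) * exp tau"
      unfolding tau_def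
    proof (rule zeta_le_if_middle_range)
      have h1: "norm (dirichlet_sum (1 - strip_width k) (exp x) (exp (x / real k)) (exp (16 / 65 * x))) \<le> ?H1 * exp tau"
        unfolding tau_def by (rule low_range_bound) (use k x xk x16 in auto)
      have h2: "norm (dirichlet_sum (1 - strip_width k) (exp x) (exp (16 / 65 * x)) (exp (8 / 25 * x))) \<le> ?H2 * exp tau"
        unfolding tau_def by (rule range_5_bound) (use k9 x p4 p5 in \<open>auto simp: tau_def\<close>)
      show "norm (dirichlet_sum (1 - strip_width k) (exp x) (exp (x / real k)) (exp (8 / 25 * x))) \<le> (?H1 + ?H2) * exp (x / (2 ^ k - 2))"
        unfolding tau_def[symmetric] distrib_right[of ?H1]
        by (rule order.trans[OF norm_dirichlet_sum_split add_mono[OF h1 h2]]) (use x16 x0 in auto)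
    qed (use k x p3 p4 in \<open>auto simp: tau_def\<close>)
    also have "\<dots> \<le> 1.546 * x * exp tau"
    proof (rule mult_right_mono)
      have this0: "v + (2.15 * (2.47 * (16 / 65 * x - v) + 1) + ?H2) + (1.05 * 0.02 + 2.12 * 0.05) * (2.47 * (4 / 9 * x - 8 / 25 * x) + 1) + 9.2 * 0.05 + 7.4 \<le> 1.546 * x"
        if "0 \<le> v" for v using x that by (simp add: field_simps)
      have "0 \<le> x / k" using x0 by simp
      from this0[OF this] show "x / k + (?H1 + ?H2) + (1.05 * 0.02 + 2.12 * 0.05) * (2.47 * (4 / 9 * x - 8 / 25 * x) + 1) + 9.2 * 0.05 + 7.4 \<le> 1.546 * x" .
    qed simp
    finally show ?thesis unfolding tau_def .
  qed
qed

lemma zeta_ge_7_middle: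
  assumes k: "k \<ge> 7" and x90: "90 \<le> x" and u: "strip_width k * x \<le> 5"
  shows "norm (riemann_zeta (Complex (1 - strip_width k) (exp x))) \<le> 1.546 * x"
proof -
  define dl where "dl = strip_width k"
  have w: "0 < dl" "dl \<le> 1 / 18"
    using strip_width_antimono[of 7 k] k strip_width_values(4) two_power_minus_two_pos[of k] by (auto simp: dl_def strip_width_def)
  interpret lo: zeta_strip "1 - dl" "1 / 6" x by unfold_locales (use w x90 in auto)
  interpret zeta_strip "1 - dl" dl x by unfold_locales (use w x90 in auto)
  let ?D = "\<lambda>u v. norm (dirichlet_sum (1 - dl) (exp x) u v)"
  have e53: "exp (5 / 3 :: real) \<le> 53 / 10"
      by (rule exp_le_chain[of _ _ "[1151 / 500, 37923 / 25000]"]) simp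
  \<comment> \<open>The chord of \<open>exp\<close> between 0 and 5/3, with
    \<open>0.86 = (5.3 - 1) / 5\<close>. Linearity in \<open>dl * x\<close> lets \<open>dl\<close>
    cancel from the trivial bound, which leaves 0.86 \<open>x\<close> for every width.\<close>
  have e: "exp (dl * x / 3) \<le> 1 + dl * x * 0.86"
  proof -
    have "exp ((1 - dl * x / 5) * 0 + dl * x / 5 * (5 / 3)) \<le> (1 - dl * x / 5) * exp 0 + dl * x / 5 * exp (5 / 3)"
      using convex_onD[OF exp_convex, of "dl * x / 5" 0 "5 / 3"] w x u by (simp add: dl_def)
    also have "dl * x / 5 * exp (5 / 3) \<le> dl * x / 5 * 5.3"
      using e53 w x90 by (intro mult_left_mono) auto
    finally show ?thesis by simp
  qed
  have "?D 0 (exp (1 / 3 * x + 0)) \<le> 1 - 1 / dl + exp_sum (cs_triv dl (1 / 3) 0) x"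
    by (rule trivial_part) (use x90 in simp)
  also have "\<dots> = 1 + (exp (dl * x / 3) - 1) / dl" by (simp add: cs_triv_def diff_divide_distrib)
  also have "(exp (dl * x / 3) - 1) / dl \<le> (dl * x * 0.86) / dl" using e w by (intro divide_right_mono) auto
  also have "(dl * x * 0.86) / dl = x * 0.86" using w by simp
  finally have 1: "?D 0 (exp (1 / 3 * x)) \<le> 1 + x * 0.86" by simp
  define m where "m = nat \<lceil>2 / 3 * x\<rceil>"
  have m: "2 / 3 * x \<le> real m" "real m \<le> 2 / 3 * x + 1" using x90 unfolding m_def by linarith+
  have "1 \<le> 6.07 * (1 - exp (- (1 / 2 - dl) * ln (3 / 2)))"
    by (rule geometric_factor[of _ 4 9 _ "0.8351"]) (use w in \<open>simp_all add: power_divide\<close>)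
  then have "?D (exp (1 / 3 * x + 0)) (exp (3 / 5 * x + 0)) \<le> exp_sum (cs_3 dl (1 / 3) 0 (3 / 5) 0 6.07 (real m)) x"
    using x90 m by (intro part_3[where m = m] disjI2) auto
  also have "\<dots> = 1.16 * 6.07 * exp ((1 / 6 - (1 / 2 - dl) * (1 / 3)) * x) + 4.29 * real m * exp ((dl * (3 / 5) - 1 / 6) * x)"
    by (simp add: cs_3_def)
  also have "\<dots> \<le> 1.16 * 6.07 * 5.3 + 1"
  proof (intro add_mono mult_left_mono)
    have "1 / 6 - (1 / 2 - dl) * (1 / 3) = dl / 3" by (simp add: field_simps)
    then have "(1 / 6 - (1 / 2 - dl) * (1 / 3)) * x = dl * x / 3" by simp
    then have "(1 / 6 - (1 / 2 - dl) * (1 / 3)) * x \<le> 5 / 3" using u unfolding dl_def[symmetric] by linarith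
    then have "exp ((1 / 6 - (1 / 2 - dl) * (1 / 3)) * x) \<le> exp (5 / 3)" by (simp only: exp_le_cancel_iff)
    from order.trans[OF this e53]
    have "exp ((1 / 6 - (1 / 2 - dl) * (1 / 3)) * x) \<le> 53 / 10" .
    then show "exp ((1 / 6 - (1 / 2 - dl) * (1 / 3)) * x) \<le> 5.3" by (rule order.trans) simp
    have "(dl * (3 / 5) - 1 / 6) * x \<le> - (2 / 15) * x" using w x90 by (intro mult_right_mono) auto
    moreover have "4.29 * real m \<le> 2.925 * x" using m x90 by simp
    ultimately have "4.29 * real m * exp ((dl * (3 / 5) - 1 / 6) * x) \<le> (2.925 * x) * exp (- (2 / 15 * x))"
      using x90 by (intro mult_mono[of "4.29 * real m"]) auto
    also have "\<dots> = 21.9375 * (2 / 15 * x * exp (- (2 / 15 * x)))" by simp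
    also have "\<dots> \<le> 21.9375 * (6 / (2 / 15 * x)\<^sup>2)" using x90 by (intro mult_left_mono times_exp_minus_le) auto
    also have "\<dots> \<le> 21.9375 * (6 / 12\<^sup>2)" using x90 by (intro mult_left_mono divide_left_mono power_mono) auto
    also have "\<dots> \<le> 1" by simp
    finally show "4.29 * real m * exp ((dl * (3 / 5) - 1 / 6) * x) \<le> 1" .
  qed auto
  finally have 2: "?D (exp (1 / 3 * x)) (exp (3 / 5 * x)) \<le> 1.16 * 6.07 * 5.3 + 1" by simp
  have "Z \<le> (1 + x * 0.86) + (1.16 * 6.07 * 5.3 + 1) + 2"
    using lo.zeta_le_low_sum[OF refl x90] norm_dirichlet_sum_split[of 0 "exp (1 / 3 * x)" "exp (3 / 5 * x)" "1 - dl" "exp x"] 1 2 x90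
    by simp
  then show ?thesis using x90 unfolding dl_def by simp
qed

subsection \<open>Moderate arguments\<close>

context zeta_strip
begin

text \<open>The digit in the names below selects the width. The inner lists certify the exponentials
  of the concatenated coefficient lists, in their order, at the two end points of the interval; the
  fraction multiplying \<open>1 - 1 / d\<close> is the lower bound \<open>r\<close> for
  \<open>exp (- l * x1)\<close>.\<close>

lemma regime_4_T:
  assumes dd: "d = 2 / 7" and xx: "17 / 5 \<le> x" "x \<le> 43 / 5"
  shows "Z \<le> 1.546 * x * exp (1 / 14 * x)"
proof (rule le_linear_exp_if_chains[OF _ _ _ xx])
  show "Z \<le> 1 - 1 / (2 / 7) + exp_sum (cs_triv (2 / 7) 1 (- 1.6) @ cs_tail (2 / 7)) x"
    using regime_T unfolding dd .
  show "exp_chain (1 / 14 * (43 / 5)) [1849 / 1000, 67977 / 50000]" "338 / 625 * (1849 / 1000) \<le> (1 :: real)" by simp_all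
  show "exp_sum_chains (exp_shift (1 / 14) (cs_triv (2 / 7) 1 (- 1.6) @ cs_tail (2 / 7))) (17 / 5)
    [[13119 / 10000], [109 / 500, 233 / 500, 853 / 1250], [23 / 125, 107 / 250, 32689 / 50000], [123 / 20000, 49 / 625, 7 / 25, 529 / 1000, 36353 / 50000]]
    (1.546 * (17 / 5) - (1 - 1 / (2 / 7)) * (338 / 625))"
    by (simp add: cs_triv_def cs_tail_def cs_2_def cs_3_def)
  show "exp_sum_chains (exp_shift (1 / 14) (cs_triv (2 / 7) 1 (- 1.6) @ cs_tail (2 / 7))) (43 / 5)
    [[4, 2, 14141 / 10000], [187 / 50000, 611 / 10000, 247 / 1000, 62 / 125, 70407 / 100000], [7 / 500, 59 / 500, 343 / 1000, 117 / 200, 38217 / 50000], [1 / 390625, 1 / 625, 1 / 25, 1 / 5, 447 / 1000, 8353 / 12500]]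
    (1.546 * (43 / 5) - (1 - 1 / (2 / 7)) * (338 / 625))"
    by (simp add: cs_triv_def cs_tail_def cs_2_def cs_3_def)
qed (simp_all add: cs_triv_def cs_tail_def cs_2_def cs_3_def)

text \<open>Only a logarithmic length of 1.6 lies between the cut and \<open>exp (x - 1.6)\<close>,
  that is, four blocks of length at least 0.4. The count 4 replaces the larger geometric factor
  183/20.\<close>

lemma regime_4_IIa:
  assumes dd: "d = 2 / 7" and xx: "43 / 5 \<le> x" "x \<le> 21 / 2"
  shows "Z \<le> 1.546 * x * exp (1 / 14 * x)"
proof (rule le_linear_exp_if_chains[OF _ _ _ xx])
  show "Z \<le> 1 - 1 / (2 / 7) + exp_sum (cs_triv (2 / 7) 1 (- (16 / 5)) @ cs_2 (2 / 7) 1 (- (16 / 5)) 4 @ cs_tail (2 / 7)) x"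
    using regime_II[of "1" "- (16 / 5)" "4" 4] xx  unfolding dd by simp
  show "exp_chain (1 / 14 * (21 / 2)) [1059 / 500, 291 / 200]" "4721 / 10000 * (1059 / 500) \<le> (1 :: real)" by simp_all
  show "exp_sum_chains (exp_shift (1 / 14) (cs_triv (2 / 7) 1 (- (16 / 5)) @ cs_2 (2 / 7) 1 (- (16 / 5)) 4 @ cs_tail (2 / 7))) (43 / 5)
    [[127 / 50, 1591 / 1000], [84247 / 100000], [281 / 1000, 53 / 100, 72771 / 100000], [137 / 2500, 117 / 500, 483 / 1000, 6947 / 10000], [117 / 10000, 27 / 250, 41 / 125, 143 / 250, 75619 / 100000], [187 / 50000, 611 / 10000, 247 / 1000, 62 / 125, 70407 / 100000], [7 / 500, 59 / 500, 343 / 1000, 117 / 200, 38217 / 50000], [1 / 390625, 1 / 625, 1 / 25, 1 / 5, 447 / 1000, 8353 / 12500]]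
    (1.546 * (43 / 5) - (1 - 1 / (2 / 7)) * (4721 / 10000))"
    by (simp add: cs_triv_def cs_tail_def cs_2_def cs_3_def)
  show "exp_sum_chains (exp_shift (1 / 14) (cs_triv (2 / 7) 1 (- (16 / 5)) @ cs_2 (2 / 7) 1 (- (16 / 5)) 4 @ cs_tail (2 / 7))) (21 / 2)
    [[77 / 20, 49 / 25, 2793 / 2000], [49 / 100, 4373 / 6250], [641 / 10000, 253 / 1000, 251 / 500, 14157 / 20000], [321 / 10000, 179 / 1000, 211 / 500, 64913 / 100000], [131 / 50000, 511 / 10000, 113 / 500, 19 / 40, 68883 / 100000], [209 / 250000, 289 / 10000, 17 / 100, 103 / 250, 12827 / 20000], [133 / 25000, 729 / 10000, 27 / 100, 519 / 1000, 18007 / 25000], []]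
    (1.546 * (21 / 2) - (1 - 1 / (2 / 7)) * (4721 / 10000))"
    by (simp add: cs_triv_def cs_tail_def cs_2_def cs_3_def)
qed (simp_all add: cs_triv_def cs_tail_def cs_2_def cs_3_def)

lemma regime_4_II:
  assumes dd: "d = 2 / 7" and xx: "21 / 2 \<le> x" "x \<le> 27"
  shows "Z \<le> 1.546 * x * exp (1 / 14 * x)"
proof (rule le_linear_exp_if_chains[OF _ _ _ xx])
  show "Z \<le> 1 - 1 / (2 / 7) + exp_sum (cs_triv (2 / 7) (1 / 2) (1 / 2) @ cs_2 (2 / 7) (1 / 2) (1 / 2) (183 / 20) @ cs_tail (2 / 7)) x"
    using regime_II[of "1 / 2" "1 / 2" "183 / 20"] xx geometric_factors_7(1) unfolding dd by simp
  show "exp_chain (1 / 14 * (27)) [3443 / 500, 328 / 125, 161959 / 100000]" "363 / 2500 * (3443 / 500) \<le> (1 :: real)" by simp_all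
  show "exp_sum_chains (exp_shift (1 / 14) (cs_triv (2 / 7) (1 / 2) (1 / 2) @ cs_2 (2 / 7) (1 / 2) (1 / 2) (183 / 20) @ cs_tail (2 / 7))) (21 / 2)
    [[49 / 20, 3907 / 2500], [14813 / 10000], [1123 / 1250], [321 / 10000, 179 / 1000, 211 / 500, 64913 / 100000], [791 / 100000, 889 / 10000, 149 / 500, 109 / 200, 36909 / 50000], [209 / 250000, 289 / 10000, 17 / 100, 103 / 250, 12827 / 20000], [133 / 25000, 729 / 10000, 27 / 100, 519 / 1000, 18007 / 25000], []]
    (1.546 * (21 / 2) - (1 - 1 / (2 / 7)) * (363 / 2500))"
    by (simp add: cs_triv_def cs_tail_def cs_2_def cs_3_def)
  show "exp_sum_chains (exp_shift (1 / 14) (cs_triv (2 / 7) (1 / 2) (1 / 2) @ cs_2 (2 / 7) (1 / 2) (1 / 2) (183 / 20) @ cs_tail (2 / 7))) (27)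
    [[801 / 100, 283 / 100, 42 / 25, 3239 / 2500], [121 / 25, 11 / 5, 14813 / 10000], [293 / 100, 171 / 100, 817 / 625], [307 / 1000000, 7 / 400, 33 / 250, 181 / 500, 601 / 1000, 15493 / 20000], [687 / 100000000, 131 / 50000, 511 / 10000, 113 / 500, 19 / 40, 68883 / 100000], [], [9 / 6250000, 3 / 2500, 173 / 5000, 93 / 500, 431 / 1000, 32791 / 50000], []]
    (1.546 * (27) - (1 - 1 / (2 / 7)) * (363 / 2500))"
    by (simp add: cs_triv_def cs_tail_def cs_2_def cs_3_def)
qed (simp_all add: cs_triv_def cs_tail_def cs_2_def cs_3_def)

lemma regime_4_III:
  assumes dd: "d = 2 / 7" and xx: "27 \<le> x" "x \<le> 54"
  shows "Z \<le> 1.546 * x * exp (1 / 14 * x)"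
proof (rule le_linear_exp_if_chains[OF _ _ _ xx])
  show "Z \<le> 1 - 1 / (2 / 7) + exp_sum (cs_triv (2 / 7) (2 / 5) 0 @ cs_3 (2 / 7) (2 / 5) 0 (3 / 5) 0 (301 / 25) (183 / 20)
      @ cs_2 (2 / 7) (3 / 5) 0 (183 / 20) @ cs_tail (2 / 7)) x"
    using regime_III[of "2 / 5" "0" "3 / 5" "0" "301 / 25" "183 / 20"] xx geometric_factors_7 unfolding dd by simp
  show "exp_chain (1 / 14 * (54)) [479 / 10, 173 / 25, 263 / 100, 4049 / 2500]" "13 / 625 * (479 / 10) \<le> (1 :: real)" by simp_all
  show "exp_sum_chains (exp_shift (1 / 14) (cs_triv (2 / 7) (2 / 5) 0 @ cs_3 (2 / 7) (2 / 5) 0 (3 / 5) 0 (301 / 25) (183 / 20)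
      @ cs_2 (2 / 7) (3 / 5) 0 (183 / 20) @ cs_tail (2 / 7))) (27)
    [[33 / 10, 9 / 5, 167 / 125], [647 / 500], [17 / 100, 41 / 100, 6377 / 10000], [1], [73 / 1000, 27 / 100, 51 / 100, 446 / 625], [53 / 100000, 23 / 1000, 3 / 20, 19 / 50, 61 / 100, 7747 / 10000], [13 / 5000000, 1 / 625, 1 / 25, 1 / 5, 11 / 25, 6559 / 10000], [], [13 / 5000000, 1 / 625, 1 / 25, 1 / 5, 11 / 25, 6559 / 10000], []]
    (1.546 * (27) - (1 - 1 / (2 / 7)) * (13 / 625))"
    by (simp add: cs_triv_def cs_tail_def cs_2_def cs_3_def)
  show "exp_sum_chains (exp_shift (1 / 14) (cs_triv (2 / 7) (2 / 5) 0 @ cs_3 (2 / 7) (2 / 5) 0 (3 / 5) 0 (301 / 25) (183 / 20)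
      @ cs_2 (2 / 7) (3 / 5) 0 (183 / 20) @ cs_tail (2 / 7))) (54)
    [[11, 33 / 10, 9 / 5, 167 / 125], [17 / 10, 647 / 500], [29 / 1000, 17 / 100, 41 / 100, 6377 / 10000], [1], [27 / 5000, 73 / 1000, 27 / 100, 51 / 100, 446 / 625], [], [], [], [], []]
    (1.546 * (54) - (1 - 1 / (2 / 7)) * (13 / 625))"
    by (simp add: cs_triv_def cs_tail_def cs_2_def cs_3_def)
qed (simp_all add: cs_triv_def cs_tail_def cs_2_def cs_3_def)

lemma regime_5_Ta:
  assumes dd: "d = 1 / 6" and xx: "17 / 5 \<le> x" "x \<le> 5"
  shows "Z \<le> 1.546 * x * exp (1 / 30 * x)"
proof (rule le_linear_exp_if_chains[OF _ _ _ xx])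
  show "Z \<le> 1 - 1 / (1 / 6) + exp_sum (cs_triv (1 / 6) 1 (- 1.6) @ cs_tail (1 / 6)) x"
    using regime_T unfolding dd .
  show "exp_chain (1 / 30 * (5)) [5907 / 5000]" "423 / 500 * (5907 / 5000) \<le> (1 :: real)" by simp_all
  show "exp_sum_chains (exp_shift (1 / 30) (cs_triv (1 / 6) 1 (- 1.6) @ cs_tail (1 / 6))) (17 / 5)
    [[603 / 500], [21 / 100, 9 / 20, 6681 / 10000], [11 / 100, 8 / 25, 14 / 25, 7427 / 10000], [1 / 250, 63 / 1000, 1 / 4, 49 / 100, 6969 / 10000]]
    (1.546 * (17 / 5) - (1 - 1 / (1 / 6)) * (423 / 500))"
    by (simp add: cs_triv_def cs_tail_def cs_2_def cs_3_def)
  show "exp_sum_chains (exp_shift (1 / 30) (cs_triv (1 / 6) 1 (- 1.6) @ cs_tail (1 / 6))) (5)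
    [[373 / 250], [29 / 500, 6 / 25, 12 / 25, 6873 / 10000], [33 / 1000, 9 / 50, 21 / 50, 6457 / 10000], [29 / 100000, 17 / 1000, 13 / 100, 7 / 20, 59 / 100, 1917 / 2500]]
    (1.546 * (5) - (1 - 1 / (1 / 6)) * (423 / 500))"
    by (simp add: cs_triv_def cs_tail_def cs_2_def cs_3_def)
qed (simp_all add: cs_triv_def cs_tail_def cs_2_def cs_3_def)

lemma regime_5_Tb:
  assumes dd: "d = 1 / 6" and xx: "5 \<le> x" "x \<le> 21 / 2"
  shows "Z \<le> 1.546 * x * exp (1 / 30 * x)"
proof (rule le_linear_exp_if_chains[OF _ _ _ xx])
  show "Z \<le> 1 - 1 / (1 / 6) + exp_sum (cs_triv (1 / 6) 1 (- 1.6) @ cs_tail (1 / 6)) x"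
    using regime_T unfolding dd .
  show "exp_chain (1 / 30 * (21 / 2)) [35477 / 25000]" "3523 / 5000 * (35477 / 25000) \<le> (1 :: real)" by simp_all
  show "exp_sum_chains (exp_shift (1 / 30) (cs_triv (1 / 6) 1 (- 1.6) @ cs_tail (1 / 6))) (5)
    [[14919 / 10000], [251 / 5000, 28 / 125, 473 / 1000, 6873 / 10000], [303 / 10000, 87 / 500, 417 / 1000, 32283 / 50000], [13 / 62500, 9 / 625, 3 / 25, 173 / 500, 147 / 250, 76673 / 100000]]
    (1.546 * (5) - (1 - 1 / (1 / 6)) * (3523 / 5000))"
    by (simp add: cs_triv_def cs_tail_def cs_2_def cs_3_def)
  show "exp_sum_chains (exp_shift (1 / 30) (cs_triv (1 / 6) 1 (- 1.6) @ cs_tail (1 / 6))) (21 / 2)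
    [[157 / 50, 177 / 100, 3319 / 2500], [433 / 1000000, 13 / 625, 18 / 125, 379 / 1000, 12309 / 20000], [41 / 62500, 16 / 625, 4 / 25, 2 / 5, 63169 / 100000], []]
    (1.546 * (21 / 2) - (1 - 1 / (1 / 6)) * (3523 / 5000))"
    by (simp add: cs_triv_def cs_tail_def cs_2_def cs_3_def)
qed (simp_all add: cs_triv_def cs_tail_def cs_2_def cs_3_def)

lemma regime_5_II:
  assumes dd: "d = 1 / 6" and xx: "21 / 2 \<le> x" "x \<le> 34"
  shows "Z \<le> 1.546 * x * exp (1 / 30 * x)"
proof (rule le_linear_exp_if_chains[OF _ _ _ xx])
  show "Z \<le> 1 - 1 / (1 / 6) + exp_sum (cs_triv (1 / 6) (1 / 2) (1 / 2) @ cs_2 (1 / 6) (1 / 2) (1 / 2) (1531 / 100) @ cs_tail (1 / 6)) x"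
    using regime_II[of "1 / 2" "1 / 2" "1531 / 100"] xx geometric_factors_6(1) unfolding dd by simp
  show "exp_chain (1 / 30 * (34)) [3109 / 1000, 1763 / 1000, 26551 / 20000]" "201 / 625 * (3109 / 1000) \<le> (1 :: real)" by simp_all
  show "exp_sum_chains (exp_shift (1 / 30) (cs_triv (1 / 6) (1 / 2) (1 / 2) @ cs_2 (1 / 6) (1 / 2) (1 / 2) (1531 / 100) @ cs_tail (1 / 6))) (21 / 2)
    [[46 / 25, 2711 / 2000], [2229 / 2000], [33797 / 50000], [167 / 10000, 129 / 1000, 179 / 500, 299 / 500, 15463 / 20000], [59 / 10000, 48 / 625, 277 / 1000, 263 / 500, 72517 / 100000], [433 / 1000000, 13 / 625, 18 / 125, 379 / 1000, 12309 / 20000], [41 / 62500, 16 / 625, 4 / 25, 2 / 5, 63169 / 100000], []]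
    (1.546 * (21 / 2) - (1 - 1 / (1 / 6)) * (201 / 625))"
    by (simp add: cs_triv_def cs_tail_def cs_2_def cs_3_def)
  show "exp_sum_chains (exp_shift (1 / 30) (cs_triv (1 / 6) (1 / 2) (1 / 2) @ cs_2 (1 / 6) (1 / 2) (1 / 2) (1531 / 100) @ cs_tail (1 / 6))) (34)
    [[149 / 25, 61 / 25, 15619 / 10000], [361 / 100, 19 / 10, 13783 / 10000], [219 / 100, 2959 / 2000], [317 / 100000000, 89 / 50000, 421 / 10000, 41 / 200, 113 / 250, 67173 / 100000], [], [], [], []]
    (1.546 * (34) - (1 - 1 / (1 / 6)) * (201 / 625))"
    by (simp add: cs_triv_def cs_tail_def cs_2_def cs_3_def)
qed (simp_all add: cs_triv_def cs_tail_def cs_2_def cs_3_def)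

lemma regime_5_III:
  assumes dd: "d = 1 / 6" and xx: "34 \<le> x" "x \<le> 100"
  shows "Z \<le> 1.546 * x * exp (1 / 30 * x)"
proof (rule le_linear_exp_if_chains[OF _ _ _ xx])
  show "Z \<le> 1 - 1 / (1 / 6) + exp_sum (cs_triv (1 / 6) (7 / 20) 0 @ cs_3 (1 / 6) (7 / 20) 0 (3 / 5) 0 (198 / 25) (1531 / 100)
      @ cs_2 (1 / 6) (3 / 5) 0 (1531 / 100) @ cs_tail (1 / 6)) x"
    using regime_III[of "7 / 20" "0" "3 / 5" "0" "198 / 25" "1531 / 100"] xx geometric_factors_6 unfolding dd by simp
  show "exp_chain (1 / 30 * (100)) [143 / 5, 267 / 50, 231 / 100, 1517 / 1000]" "349 / 10000 * (143 / 5) \<le> (1 :: real)" by simp_all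
  show "exp_sum_chains (exp_shift (1 / 30) (cs_triv (1 / 6) (7 / 20) 0 @ cs_3 (1 / 6) (7 / 20) 0 (3 / 5) 0 (198 / 25) (1531 / 100)
      @ cs_2 (1 / 6) (3 / 5) 0 (1531 / 100) @ cs_tail (1 / 6))) (34)
    [[12 / 5, 153 / 100], [9 / 5, 166 / 125], [37 / 1000, 19 / 100, 43 / 100, 3269 / 5000], [33 / 100, 57 / 100, 7533 / 10000], [13 / 1000, 11 / 100, 33 / 100, 57 / 100, 7533 / 10000], [63 / 10000000, 1 / 400, 49 / 1000, 11 / 50, 23 / 50, 3359 / 5000], [], [], [], []]
    (1.546 * (34) - (1 - 1 / (1 / 6)) * (349 / 10000))"
    by (simp add: cs_triv_def cs_tail_def cs_2_def cs_3_def)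
  show "exp_sum_chains (exp_shift (1 / 30) (cs_triv (1 / 6) (7 / 20) 0 @ cs_3 (1 / 6) (7 / 20) 0 (3 / 5) 0 (198 / 25) (1531 / 100)
      @ cs_2 (1 / 6) (3 / 5) 0 (1531 / 100) @ cs_tail (1 / 6))) (100)
    [[14, 37 / 10, 19 / 10, 1367 / 1000], [29 / 5, 12 / 5, 1517 / 1000], [33 / 500000, 81 / 10000, 9 / 100, 3 / 10, 27 / 50, 7317 / 10000], [1 / 25, 1 / 5, 11 / 25, 6593 / 10000], [13 / 5000000, 1 / 625, 1 / 25, 1 / 5, 11 / 25, 6593 / 10000], [], [], [], [], []]
    (1.546 * (100) - (1 - 1 / (1 / 6)) * (349 / 10000))"
    by (simp add: cs_triv_def cs_tail_def cs_2_def cs_3_def)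
qed (simp_all add: cs_triv_def cs_tail_def cs_2_def cs_3_def)

text \<open>The exponent 0 instead of 1/62 gives a bound without any power of \<open>t\<close>. As
  \<open>d\<close> only bounds the width from above, this statement and the next ones up to
  \<open>x = 50\<close> serve every \<open>k \<ge> 6\<close>.\<close>

lemma regime_6_T:
  assumes dd: "d = 3 / 31" and xx: "17 / 5 \<le> x" "x \<le> 11"
  shows "Z \<le> 1.546 * x * exp (0 * x)"
proof (rule le_linear_exp_if_chains[OF _ _ _ xx])
  show "Z \<le> 1 - 1 / (3 / 31) + exp_sum (cs_triv (3 / 31) 1 (- 1.6) @ cs_tail (3 / 31)) x"
    using regime_T unfolding dd .
  show "exp_chain (0 * (11)) [1]" "1 * 1 \<le> (1 :: real)" by simp_all
  show "exp_sum_chains (exp_shift (0) (cs_triv (3 / 31) 1 (- 1.6) @ cs_tail (3 / 31))) (17 / 5)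
    [[1191 / 1000], [21 / 100, 9 / 20, 6661 / 10000], [73 / 1000, 27 / 100, 51 / 100, 7099 / 10000], [29 / 10000, 53 / 1000, 23 / 100, 47 / 100, 6813 / 10000]]
    (1.546 * (17 / 5) - (1 - 1 / (3 / 31)) * (1))"
    by (simp add: cs_triv_def cs_tail_def cs_2_def cs_3_def)
  show "exp_sum_chains (exp_shift (0) (cs_triv (3 / 31) 1 (- 1.6) @ cs_tail (3 / 31))) (11)
    [[5 / 2, 197 / 125], [29 / 100000, 17 / 1000, 13 / 100, 7 / 20, 59 / 100, 767 / 1000], [23 / 100000, 3 / 200, 3 / 25, 17 / 50, 29 / 50, 7579 / 10000], []]
    (1.546 * (11) - (1 - 1 / (3 / 31)) * (1))"
    by (simp add: cs_triv_def cs_tail_def cs_2_def cs_3_def)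
qed (simp_all add: cs_triv_def cs_tail_def cs_2_def cs_3_def)

lemma regime_6_II:
  assumes dd: "d = 3 / 31" and xx: "11 \<le> x" "x \<le> 30"
  shows "Z \<le> 1.546 * x * exp (0 * x)"
proof (rule le_linear_exp_if_chains[OF _ _ _ xx])
  show "Z \<le> 1 - 1 / (3 / 31) + exp_sum (cs_triv (3 / 31) (1 / 2) (1 / 2) @ cs_2 (3 / 31) (1 / 2) (1 / 2) 26 @ cs_tail (3 / 31)) x"
    using regime_II[of "1 / 2" "1 / 2" "26"] xx geometric_factors_31(1) unfolding dd by simp
  show "exp_chain (0 * (30)) [1]" "1 * 1 \<le> (1 :: real)" by simp_all
  show "exp_sum_chains (exp_shift (0) (cs_triv (3 / 31) (1 / 2) (1 / 2) @ cs_2 (3 / 31) (1 / 2) (1 / 2) 26 @ cs_tail (3 / 31))) (11)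
    [[179 / 100, 13369 / 10000], [271 / 250], [16437 / 25000], [21 / 2000, 51 / 500, 319 / 1000, 141 / 250, 3753 / 5000], [451 / 100000, 671 / 10000, 259 / 1000, 127 / 250, 7127 / 10000], [217 / 1000000, 147 / 10000, 121 / 1000, 347 / 1000, 589 / 1000, 9587 / 12500], [147 / 1000000, 121 / 10000, 11 / 100, 331 / 1000, 23 / 40, 75789 / 100000], []]
    (1.546 * (11) - (1 - 1 / (3 / 31)) * (1))"
    by (simp add: cs_triv_def cs_tail_def cs_2_def cs_3_def)
  show "exp_sum_chains (exp_shift (0) (cs_triv (3 / 31) (1 / 2) (1 / 2) @ cs_2 (3 / 31) (1 / 2) (1 / 2) 26 @ cs_tail (3 / 31))) (30)
    [[9 / 2, 53 / 25, 291 / 200], [68 / 25, 2061 / 1250], [2061 / 1250], [129 / 25000000, 227 / 100000, 119 / 2500, 109 / 500, 233 / 500, 68191 / 100000], [], [], [], []]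
    (1.546 * (30) - (1 - 1 / (3 / 31)) * (1))"
    by (simp add: cs_triv_def cs_tail_def cs_2_def cs_3_def)
qed (simp_all add: cs_triv_def cs_tail_def cs_2_def cs_3_def)

lemma regime_6_III:
  assumes dd: "d = 3 / 31" and xx: "30 \<le> x" "x \<le> 50"
  shows "Z \<le> 1.546 * x * exp (0 * x)"
proof (rule le_linear_exp_if_chains[OF _ _ _ xx])
  show "Z \<le> 1 - 1 / (3 / 31) + exp_sum (cs_triv (3 / 31) (2 / 5) 0 @ cs_3 (3 / 31) (2 / 5) 0 (3 / 5) 0 (166 / 25) 26
      @ cs_2 (3 / 31) (3 / 5) 0 26 @ cs_tail (3 / 31)) x"
    using regime_III[of "2 / 5" "0" "3 / 5" "0" "166 / 25" "26"] xx geometric_factors_31 unfolding dd by simp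
  show "exp_chain (0 * (50)) [1]" "1 * 1 \<le> (1 :: real)" by simp_all
  show "exp_sum_chains (exp_shift (0) (cs_triv (3 / 31) (2 / 5) 0 @ cs_3 (3 / 31) (2 / 5) 0 (3 / 5) 0 (166 / 25) 26
      @ cs_2 (3 / 31) (3 / 5) 0 26 @ cs_tail (3 / 31))) (30)
    [[33 / 10, 9 / 5, 1337 / 1000], [147 / 125], [9 / 200, 21 / 100, 9 / 20, 1331 / 2000], [3 / 10, 27 / 50, 3651 / 5000], [17 / 1000, 13 / 100, 7 / 20, 59 / 100, 479 / 625], [17 / 2000000, 29 / 10000, 53 / 1000, 23 / 100, 47 / 100, 341 / 500], [], [], [], []]
    (1.546 * (30) - (1 - 1 / (3 / 31)) * (1))"
    by (simp add: cs_triv_def cs_tail_def cs_2_def cs_3_def)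
  show "exp_sum_chains (exp_shift (0) (cs_triv (3 / 31) (2 / 5) 0 @ cs_3 (3 / 31) (2 / 5) 0 (3 / 5) 0 (166 / 25) 26
      @ cs_2 (3 / 31) (3 / 5) 0 26 @ cs_tail (3 / 31))) (50)
    [[73 / 10, 27 / 10, 1623 / 1000], [1309 / 1000], [27 / 5000, 73 / 1000, 27 / 100, 51 / 100, 7123 / 10000], [13 / 100, 9 / 25, 3 / 5, 1539 / 2000], [11 / 10000, 33 / 1000, 9 / 50, 21 / 50, 3209 / 5000], [], [], [], [], []]
    (1.546 * (50) - (1 - 1 / (3 / 31)) * (1))"
    by (simp add: cs_triv_def cs_tail_def cs_2_def cs_3_def)
qed (simp_all add: cs_triv_def cs_tail_def cs_2_def cs_3_def)

lemma regime_6_IIIa: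
  assumes dd: "d = 3 / 31" and xx: "50 \<le> x" "x \<le> 140"
  shows "Z \<le> 1.546 * x * exp (1 / 62 * x)"
proof (rule le_linear_exp_if_chains[OF _ _ _ xx])
  show "Z \<le> 1 - 1 / (3 / 31) + exp_sum (cs_triv (3 / 31) (7 / 20) 0 @ cs_3 (3 / 31) (7 / 20) 0 (3 / 5) 0 (166 / 25) 26
      @ cs_2 (3 / 31) (3 / 5) 0 26 @ cs_tail (3 / 31)) x"
    using regime_III[of "7 / 20" "0" "3 / 5" "0" "166 / 25" "26"] xx geometric_factors_31 unfolding dd by simp
  show "exp_chain (1 / 62 * (140)) [961 / 100, 31 / 10, 44 / 25, 6631 / 5000]" "13 / 125 * (961 / 100) \<le> (1 :: real)" by simp_all
  show "exp_sum_chains (exp_shift (1 / 62) (cs_triv (3 / 31) (7 / 20) 0 @ cs_3 (3 / 31) (7 / 20) 0 (3 / 5) 0 (166 / 25) 26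
      @ cs_2 (3 / 31) (3 / 5) 0 26 @ cs_tail (3 / 31))) (50)
    [[5 / 2, 1559 / 1000], [1601 / 1000], [1 / 400, 49 / 1000, 11 / 50, 23 / 50, 6773 / 10000], [63 / 1000, 1 / 4, 49 / 100, 6957 / 10000], [53 / 100000, 23 / 1000, 3 / 20, 19 / 50, 6103 / 10000], [], [], [], [], []]
    (1.546 * (50) - (1 - 1 / (3 / 31)) * (13 / 125))"
    by (simp add: cs_triv_def cs_tail_def cs_2_def cs_3_def)
  show "exp_sum_chains (exp_shift (1 / 62) (cs_triv (3 / 31) (7 / 20) 0 @ cs_3 (3 / 31) (7 / 20) 0 (3 / 5) 0 (166 / 25) 26
      @ cs_2 (3 / 31) (3 / 5) 0 26 @ cs_tail (3 / 31))) (140)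
    [[14, 37 / 10, 19 / 10, 273 / 200], [4, 2, 139 / 100], [], [53 / 100000, 23 / 1000, 3 / 20, 19 / 50, 61 / 100, 7757 / 10000], [], [], [], [], [], []]
    (1.546 * (140) - (1 - 1 / (3 / 31)) * (13 / 125))"
    by (simp add: cs_triv_def cs_tail_def cs_2_def cs_3_def)
qed (simp_all add: cs_triv_def cs_tail_def cs_2_def cs_3_def)

text \<open>Without a power of \<open>t\<close> again, now for every \<open>k \<ge> 7\<close>; the
  narrower strip extends the admissible interval to \<open>x = 90\<close>.\<close>

lemma regime_7_III:
  assumes dd: "d = 1 / 18" and xx: "50 \<le> x" "x \<le> 90"
  shows "Z \<le> 1.546 * x * exp (0 * x)"
proof (rule le_linear_exp_if_chains[OF _ _ _ xx])
  show "Z \<le> 1 - 1 / (1 / 18) + exp_sum (cs_triv (1 / 18) (7 / 20) 0 @ cs_3 (1 / 18) (7 / 20) 0 (3 / 5) 0 (607 / 100) 45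
      @ cs_2 (1 / 18) (3 / 5) 0 45 @ cs_tail (1 / 18)) x"
    using regime_III[of "7 / 20" "0" "3 / 5" "0" "607 / 100" "45"] xx geometric_factors_18 unfolding dd by simp
  show "exp_chain (0 * (90)) [1]" "1 * 1 \<le> (1 :: real)" by simp_all
  show "exp_sum_chains (exp_shift (0) (cs_triv (1 / 18) (7 / 20) 0 @ cs_3 (1 / 18) (7 / 20) 0 (3 / 5) 0 (607 / 100) 45
      @ cs_2 (1 / 18) (3 / 5) 0 45 @ cs_tail (1 / 18))) (50)
    [[27 / 10, 1627 / 1000], [9 / 5, 1321 / 1000], [1 / 625, 1 / 25, 1 / 5, 11 / 25, 6593 / 10000], [1 / 25, 1 / 5, 11 / 25, 6593 / 10000], [29 / 100000, 17 / 1000, 13 / 100, 9 / 25, 3 / 5, 1927 / 2500], [], [], [], [], []]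
    (1.546 * (50) - (1 - 1 / (1 / 18)) * (1))"
    by (simp add: cs_triv_def cs_tail_def cs_2_def cs_3_def)
  show "exp_sum_chains (exp_shift (0) (cs_triv (1 / 18) (7 / 20) 0 @ cs_3 (1 / 18) (7 / 20) 0 (3 / 5) 0 (607 / 100) 45
      @ cs_2 (1 / 18) (3 / 5) 0 45 @ cs_tail (1 / 18))) (90)
    [[29 / 5, 12 / 5, 1549 / 1000], [14 / 5, 1649 / 1000], [3 / 250000, 17 / 5000, 29 / 500, 6 / 25, 12 / 25, 6873 / 10000], [17 / 5000, 29 / 500, 6 / 25, 12 / 25, 6873 / 10000], [], [], [], [], [], []]
    (1.546 * (90) - (1 - 1 / (1 / 18)) * (1))"
    by (simp add: cs_triv_def cs_tail_def cs_2_def cs_3_def)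
qed (simp_all add: cs_triv_def cs_tail_def cs_2_def cs_3_def)

end

subsection \<open>Small arguments\<close>

text \<open>A rational \<open>p\<close> bounds \<open>n powr (- 5 / 7)\<close> as soon as
  \<open>n ^ 5 * p ^ 7 \<ge> 1\<close>.\<close>

lemma powr_minus_5_7:
  "real 2 powr (- (1 - 2 / 7)) \<le> 60951 / 100000"
  "real 3 powr (- (1 - 2 / 7)) \<le> 73 / 160"
  "real 4 powr (- (1 - 2 / 7)) \<le> 743 / 2000"
  "real 5 powr (- (1 - 2 / 7)) \<le> 31677 / 100000"
  "real 6 powr (- (1 - 2 / 7)) \<le> 27809 / 100000"
  "real 7 powr (- (1 - 2 / 7)) \<le> 2491 / 10000"
  "real 8 powr (- (1 - 2 / 7)) \<le> 5661 / 25000"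
  "real 9 powr (- (1 - 2 / 7)) \<le> 20817 / 100000"
proof -
  have "real n powr (- (1 - 2 / 7)) \<le> p" if "n > 0" "0 < p" "1 \<le> real n ^ 5 * p ^ 7" for n :: nat and p :: real
  proof -
    have "(inverse (real n) ^ 5) powr (1 / real 7) \<le> p"
      using that by (intro powr_le_if_le_power) (auto simp: field_simps)
    moreover have "(inverse (real n) ^ 5) powr (1 / real 7) = real n powr (- (1 - 2 / 7))"
      using that by (simp add: powr_powr powr_minus powr_def ln_inverse ln_realpow)
    ultimately show ?thesis by simp
  qed
  note p = this

  show "real 2 powr (- (1 - 2 / 7)) \<le> 60951 / 100000" by (rule p) (simp_all add: power_divide)
  show "real 3 powr (- (1 - 2 / 7)) \<le> 73 / 160" by (rule p) (simp_all add: power_divide)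
  show "real 4 powr (- (1 - 2 / 7)) \<le> 743 / 2000" by (rule p) (simp_all add: power_divide)
  show "real 5 powr (- (1 - 2 / 7)) \<le> 31677 / 100000" by (rule p) (simp_all add: power_divide)
  show "real 6 powr (- (1 - 2 / 7)) \<le> 27809 / 100000" by (rule p) (simp_all add: power_divide)
  show "real 7 powr (- (1 - 2 / 7)) \<le> 2491 / 10000" by (rule p) (simp_all add: power_divide)
  show "real 8 powr (- (1 - 2 / 7)) \<le> 5661 / 25000" by (rule p) (simp_all add: power_divide)
  show "real 9 powr (- (1 - 2 / 7)) \<le> 20817 / 100000" by (rule p) (simp_all add: power_divide)
qed

lemma sum_expansions:
  fixes f :: "nat \<Rightarrow> real"
  shows
  "(\<Sum>n=1..<1. f n) = 0"
  "(\<Sum>n=1..<2. f n) = f 1"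
  "(\<Sum>n=1..<4. f n) = f 1 + f 2 + f 3"
  "(\<Sum>n=1..<6. f n) = f 1 + f 2 + f 3 + f 4 + f 5"
  "(\<Sum>n=1..<9. f n) = f 1 + f 2 + f 3 + f 4 + f 5 + f 6 + f 7 + f 8"
  by (simp_all add: eval_nat_numeral)

lemma ln_lower_bounds:
  "549 / 500 \<le> ln (3 :: real)"
  "277 / 200 \<le> ln (4 :: real)"
  "1039 / 500 \<le> ln (8 :: real)"
  "1319 / 500 \<le> ln (14 :: real)"
  "309 / 100 \<le> ln (22 :: real)"
  "17 / 5 \<le> ln (30 :: real)"
proof -
  have e: "exp (549 / 500 :: real) \<le> 3"
    by (rule exp_le_chain[of _ _ "[433 / 250, 32897 / 25000]"]) simp
  then show "549 / 500 \<le> ln (3 :: real)" by (subst ln_ge_iff) simp_all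
  have e: "exp (277 / 200 :: real) \<le> 4"
    by (rule exp_le_chain[of _ _ "[2, 7069 / 5000]"]) simp
  then show "277 / 200 \<le> ln (4 :: real)" by (subst ln_ge_iff) simp_all
  have e: "exp (1039 / 500 :: real) \<le> 19973 / 2500"
    by (rule exp_le_chain[of _ _ "[5653 / 2000, 4203 / 2500, 1296607 / 1000000]"]) simp
  then show "1039 / 500 \<le> ln (8 :: real)" by (subst ln_ge_iff) simp_all
  have e: "exp (1319 / 500 :: real) \<le> 14"
    by (rule exp_le_chain[of _ _ "[3741 / 1000, 967 / 500, 139063 / 100000]"]) simp
  then show "1319 / 500 \<le> ln (14 :: real)" by (subst ln_ge_iff) simp_all
  have e: "exp (309 / 100 :: real) \<le> 21983 / 1000"
    by (rule exp_le_chain[of _ _ "[23443 / 5000, 21653 / 10000, 735731 / 500000]"]) simp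
  then show "309 / 100 \<le> ln (22 :: real)" by (subst ln_ge_iff) simp_all
  have e: "exp (17 / 5 :: real) \<le> 2999 / 100"
    by (rule exp_le_chain[of _ _ "[1369 / 250, 117 / 50, 152961 / 100000]"]) simp
  then show "17 / 5 \<le> ln (30 :: real)" by (subst ln_ge_iff) simp_all
qed

text \<open>The left-hand side is convex in \<open>t\<close> and the logarithm is concave, so the
  comparison at the end points carries over to the interval.\<close>

lemma convex_le_ln:
  fixes A B C t t0 t1 :: real
  assumes t: "0 < t0" "t0 < t1" "t0 \<le> t" "t \<le> t1" and pos: "0 \<le> B" "0 \<le> C" "0 \<le> be"
    and e0: "A + B / t0 + C * t0\<^sup>2 \<le> be * l0" "l0 \<le> ln t0"
    and e1: "A + B / t1 + C * t1\<^sup>2 \<le> be * l1" "l1 \<le> ln t1"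
  shows "A + B / t + C * t\<^sup>2 \<le> be * ln t"
proof -
  define u where "u = (t - t0) / (t1 - t0)"
  have u: "0 \<le> u" "u \<le> 1" using t by (auto simp: u_def)
  have "u * (t1 - t0) = t - t0" using t by (simp add: u_def)
  then have te: "t = (1 - u) * t0 + u * t1" by (simp add: algebra_simps)
  have "((1 - u) *\<^sub>R t0 + u *\<^sub>R t1)\<^sup>2 \<le> (1 - u) * t0\<^sup>2 + u * t1\<^sup>2"
    using convex_onD[OF convex_power2, of u t0 t1] u by simp
  then have sq: "t\<^sup>2 \<le> (1 - u) * t0\<^sup>2 + u * t1\<^sup>2" by (simp add: te)
  have inv: "1 / t \<le> (1 - u) * (1 / t0) + u * (1 / t1)"
  proof -
    have "t0 * t1 \<le> ((1 - u) * t1 + u * t0) * t"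
    proof -
      have "((1 - u) * t1 + u * t0) * t - t0 * t1 = u * (1 - u) * (t1 - t0)\<^sup>2"
        unfolding te by (simp add: algebra_simps power2_eq_square)
      moreover have "0 \<le> u * (1 - u) * (t1 - t0)\<^sup>2" using u by simp
      ultimately show ?thesis by linarith
    qed
    then show ?thesis using t by (simp add: field_simps)
  qed
  have "(1 - u) * ln t0 + u * ln t1 \<le> ln t"
    using concave_onD[OF ln_concave, of u t0 t1] t u by (simp add: te)
  then have ln: "be * ((1 - u) * ln t0 + u * ln t1) \<le> be * ln t" using pos by (intro mult_left_mono) auto
  have "A + B / t + C * t\<^sup>2 \<le> A + B * ((1 - u) * (1 / t0) + u * (1 / t1)) + C * ((1 - u) * t0\<^sup>2 + u * t1\<^sup>2)"
    using sq mult_left_mono[OF inv pos(1)] pos by (intro add_mono mult_left_mono) auto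
  also have "\<dots> = (1 - u) * (A + B / t0 + C * t0\<^sup>2) + u * (A + B / t1 + C * t1\<^sup>2)"
    by (simp add: algebra_simps)
  also have "\<dots> \<le> (1 - u) * (be * ln t0) + u * (be * ln t1)"
    using u e0 e1 mult_left_mono[OF e0(2) pos(3)] mult_left_mono[OF e1(2) pos(3)]
    by (intro add_mono mult_left_mono) auto
  also have "\<dots> = be * ((1 - u) * ln t0 + u * ln t1)" by (simp add: algebra_simps)
  finally show ?thesis using ln by linarith
qed

text \<open>Euler-Maclaurin with a fixed number of terms, all taken trivially at the largest width
  2/7. \<open>N * p\<close> bounds \<open>N powr (2 / 7)\<close>, \<open>p / N\<close> bounds
  \<open>N powr (- 12 / 7)\<close>, and \<open>7 / 96 = 1 / (8 * (2 - 2 / 7))\<close>.\<close>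

lemma zeta_small_piece:
  fixes sg t p q t0 t1 :: real and N :: nat
  assumes sg: "0 < sg" "sg < 1" "1 - sg \<le> 2 / 7" and N: "N \<ge> 1"
    and t: "0 < t0" "t0 < t1" "t0 \<le> t" "t \<le> t1"
    and p: "(\<Sum>n=1..<N. real n powr (- (1 - 2 / 7))) \<le> q" "real N powr (- (1 - 2 / 7)) \<le> p"
    and e0: "q + p / 2 + 2.5 * 7 / 96 * (p / N) + (real N * p) / t0 + 7 / 96 * (p / N) * t0\<^sup>2 \<le> 1.546 * l0" "l0 \<le> ln t0"
    and e1: "q + p / 2 + 2.5 * 7 / 96 * (p / N) + (real N * p) / t1 + 7 / 96 * (p / N) * t1\<^sup>2 \<le> 1.546 * l1" "l1 \<le> ln t1"
  shows "norm (riemann_zeta (Complex sg t)) \<le> 1.546 * ln t"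
proof -
  define r where "r = real N powr (- (1 - 2 / 7))"
  have r: "0 \<le> r" "r \<le> p" using p by (auto simp: r_def)
  have Nd: "real N powr (2 / 7) = real N * r" "real N powr (- (2 - 2 / 7)) = r / real N"
  proof -
    have "real N * r = real N powr 1 * real N powr (- (1 - 2 / 7))" using N by (simp add: r_def)
    also have "\<dots> = real N powr (2 / 7)" by (simp only: powr_add[symmetric]) simp
    finally show "real N powr (2 / 7) = real N * r" by simp
    have "real N powr (- (2 - 2 / 7)) = real N powr (- (1 - 2 / 7)) / real N powr 1"
      by (simp only: powr_diff[symmetric]) simp
    then show "real N powr (- (2 - 2 / 7)) = r / real N" using N by (simp add: r_def)
  qed
  let ?S = "\<Sum>n=1..<N. of_nat n powr (- Complex sg t)"
  have "norm (riemann_zeta (Complex sg t) - ?S) \<le> r / 2 + real N * r / t + (t\<^sup>2 + 2.5) / (8 * (2 - 2 / 7)) * (r / real N)"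
    using norm_zeta_minus_sum[OF N _ sg, of t] t unfolding Nd r_def by simp
  also have "\<dots> \<le> p / 2 + real N * p / t + (t\<^sup>2 + 2.5) / (8 * (2 - 2 / 7)) * (p / real N)"
    using r t by (intro add_mono divide_right_mono mult_left_mono) auto
  finally have 1: "norm (riemann_zeta (Complex sg t) - ?S) \<le> p / 2 + real N * p / t + (t\<^sup>2 + 2.5) / (8 * (2 - 2 / 7)) * (p / real N)" .
  have "norm ?S \<le> (\<Sum>n=1..<N. real n powr (- (1 - 2 / 7)))"
  proof (rule sum_norm_le)
    fix n assume "n \<in> {1..<N}"
    then show "norm (of_nat n powr (- Complex sg t)) \<le> real n powr (- (1 - 2 / 7))"
      using powr_minus_le_of_nat[OF _ sg(3), of n] by (simp add: powr_Complex_eq norm_mult)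
  qed
  then have 2: "norm ?S \<le> q" using p by simp
  have "norm (riemann_zeta (Complex sg t)) \<le> norm ?S + norm (riemann_zeta (Complex sg t) - ?S)"
    by (rule norm_triangle_sub)
  also have "\<dots> \<le> (q + p / 2 + 2.5 * 7 / 96 * (p / N)) + (real N * p) / t + (7 / 96 * (p / N)) * t\<^sup>2"
  proof -
    have "(t\<^sup>2 + 2.5) / (8 * (2 - 2 / 7)) * w = 2.5 * 7 / 96 * w + (7 / 96 * w) * t\<^sup>2" for w :: real
      by (simp add: field_simps)
    then show ?thesis using 1 2 by (simp only:)
  qed
  also have "\<dots> \<le> 1.546 * ln t"
    using t r e0 e1 N by (intro convex_le_ln[of t0 t1]) auto
  finally show ?thesis .
qed

lemma zeta_small:
  fixes sg t :: real
  assumes sg: "0 < sg" "sg < 1" "1 - sg \<le> 2 / 7" and t: "3 \<le> t" "t \<le> 30"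
  shows "norm (riemann_zeta (Complex sg t)) \<le> 1.546 * ln t"
proof -
  \<comment> \<open>The cut-off \<open>N\<close> grows with \<open>t\<close>: more terms enlarge the
    trivial sum, fewer enlarge the error proportional to \<open>t\<^sup>2\<close>.\<close>
  have c3: ?thesis if "3 \<le> t" "t \<le> 4"
  proof (rule zeta_small_piece[OF sg, of 1 3 4 _ "0" "1" "549 / 500" "277 / 200"])
    show "(\<Sum>n=1..<1. real n powr (- (1 - 2 / 7))) \<le> 0"
      unfolding sum_expansions using powr_minus_5_7 by simp
  qed (use that powr_minus_5_7 ln_lower_bounds in \<open>simp_all add: power2_eq_square\<close>)
  have c4: ?thesis if "4 \<le> t" "t \<le> 8"
  proof (rule zeta_small_piece[OF sg, of 2 4 8 _ "1" "60951 / 100000" "277 / 200" "1039 / 500"])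
    show "(\<Sum>n=1..<2. real n powr (- (1 - 2 / 7))) \<le> 1"
      unfolding sum_expansions using powr_minus_5_7 by simp
  qed (use that powr_minus_5_7 ln_lower_bounds in \<open>simp_all add: power2_eq_square\<close>)
  have c8: ?thesis if "8 \<le> t" "t \<le> 14"
  proof (rule zeta_small_piece[OF sg, of 4 8 14 _ "12911 / 6250" "743 / 2000" "1039 / 500" "1319 / 500"])
    show "(\<Sum>n=1..<4. real n powr (- (1 - 2 / 7))) \<le> 12911 / 6250"
      unfolding sum_expansions using powr_minus_5_7 by simp
  qed (use that powr_minus_5_7 ln_lower_bounds in \<open>simp_all add: power2_eq_square\<close>)
  have c14: ?thesis if "14 \<le> t" "t \<le> 22"
  proof (rule zeta_small_piece[OF sg, of 6 14 22 _ "275403 / 100000" "27809 / 100000" "1319 / 500" "309 / 100"])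
    show "(\<Sum>n=1..<6. real n powr (- (1 - 2 / 7))) \<le> 275403 / 100000"
      unfolding sum_expansions using powr_minus_5_7 by simp
  qed (use that powr_minus_5_7 ln_lower_bounds in \<open>simp_all add: power2_eq_square\<close>)
  have c22: ?thesis if "22 \<le> t" "t \<le> 30"
  proof (rule zeta_small_piece[OF sg, of 9 22 30 _ "175383 / 50000" "20817 / 100000" "309 / 100" "17 / 5"])
    show "(\<Sum>n=1..<9. real n powr (- (1 - 2 / 7))) \<le> 175383 / 50000"
      unfolding sum_expansions using powr_minus_5_7 by simp
  qed (use that powr_minus_5_7 ln_lower_bounds in \<open>simp_all add: power2_eq_square\<close>)
  show ?thesis
    using t c3 c4 c8 c14 c22 by (cases "t \<le> 4"; cases "t \<le> 8"; cases "t \<le> 14"; cases "t \<le> 22"; simp)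
qed

section \<open>Assembly of all cases\<close>

lemma zeta_large_4:
  assumes x: "17 / 5 \<le> x"
  shows "norm (riemann_zeta (Complex (1 - strip_width 4) (exp x))) \<le> 1.546 * x * exp (x / (2 ^ 4 - 2))"
proof -
  interpret zeta_strip "1 - strip_width 4" "2 / 7" x
    by unfold_locales (use x in \<open>simp_all add: strip_width_values\<close>)
  consider "x \<le> 43 / 5" | "43 / 5 \<le> x" "x \<le> 21 / 2" | "21 / 2 \<le> x" "x \<le> 27" | "27 \<le> x" "x \<le> 54" | "54 \<le> x"
    by linarith
  then have "Z \<le> 1.546 * x * exp (1 / 14 * x)"
    using regime_4_T regime_4_IIa regime_4_II regime_4_III regime_4_high assms by cases auto
  then show ?thesis by simp
qed

lemma zeta_large_5:
  assumes x: "17 / 5 \<le> x"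
  shows "norm (riemann_zeta (Complex (1 - strip_width 5) (exp x))) \<le> 1.546 * x * exp (x / (2 ^ 5 - 2))"
proof (cases "100 \<le> x")
  case False
  interpret zeta_strip "1 - strip_width 5" "1 / 6" x
    by unfold_locales (use x in \<open>simp_all add: strip_width_values\<close>)
  consider "x \<le> 5" | "5 \<le> x" "x \<le> 21 / 2" | "21 / 2 \<le> x" "x \<le> 34" | "34 \<le> x" "x \<le> 100"
    using False by linarith
  then have "Z \<le> 1.546 * x * exp (1 / 30 * x)"
    using regime_5_Ta regime_5_Tb regime_5_II regime_5_III assms by cases auto
  then show ?thesis by simp
qed (rule zeta_5_high)

lemma le_times_exp_if_nonneg:
  fixes z x y :: real
  assumes "z \<le> 1.546 * x" "0 \<le> x" "0 \<le> y"
  shows "z \<le> 1.546 * x * exp y"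
proof -
  have "1.546 * x * 1 \<le> 1.546 * x * exp y" using assms by (intro mult_left_mono) auto
  then show ?thesis using assms(1) by simp
qed

lemma zeta_large_ge_6:
  assumes k: "6 \<le> k" and x: "17 / 5 \<le> x" "x \<le> 50"
  shows "norm (riemann_zeta (Complex (1 - strip_width k) (exp x))) \<le> 1.546 * x"
proof -
  have "strip_width k \<le> 3 / 31" "0 < strip_width k"
    using strip_width_antimono[of 6 k] k strip_width_values two_power_minus_two_pos[of k] by (auto simp: strip_width_def)
  then interpret zeta_strip "1 - strip_width k" "3 / 31" x
    by unfold_locales (use x in simp_all)
  consider "x \<le> 11" | "11 \<le> x" "x \<le> 30" | "30 \<le> x" using x by linarith
  then have "Z \<le> 1.546 * x * exp (0 * x)" using regime_6_T regime_6_II regime_6_III assms by cases auto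
  then show ?thesis by simp
qed

lemma zeta_large_6:
  assumes x: "17 / 5 \<le> x"
  shows "norm (riemann_zeta (Complex (1 - strip_width 6) (exp x))) \<le> 1.546 * x * exp (x / (2 ^ 6 - 2))"
proof -
  interpret zeta_strip "1 - strip_width 6" "3 / 31" x
    by unfold_locales (use x in \<open>simp_all add: strip_width_values\<close>)
  consider "x \<le> 50" | "50 \<le> x" "x \<le> 140" | "140 \<le> x" by linarith
  then show ?thesis
  proof cases
    case 1
    then show ?thesis using le_times_exp_if_nonneg[OF zeta_large_ge_6[of 6 x]] assms by simp
  next
    case 2
    then show ?thesis using regime_6_IIIa by simp
  qed (rule zeta_6_high)
qed

lemma zeta_large_ge_7:
  assumes k: "7 \<le> k" and x: "17 / 5 \<le> x"
  shows "norm (riemann_zeta (Complex (1 - strip_width k) (exp x))) \<le> 1.546 * x * exp (x / (2 ^ k - 2))"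
\<comment> \<open>Outside the high range either \<open>x \<le> 90\<close>, where single checks serve
  all \<open>k \<ge> 7\<close>, or \<open>strip_width k * x \<le> 5\<close>. Both give a bound
  without a power of \<open>t\<close>.\<close>
proof (cases "90 \<le> x \<and> 5 \<le> strip_width k * x")
  case False
  have w: "strip_width k \<le> 1 / 18" "0 < strip_width k" and pos: "(2::real) ^ k - 2 > 0"
    using strip_width_antimono[of 7 k] k strip_width_values two_power_minus_two_pos[of k] by (auto simp: strip_width_def)
  interpret zeta_strip "1 - strip_width k" "1 / 18" x
    by unfold_locales (use x w in simp_all)
  consider "x \<le> 50" | "50 \<le> x" "x \<le> 90" | "90 \<le> x" "strip_width k * x \<le> 5" using False by linarith
  then have "Z \<le> 1.546 * x"
    using zeta_large_ge_6[of k x] regime_7_III zeta_ge_7_middle[OF k] k assms by cases auto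
  then show ?thesis by (rule le_times_exp_if_nonneg) (use pos assms in auto)
qed (rule zeta_ge_7_high[OF k], simp)

theorem theorem1p1:
  fixes k :: nat and t :: real
  assumes "k \<ge> 4" and "t \<ge> 3"
  shows "norm (riemann_zeta (complex_of_real (zeta_sigma k) + \<i> * complex_of_real t))
           \<le> 1.546 * t powr (1 / (2 ^ k - 2)) * ln t"
proof -
  have w: "0 < strip_width k" "strip_width k \<le> 2 / 7" and pos: "(2::real) ^ k - 2 > 0"
    using strip_width_antimono[of 4 k] assms strip_width_values two_power_minus_two_pos[of k] by (auto simp: strip_width_def)
  have t: "exp (ln t) = t" "0 < ln t" using assms by simp_all
  have "norm (riemann_zeta (Complex (1 - strip_width k) t)) \<le> 1.546 * ln t * exp (ln t / (2 ^ k - 2))"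
  proof (cases "t \<le> 30")
    case True
    then have "norm (riemann_zeta (Complex (1 - strip_width k) t)) \<le> 1.546 * ln t" using assms w by (intro zeta_small) auto
    then show ?thesis by (rule le_times_exp_if_nonneg) (use t pos in simp_all)
  next
    case False
    then have "ln 30 \<le> ln t" by simp
    then have x: "17 / 5 \<le> ln t" using ln_lower_bounds by linarith
    consider "k = 4" | "k = 5" | "k = 6" | "7 \<le> k" using assms by linarith
    then show ?thesis
    proof cases
      case 1 then show ?thesis using zeta_large_4[OF x] by (simp only: t)
    next
      case 2 then show ?thesis using zeta_large_5[OF x] by (simp only: t)
    next
      case 3 then show ?thesis using zeta_large_6[OF x] by (simp only: t)
    next
      case 4 from zeta_large_ge_7[OF this x] show ?thesis by (simp only: t)
    qed
  qed
  moreover have "complex_of_real (zeta_sigma k) + \<i> * complex_of_real t = Complex (1 - strip_width k) t"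
    by (simp add: complex_eq_iff zeta_sigma_def strip_width_def)
  moreover have "t powr (1 / (2 ^ k - 2)) = exp (ln t / (2 ^ k - 2))" using assms by (simp add: powr_def)
  ultimately show ?thesis by (simp add: mult_ac)
qed

end
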